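(* Let $\mathscr{C}$ be a small category, $J$ a Grothendieck topology on $\mathscr{C}^{\mathrm{op}}$, and $\mathcal{O}$ a structure sheaf on the site $(\mathscr{C}^{\mathrm{op}}, J)$. Then there is an equivalence of categories $$\mathrm{Sh}(\mathscr{C}^{\mathrm{op}}, J, \mathcal{O}) \simeq \mathcal{O}\text{-Mod} / \mathcal{T}(J),$$ that is, the category of sheaves of modules on $(\mathscr{C}^{\mathrm{op}}, J, \mathcal{O})$ is equivalent to the Serre quotient of the category of $\mathcal{O}$-modules by the category of $J$-torsion $\mathcal{O}$-modules.
   Context: Presheaves on $\mathscr{C}^{\mathrm{op}}$ are covariant functors on $\mathscr{C}$. A sieve on $x$ in $\mathscr{C}^{\mathrm{op}}$ is a subfunctor $S \subseteq \mathscr{C}(x,-)$ (possibly empty), i.e. a set of morphisms with domain $x$ closed under post-composition. For $f: x \to y$ put $f^{\ast}(S) = \{ g: y \to \bullet \mid gf \in S\}$. A Grothendieck topology $J$ on $\mathscr{C}^{\mathrm{op}}$ assigns to each object $x$ a collection $J(x)$ of subfunctors of $\mathscr{C}(x,-)$ such that: $\mathscr{C}(x,-) \in J(x)$; $S \in J(x)$ implies $f^{\ast}(S) \in J(y)$ for every $f: x \to y$; and if $S \in J(x)$ and $T \subseteq \mathscr{C}(x,-)$ is a subfunctor with $f^{\ast}(T) \in J(y)$ for every $(f: x \to y) \in S$, then $T \in J(x)$. A presheaf of sets $F: \mathscr{C} \to \mathrm{Set}$ is a sheaf if for all $x$ and $S \in J(x)$ the restriction map $\mathrm{Nat}(\mathscr{C}(x,-),F)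 \to \mathrm{Nat}(S,F)$ is a bijection. A structure sheaf $\mathcal{O}$ is a covariant functor from $\mathscr{C}$ to associative rings whose underlying presheaf of sets is a sheaf. An $\mathcal{O}$-module is a covariant functor $V: \mathscr{C} \to \mathrm{Ab}$ such that each $V_x$ is a left $\mathcal{O}_x$-module and each $V_f: V_x \to V_y$ is $\mathcal{O}_x$-linear, $V_y$ being an $\mathcal{O}_x$-module via $\mathcal{O}_f$; it is a sheaf of modules if its underlying presheaf of sets is a sheaf. $\mathcal{O}\text{-Mod}$ is the category of $\mathcal{O}$-modules and $\mathrm{Sh}(\mathscr{C}^{\mathrm{op}}, J, \mathcal{O})$ its full subcategory of sheaves of modules. An element $v \in V_x$ is $J$-torsion if there is $S \in J(x)$ with $V_f(v) = 0$ for all $f \in S$ (every $v\in V_x$ is $J$-torsion if $\emptyset \in J(x)$). $V$ is $J$-torsion if all its elements are $J$-torsion; $\mathcal{T}(J)$ is the full subcategory of $\mathcal{O}\text{-Mod}$ of $J$-torsion modules. *)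

theory Defs
  imports "HOL-Algebra.Module" "HOL-Library.Equipollence"
begin

section \<open>Categories\<close>

record ('o, 'm) cat =
  Obj :: "'o set"
  Arr :: "'m set"
  Dom :: "'m \<Rightarrow> 'o"
  Cod :: "'m \<Rightarrow> 'o"
  Ident :: "'o \<Rightarrow> 'm"
  Comp :: "'m \<Rightarrow> 'm \<Rightarrow> 'm"  (infixl \<open>\<cdot>\<index>\<close> 75)

definition Hom :: "('o, 'm) cat \<Rightarrow> 'o \<Rightarrow> 'o \<Rightarrow> 'm set" where
  "Hom C x y = {f \<in> Arr C. Dom C f = x \<and> Cod C f = y}"

locale category =
  fixes C :: "('o, 'm) cat" (structure)
  assumes dom_obj: "f \<in> Arr C \<Longrightarrow> Dom C f \<in> Obj C"
    and cod_obj: "f \<in> Arr C \<Longrightarrow> Cod C f \<in> Obj C"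
    and ident_hom: "x \<in> Obj C \<Longrightarrow> Ident C x \<in> Hom C x x"
    and comp_hom: "\<lbrakk>f \<in> Hom C x y; g \<in> Hom C y z\<rbrakk> \<Longrightarrow> g \<cdot> f \<in> Hom C x z"
    and ident_left: "f \<in> Hom C x y \<Longrightarrow> Ident C y \<cdot> f = f"
    and ident_right: "f \<in> Hom C x y \<Longrightarrow> f \<cdot> Ident C x = f"
    and comp_assoc: "\<lbrakk>f \<in> Hom C w x; g \<in> Hom C x y; h \<in> Hom C y z\<rbrakk>
      \<Longrightarrow> h \<cdot> (g \<cdot> f) = (h \<cdot> g) \<cdot> f"

definition full_subcategory :: "('o, 'm) cat \<Rightarrow> 'o set \<Rightarrow> ('o, 'm) cat" where
  "full_subcategory C P = C\<lparr>
     Obj := Obj C \<inter> P,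
     Arr := {f \<in> Arr C. Dom C f \<in> P \<and> Cod C f \<in> P}\<rparr>"

record ('o, 'm, 'p, 'n) cat_functor =
  on_Obj :: "'o \<Rightarrow> 'p"
  on_Arr :: "'m \<Rightarrow> 'n"

definition is_functor ::
  "('o, 'm) cat \<Rightarrow> ('p, 'n) cat \<Rightarrow> ('o, 'm, 'p, 'n) cat_functor \<Rightarrow> bool" where
  "is_functor A B F \<longleftrightarrow>
     on_Obj F \<in> Obj A \<rightarrow> Obj B \<and>
     (\<forall>x y. \<forall>f \<in> Hom A x y. on_Arr F f \<in> Hom B (on_Obj F x) (on_Obj F y)) \<and>
     (\<forall>x \<in> Obj A. on_Arr F (Ident A x) = Ident B (on_Obj F x)) \<and>
     (\<forall>x y z. \<forall>f \<in> Hom A x y. \<forall>g \<in> Hom A y z.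
        on_Arr F (g \<cdot>\<^bsub>A\<^esub> f) = on_Arr F g \<cdot>\<^bsub>B\<^esub> on_Arr F f)"

definition id_functor :: "('o, 'm, 'o, 'm) cat_functor" where
  "id_functor = \<lparr>on_Obj = (\<lambda>x. x), on_Arr = (\<lambda>f. f)\<rparr>"

definition comp_functor ::
  "('p, 'n, 'q, 'l) cat_functor \<Rightarrow> ('o, 'm, 'p, 'n) cat_functor \<Rightarrow> ('o, 'm, 'q, 'l) cat_functor" where
  "comp_functor G F = \<lparr>on_Obj = on_Obj G \<circ> on_Obj F, on_Arr = on_Arr G \<circ> on_Arr F\<rparr>"

definition is_iso :: "('o, 'm) cat \<Rightarrow> 'm \<Rightarrow> bool" where
  "is_iso A f \<longleftrightarrow> f \<in> Arr A \<and>
     (\<exists>g \<in> Hom A (Cod A f) (Dom A f).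
        g \<cdot>\<^bsub>A\<^esub> f = Ident A (Dom A f) \<and> f \<cdot>\<^bsub>A\<^esub> g = Ident A (Cod A f))"

definition naturally_isomorphic ::
  "('o, 'm) cat \<Rightarrow> ('p, 'n) cat \<Rightarrow>
   ('o, 'm, 'p, 'n) cat_functor \<Rightarrow> ('o, 'm, 'p, 'n) cat_functor \<Rightarrow> bool" where
  "naturally_isomorphic A B F G \<longleftrightarrow>
     (\<exists>\<tau>. (\<forall>x \<in> Obj A. \<tau> x \<in> Hom B (on_Obj F x) (on_Obj G x) \<and> is_iso B (\<tau> x)) \<and>
          (\<forall>x y. \<forall>f \<in> Hom A x y. \<tau> y \<cdot>\<^bsub>B\<^esub> on_Arr F f = on_Arr G f \<cdot>\<^bsub>B\<^esub> \<tau> x))"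

definition equivalent_categories :: "('o, 'm) cat \<Rightarrow> ('p, 'n) cat \<Rightarrow> bool" where
  "equivalent_categories A B \<longleftrightarrow> category A \<and> category B \<and>
     (\<exists>F G. is_functor A B F \<and> is_functor B A G \<and>
        naturally_isomorphic A A (comp_functor G F) id_functor \<and>
        naturally_isomorphic B B (comp_functor F G) id_functor)"


section \<open>Serre quotients\<close>

definition zero_object :: "('o, 'm) cat \<Rightarrow> 'o \<Rightarrow> bool" where
  "zero_object A z \<longleftrightarrow> z \<in> Obj A \<and>
     (\<forall>x \<in> Obj A. (\<exists>!f. f \<in> Hom A z x) \<and> (\<exists>!f. f \<in> Hom A x z))"

definition zero_arrow :: "('o, 'm) cat \<Rightarrow> 'm \<Rightarrow> bool" where
  "zero_arrow A f \<longleftrightarrow> (\<exists>z. zero_object A z \<and>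
     (\<exists>g \<in> Hom A (Dom A f) z. \<exists>h \<in> Hom A z (Cod A f). f = h \<cdot>\<^bsub>A\<^esub> g))"

definition is_kernel :: "('o, 'm) cat \<Rightarrow> 'm \<Rightarrow> 'm \<Rightarrow> bool" where
  "is_kernel A k f \<longleftrightarrow> f \<in> Arr A \<and> k \<in> Arr A \<and> Cod A k = Dom A f \<and> zero_arrow A (f \<cdot>\<^bsub>A\<^esub> k) \<and>
     (\<forall>h \<in> Arr A. Cod A h = Dom A f \<and> zero_arrow A (f \<cdot>\<^bsub>A\<^esub> h) \<longrightarrow>
        (\<exists>!u. u \<in> Hom A (Dom A h) (Dom A k) \<and> k \<cdot>\<^bsub>A\<^esub> u = h))"

definition is_cokernel :: "('o, 'm) cat \<Rightarrow> 'm \<Rightarrow> 'm \<Rightarrow> bool" where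
  "is_cokernel A c f \<longleftrightarrow> f \<in> Arr A \<and> c \<in> Arr A \<and> Dom A c = Cod A f \<and> zero_arrow A (c \<cdot>\<^bsub>A\<^esub> f) \<and>
     (\<forall>h \<in> Arr A. Dom A h = Cod A f \<and> zero_arrow A (h \<cdot>\<^bsub>A\<^esub> f) \<longrightarrow>
        (\<exists>!u. u \<in> Hom A (Cod A c) (Cod A h) \<and> u \<cdot>\<^bsub>A\<^esub> c = h))"

text \<open>
  The Serre quotient of an abelian category \<open>A\<close> by a Serre subcategory \<open>T\<close> is the localization
  of \<open>A\<close> at the class of arrows whose kernel and cokernel lie in \<open>T\<close>. These arrows admit a
  calculus of right fractions, and the quotient is built from it: it has the objects of \<open>A\<close>, and
  an arrow from \<open>X\<close> to \<open>Y\<close> is a class of roofs \<open>X \<leftarrow> X' \<rightarrow> Y\<close> whose left leg is inverted.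
\<close>

definition inverted :: "('o, 'm) cat \<Rightarrow> ('o, 'm) cat \<Rightarrow> 'm set" where
  "inverted A T = {s \<in> Arr A.
     (\<exists>k. is_kernel A k s \<and> Dom A k \<in> Obj T) \<and>
     (\<exists>c. is_cokernel A c s \<and> Cod A c \<in> Obj T)}"

definition roofs :: "('o, 'm) cat \<Rightarrow> 'm set \<Rightarrow> 'o \<Rightarrow> 'o \<Rightarrow> ('m \<times> 'm) set" where
  "roofs A S X Y = {(s, f). s \<in> S \<and> s \<in> Arr A \<and> f \<in> Arr A \<and>
     Dom A f = Dom A s \<and> Cod A s = X \<and> Cod A f = Y}"

definition roof_rel ::
  "('o, 'm) cat \<Rightarrow> 'm set \<Rightarrow> 'o \<Rightarrow> 'o \<Rightarrow> (('m \<times> 'm) \<times> ('m \<times> 'm)) set" where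
  "roof_rel A S X Y = {((s, f), (t, g)).
     (s, f) \<in> roofs A S X Y \<and> (t, g) \<in> roofs A S X Y \<and>
     (\<exists>W. \<exists>u \<in> Hom A W (Dom A s). \<exists>v \<in> Hom A W (Dom A t).
        s \<cdot>\<^bsub>A\<^esub> u = t \<cdot>\<^bsub>A\<^esub> v \<and> s \<cdot>\<^bsub>A\<^esub> u \<in> S \<and> f \<cdot>\<^bsub>A\<^esub> u = g \<cdot>\<^bsub>A\<^esub> v)}"

text \<open>
  The roofs \<open>(s \<cdot> u, g \<cdot> h)\<close> obtained by completing \<open>X' \<rightarrow> Y \<leftarrow> Y'\<close> to a commutative square
  with \<open>u : W \<rightarrow> X'\<close> inverted and \<open>h : W \<rightarrow> Y'\<close>:
\<close>

definition roof_composites ::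
  "('o, 'm) cat \<Rightarrow> 'm set \<Rightarrow> ('m \<times> 'm) set \<Rightarrow> ('m \<times> 'm) set \<Rightarrow> ('m \<times> 'm) set" where
  "roof_composites A S G F = {(s \<cdot>\<^bsub>A\<^esub> u, g \<cdot>\<^bsub>A\<^esub> h) | s f t g u h W.
     (s, f) \<in> F \<and> (t, g) \<in> G \<and> u \<in> S \<and> u \<in> Hom A W (Dom A s) \<and> h \<in> Hom A W (Dom A t) \<and>
     f \<cdot>\<^bsub>A\<^esub> u = t \<cdot>\<^bsub>A\<^esub> h}"

definition localization ::
  "('o, 'm) cat \<Rightarrow> 'm set \<Rightarrow> ('o, 'o \<times> 'o \<times> ('m \<times> 'm) set) cat" where
  "localization A S = \<lparr>
     Obj = Obj A,
     Arr = {(X, Y, F). X \<in> Obj A \<and> Y \<in> Obj A \<and> F \<in> roofs A S X Y // roof_rel A S X Y},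
     Dom = (\<lambda>(X, Y, F). X),
     Cod = (\<lambda>(X, Y, F). Y),
     Ident = (\<lambda>X. (X, X, roof_rel A S X X `` {(Ident A X, Ident A X)})),
     Comp = (\<lambda>(Y', Z, G) (X, Y, F). (X, Z, roof_rel A S X Z `` roof_composites A S G F))\<rparr>"

definition serre_quotient ::
  "('o, 'm) cat \<Rightarrow> ('o, 'm) cat \<Rightarrow> ('o, 'o \<times> 'o \<times> ('m \<times> 'm) set) cat" where
  "serre_quotient A T = localization A (inverted A T)"


section \<open>Sites\<close>

text \<open>Throughout, topologies and presheaves live on the opposite of \<open>C\<close>.\<close>

definition max_sieve :: "('o, 'm) cat \<Rightarrow> 'o \<Rightarrow> 'm set" where
  "max_sieve C x = {f \<in> Arr C. Dom C f = x}"

definition sieve :: "('o, 'm) cat \<Rightarrow> 'o \<Rightarrow> 'm set \<Rightarrow> bool" where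
  "sieve C x S \<longleftrightarrow> S \<subseteq> max_sieve C x \<and>
     (\<forall>f \<in> S. \<forall>g \<in> Arr C. Dom C g = Cod C f \<longrightarrow> g \<cdot>\<^bsub>C\<^esub> f \<in> S)"

definition pull_sieve :: "('o, 'm) cat \<Rightarrow> 'm \<Rightarrow> 'm set \<Rightarrow> 'm set" where
  "pull_sieve C f S = {g \<in> Arr C. Dom C g = Cod C f \<and> g \<cdot>\<^bsub>C\<^esub> f \<in> S}"

locale grothendieck_topology =
  fixes C :: "('o, 'm) cat" and J :: "'o \<Rightarrow> 'm set set"
  assumes covers_sieve: "\<lbrakk>x \<in> Obj C; S \<in> J x\<rbrakk> \<Longrightarrow> sieve C x S"
    and max_covers: "x \<in> Obj C \<Longrightarrow> max_sieve C x \<in> J x"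
    and stable: "\<lbrakk>f \<in> Hom C x y; S \<in> J x\<rbrakk> \<Longrightarrow> pull_sieve C f S \<in> J y"
    and transitive: "\<lbrakk>x \<in> Obj C; S \<in> J x; sieve C x T;
      \<And>f. f \<in> S \<Longrightarrow> pull_sieve C f T \<in> J (Cod C f)\<rbrakk> \<Longrightarrow> T \<in> J x"


section \<open>Presheaves and sheaves\<close>

text \<open>
  \<open>Sec P x\<close> is the value at \<open>x\<close>, which is a set, a ring or a module; \<open>Res P f\<close> is the induced map
  of underlying sets.
\<close>

record ('o, 'm, 's, 'e) presheaf =
  Sec :: "'o \<Rightarrow> 's"
  Res :: "'m \<Rightarrow> 'e \<Rightarrow> 'e"

definition set_presheaf :: "('o, 'm) cat \<Rightarrow> ('o, 'm, 'e set, 'e) presheaf \<Rightarrow> bool" where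
  "set_presheaf C F \<longleftrightarrow>
     (\<forall>f \<in> Arr C. Res F f \<in> Sec F (Dom C f) \<rightarrow> Sec F (Cod C f)) \<and>
     (\<forall>x \<in> Obj C. \<forall>v \<in> Sec F x. Res F (Ident C x) v = v) \<and>
     (\<forall>x y z. \<forall>f \<in> Hom C x y. \<forall>g \<in> Hom C y z. \<forall>v \<in> Sec F x.
        Res F (g \<cdot>\<^bsub>C\<^esub> f) v = Res F g (Res F f v))"

text \<open>
  A natural transformation from a sieve \<open>S\<close>, seen as a subfunctor of a representable functor, to \<open>F\<close>
  is encoded as a single function on \<open>S\<close>, since an arrow determines the object at which it
  is an element of the subfunctor.
\<close>

definition Nat_sieve ::
  "('o, 'm) cat \<Rightarrow> 'm set \<Rightarrow> ('o, 'm, 'e set, 'e) presheaf \<Rightarrow> ('m \<Rightarrow> 'e) set" where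
  "Nat_sieve C S F = {\<eta> \<in> (\<Pi>\<^sub>E f \<in> S. Sec F (Cod C f)).
     \<forall>f \<in> S. \<forall>g \<in> Arr C. Dom C g = Cod C f \<longrightarrow> \<eta> (g \<cdot>\<^bsub>C\<^esub> f) = Res F g (\<eta> f)}"

definition is_sheaf ::
  "('o, 'm) cat \<Rightarrow> ('o \<Rightarrow> 'm set set) \<Rightarrow> ('o, 'm, 'e set, 'e) presheaf \<Rightarrow> bool" where
  "is_sheaf C J F \<longleftrightarrow> set_presheaf C F \<and>
     (\<forall>x \<in> Obj C. \<forall>S \<in> J x.
        bij_betw (\<lambda>\<eta>. restrict \<eta> S) (Nat_sieve C (max_sieve C x) F) (Nat_sieve C S F))"

definition underlying ::
  "('o, 'm, ('e, 'x) partial_object_scheme, 'e) presheaf \<Rightarrow> ('o, 'm, 'e set, 'e) presheaf" where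
  "underlying P = \<lparr>Sec = (\<lambda>x. carrier (Sec P x)), Res = Res P\<rparr>"

definition ring_presheaf :: "('o, 'm) cat \<Rightarrow> ('o, 'm, 'r ring, 'r) presheaf \<Rightarrow> bool" where
  "ring_presheaf C \<O> \<longleftrightarrow> set_presheaf C (underlying \<O>) \<and>
     (\<forall>x \<in> Obj C. ring (Sec \<O> x)) \<and>
     (\<forall>f \<in> Arr C. Res \<O> f \<in> ring_hom (Sec \<O> (Dom C f)) (Sec \<O> (Cod C f)))"

definition structure_sheaf ::
  "('o, 'm) cat \<Rightarrow> ('o \<Rightarrow> 'm set set) \<Rightarrow> ('o, 'm, 'r ring, 'r) presheaf \<Rightarrow> bool" where
  "structure_sheaf C J \<O> \<longleftrightarrow> ring_presheaf C \<O> \<and> is_sheaf C J (underlying \<O>)"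


section \<open>Presheaves of modules\<close>

text \<open>
  The locale \<open>module\<close> requires a commutative ring. As there, the fields \<open>mult\<close> and \<open>one\<close> of a
  module record play no role.
\<close>

locale left_module = R?: ring R + M?: abelian_group M
  for R :: "'r ring" (structure) and M :: "('r, 'v) module" (structure) +
  assumes smult_closed: "\<lbrakk>a \<in> carrier R; v \<in> carrier M\<rbrakk> \<Longrightarrow> a \<odot>\<^bsub>M\<^esub> v \<in> carrier M"
    and smult_l_distr: "\<lbrakk>a \<in> carrier R; b \<in> carrier R; v \<in> carrier M\<rbrakk>
      \<Longrightarrow> (a \<oplus>\<^bsub>R\<^esub> b) \<odot>\<^bsub>M\<^esub> v = a \<odot>\<^bsub>M\<^esub> v \<oplus>\<^bsub>M\<^esub> b \<odot>\<^bsub>M\<^esub> v"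
    and smult_r_distr: "\<lbrakk>a \<in> carrier R; v \<in> carrier M; w \<in> carrier M\<rbrakk>
      \<Longrightarrow> a \<odot>\<^bsub>M\<^esub> (v \<oplus>\<^bsub>M\<^esub> w) = a \<odot>\<^bsub>M\<^esub> v \<oplus>\<^bsub>M\<^esub> a \<odot>\<^bsub>M\<^esub> w"
    and smult_assoc: "\<lbrakk>a \<in> carrier R; b \<in> carrier R; v \<in> carrier M\<rbrakk>
      \<Longrightarrow> (a \<otimes>\<^bsub>R\<^esub> b) \<odot>\<^bsub>M\<^esub> v = a \<odot>\<^bsub>M\<^esub> (b \<odot>\<^bsub>M\<^esub> v)"
    and smult_one: "v \<in> carrier M \<Longrightarrow> \<one>\<^bsub>R\<^esub> \<odot>\<^bsub>M\<^esub> v = v"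

text \<open>Linearity of \<open>h : M \<rightarrow> N\<close> over \<open>R\<close>, where \<open>R\<close> acts on \<open>N\<close> through \<open>\<rho>\<close>.\<close>

definition linear_along ::
  "'r ring \<Rightarrow> ('r \<Rightarrow> 'r) \<Rightarrow> ('r, 'v) module \<Rightarrow> ('r, 'v) module \<Rightarrow> ('v \<Rightarrow> 'v) \<Rightarrow> bool" where
  "linear_along R \<rho> M N h \<longleftrightarrow> h \<in> hom (add_monoid M) (add_monoid N) \<and>
     (\<forall>a \<in> carrier R. \<forall>v \<in> carrier M. h (a \<odot>\<^bsub>M\<^esub> v) = \<rho> a \<odot>\<^bsub>N\<^esub> h v)"

type_synonym ('o, 'm, 'r, 'v) module_presheaf = "('o, 'm, ('r, 'v) module, 'v) presheaf"

definition O_module ::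
  "('o, 'm) cat \<Rightarrow> ('o, 'm, 'r ring, 'r) presheaf \<Rightarrow> ('o, 'm, 'r, 'v) module_presheaf \<Rightarrow> bool" where
  "O_module C \<O> V \<longleftrightarrow> set_presheaf C (underlying V) \<and>
     (\<forall>x \<in> Obj C. left_module (Sec \<O> x) (Sec V x)) \<and>
     (\<forall>f \<in> Arr C. linear_along (Sec \<O> (Dom C f)) (Res \<O> f)
        (Sec V (Dom C f)) (Sec V (Cod C f)) (Res V f))"

definition O_linear_maps ::
  "('o, 'm) cat \<Rightarrow> ('o, 'm, 'r ring, 'r) presheaf \<Rightarrow>
   ('o, 'm, 'r, 'v) module_presheaf \<Rightarrow> ('o, 'm, 'r, 'v) module_presheaf \<Rightarrow> ('o \<Rightarrow> 'v \<Rightarrow> 'v) set" where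
  "O_linear_maps C \<O> V W =
     {\<phi> \<in> (\<Pi>\<^sub>E x \<in> Obj C. extensional (carrier (Sec V x))).
       (\<forall>x \<in> Obj C. linear_along (Sec \<O> x) (\<lambda>a. a) (Sec V x) (Sec W x) (\<phi> x)) \<and>
       (\<forall>f \<in> Arr C. \<forall>v \<in> carrier (Sec V (Dom C f)).
          \<phi> (Cod C f) (Res V f v) = Res W f (\<phi> (Dom C f) v))}"

text \<open>
  The collection of all modules depends on a universe: \<open>U\<close> is the collection of small sets,
  realized as subsets of a type, and only closure under products indexed by the arrows of \<open>C\<close> is
  needed. Examples are the subsets of a type \<open>'v\<close> of cardinality less than an uncountable
  inaccessible cardinal exceeding that of \<open>K\<close>, which gives the modules of a Grothendieck universe
  in which \<open>C\<close> is small, and all subsets of an infinite type \<open>'v\<close> for which the functions from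
  \<open>K\<close> to \<open>'v\<close> inject into \<open>'v\<close>.
\<close>

definition universe_over :: "'m set \<Rightarrow> 'v set set \<Rightarrow> bool" where
  "universe_over K U \<longleftrightarrow>
     (\<exists>A \<in> U. infinite A) \<and>
     (\<forall>A \<in> U. \<forall>B. B \<lesssim> A \<longrightarrow> B \<in> U) \<and>
     (\<forall>A \<in> K \<rightarrow> U. \<exists>B \<in> U. (\<Pi>\<^sub>E k \<in> K. A k) \<lesssim> B)"

definition O_Mod ::
  "('o, 'm) cat \<Rightarrow> ('o, 'm, 'r ring, 'r) presheaf \<Rightarrow> 'v set set \<Rightarrow>
   (('o, 'm, 'r, 'v) module_presheaf,
    ('o, 'm, 'r, 'v) module_presheaf \<times> ('o, 'm, 'r, 'v) module_presheaf \<times> ('o \<Rightarrow> 'v \<Rightarrow> 'v)) cat" where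
  "O_Mod C \<O> U = (let Ob = {V. O_module C \<O> V \<and> (\<forall>x \<in> Obj C. carrier (Sec V x) \<in> U)} in \<lparr>
     Obj = Ob,
     Arr = {(V, W, \<phi>). V \<in> Ob \<and> W \<in> Ob \<and> \<phi> \<in> O_linear_maps C \<O> V W},
     Dom = (\<lambda>(V, W, \<phi>). V),
     Cod = (\<lambda>(V, W, \<phi>). W),
     Ident = (\<lambda>V. (V, V, \<lambda>x \<in> Obj C. \<lambda>v \<in> carrier (Sec V x). v)),
     Comp = (\<lambda>(V', W, \<psi>) (V, W', \<phi>).
       (V, W, \<lambda>x \<in> Obj C. compose (carrier (Sec V x)) (\<psi> x) (\<phi> x)))\<rparr>)"

definition Sh ::
  "('o, 'm) cat \<Rightarrow> ('o \<Rightarrow> 'm set set) \<Rightarrow> ('o, 'm, 'r ring, 'r) presheaf \<Rightarrow> 'v set set \<Rightarrow>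
   (('o, 'm, 'r, 'v) module_presheaf,
    ('o, 'm, 'r, 'v) module_presheaf \<times> ('o, 'm, 'r, 'v) module_presheaf \<times> ('o \<Rightarrow> 'v \<Rightarrow> 'v)) cat" where
  "Sh C J \<O> U = full_subcategory (O_Mod C \<O> U) {V. is_sheaf C J (underlying V)}"

definition torsion_element ::
  "('o, 'm) cat \<Rightarrow> ('o \<Rightarrow> 'm set set) \<Rightarrow> ('o, 'm, 'r, 'v) module_presheaf \<Rightarrow> 'o \<Rightarrow> 'v \<Rightarrow> bool" where
  "torsion_element C J V x v \<longleftrightarrow> (\<exists>S \<in> J x. \<forall>f \<in> S. Res V f v = \<zero>\<^bsub>Sec V (Cod C f)\<^esub>)"

definition torsion_module ::
  "('o, 'm) cat \<Rightarrow> ('o \<Rightarrow> 'm set set) \<Rightarrow> ('o, 'm, 'r, 'v) module_presheaf \<Rightarrow> bool" where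
  "torsion_module C J V \<longleftrightarrow> (\<forall>x \<in> Obj C. \<forall>v \<in> carrier (Sec V x). torsion_element C J V x v)"

definition torsion_modules ::
  "('o, 'm) cat \<Rightarrow> ('o \<Rightarrow> 'm set set) \<Rightarrow> ('o, 'm, 'r ring, 'r) presheaf \<Rightarrow> 'v set set \<Rightarrow>
   (('o, 'm, 'r, 'v) module_presheaf,
    ('o, 'm, 'r, 'v) module_presheaf \<times> ('o, 'm, 'r, 'v) module_presheaf \<times> ('o \<Rightarrow> 'v \<Rightarrow> 'v)) cat" where
  "torsion_modules C J \<O> U = full_subcategory (O_Mod C \<O> U) {V. torsion_module C J V}"

end

theory Submission
  imports Defs "HOL-Algebra.RingHom"
begin

text \<open>
  Every module \<open>V\<close> has a sheafification \<open>V \<rightarrow> V/t(V) \<rightarrow> (V/t(V))\<^sup>+\<close>: divide by the torsion submodule,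
  which makes \<open>V\<close> separated, and adjoin the matching families. An arrow of modules has torsion kernel
  and cokernel iff it is locally injective and locally surjective; the sheafification map is of this
  kind, and every such arrow \<open>X \<rightarrow> Y\<close> induces bijections \<open>Hom(Y, F) \<rightarrow> Hom(X, F)\<close> for
  sheaves \<open>F\<close>. Hence a roof \<open>X \<leftarrow> X' \<rightarrow> Y\<close> extends to a unique arrow between the sheafifications of \<open>X\<close>
  and \<open>Y\<close>, and the calculus of fractions shows that this identifies the classes of roofs with the
  arrows \<open>LX \<rightarrow> LY\<close> of sheaves. So \<open>L\<close> is fully faithful on the Serre quotient, with the
  inclusion of sheaves as a quasi-inverse.
\<close>

section \<open>Localization at arrows inverted by a reflection\<close>

text \<open>The category theory is separated from the sheaves: the locale records what a class
  \<open>S\<close> with right fractions and enough local objects \<open>P\<close> must satisfy, and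
  the equivalence is proved from these properties alone. Since each object has an inverted arrow
  into a local one, a class of roofs is coded by a single arrow between reflections, and identities
  in the localization become identities in \<open>A\<close>.

  Two obstacles shape the rest. \<open>inverted\<close> speaks of kernels and cokernels by universal
  property, whereas arguments on covers need elements; explicit kernels and cokernels, compared with
  arbitrary ones, connect the two. Moreover, modules have elements in a fixed type \<open>'v\<close>
  and carriers in \<open>U\<close>, while fibre products and germs leave that type. Such modules are
  built over another type, shown to be small, and copied back along injections. A germ is a partial
  function on arrows, which is why closure of \<open>U\<close> under products over the arrows of
  \<open>C\<close> is the right bound.

  Torsion is divided out first because over a separated module the saturation of a matching family
  is single-valued; then one plus construction already gives a sheaf.\<close>

locale reflective_fractions = category A for A :: "('o, 'm) cat" (structure) +
  fixes S :: "'m set" and P :: "'o set"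
  assumes S_arr: "s \<in> S \<Longrightarrow> s \<in> Arr A"
    and S_ident: "X \<in> Obj A \<Longrightarrow> Ident A X \<in> S"
    and S_comp: "\<lbrakk>s \<in> S; t \<in> S; Cod A s = Dom A t\<rbrakk> \<Longrightarrow> t \<cdot> s \<in> S"
    and ore: "\<lbrakk>t \<in> S; f \<in> Hom A X (Cod A t)\<rbrakk> \<Longrightarrow>
      \<exists>W u h. u \<in> S \<and> u \<in> Hom A W X \<and> h \<in> Hom A W (Dom A t) \<and> f \<cdot> u = t \<cdot> h"
    and cancel: "\<lbrakk>t \<in> S; f \<in> Hom A X (Dom A t); g \<in> Hom A X (Dom A t); t \<cdot> f = t \<cdot> g\<rbrakk> \<Longrightarrow>
      \<exists>W e. e \<in> S \<and> e \<in> Hom A W X \<and> f \<cdot> e = g \<cdot> e"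
    and reflection: "X \<in> Obj A \<Longrightarrow> \<exists>e \<in> S. Dom A e = X \<and> Cod A e \<in> P"
    and local_hom: "\<lbrakk>s \<in> S; s \<in> Hom A X Y; Z \<in> Obj A; Z \<in> P; h \<in> Hom A X Z\<rbrakk> \<Longrightarrow>
      \<exists>!k. k \<in> Hom A Y Z \<and> k \<cdot> s = h"
begin

section \<open>Reflection into local objects\<close>

definition unit :: "'o \<Rightarrow> 'm" where
  "unit X = (SOME e. e \<in> S \<and> Dom A e = X \<and> Cod A e \<in> P)"

definition L :: "'o \<Rightarrow> 'o" where
  "L X = Cod A (unit X)"

lemma unit:
  assumes "X \<in> Obj A"
  shows "unit X \<in> S" "unit X \<in> Hom A X (L X)" "L X \<in> P" "L X \<in> Obj A"
proof -
  have "\<exists>e. e \<in> S \<and> Dom A e = X \<and> Cod A e \<in> P" using reflection[OF assms] by blast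
  from someI_ex[OF this, folded unit_def]
  show "unit X \<in> S" "unit X \<in> Hom A X (L X)" "L X \<in> P" "L X \<in> Obj A"
    by (auto simp: L_def Hom_def S_arr cod_obj)
qed

lemma hom_obj: "f \<in> Hom A X Y \<Longrightarrow> X \<in> Obj A \<and> Y \<in> Obj A"
  by (auto simp: Hom_def dom_obj cod_obj)

lemma hom_arr: "f \<in> Hom A X Y \<Longrightarrow> f \<in> Arr A \<and> Dom A f = X \<and> Cod A f = Y"
  by (simp add: Hom_def)

lemma comp_S: "\<lbrakk>s \<in> S; t \<in> S; s \<in> Hom A X Y; t \<in> Hom A Y Z\<rbrakk> \<Longrightarrow> t \<cdot> s \<in> S"
  by (auto simp: Hom_def intro: S_comp)

text \<open>The uniqueness half of \<open>local_hom\<close> as a cancellation rule: inverted arrows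
  are epic as far as local objects can see. Arrows out of a reflection are compared in this way
  throughout.\<close>

lemma local_eq:
  assumes "s \<in> S" "s \<in> Hom A X Y" "Z \<in> P" "k \<in> Hom A Y Z" "l \<in> Hom A Y Z" "k \<cdot> s = l \<cdot> s"
  shows "k = l"
proof -
  have "k \<cdot> s \<in> Hom A X Z" using assms comp_hom by blast
  from local_hom[OF assms(1,2) _ assms(3) this] assms hom_obj show ?thesis by metis
qed

lemma comp_assoc4:
  assumes "e \<in> Hom A V W" "f \<in> Hom A W X" "g \<in> Hom A X Y" "h \<in> Hom A Y Z"
  shows "h \<cdot> (g \<cdot> (f \<cdot> e)) = (h \<cdot> (g \<cdot> f)) \<cdot> e"
  using comp_assoc[OF assms(1-3)] comp_assoc[OF assms(1) comp_hom[OF assms(2,3)] assms(4)] by simp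

text \<open>The roofs from \<open>X\<close> to \<open>Y\<close> that \<open>k : LX \<rightarrow> LY\<close> extends; these sets turn out to be the classes of roofs.\<close>

definition cls :: "'o \<Rightarrow> 'o \<Rightarrow> 'm \<Rightarrow> ('m \<times> 'm) set" where
  "cls X Y k = {(s, f). (s, f) \<in> roofs A S X Y \<and> k \<cdot> (unit X \<cdot> s) = unit Y \<cdot> f}"

section \<open>Roofs and the arrows between reflections that they determine\<close>

lemma roofs_iff:
  "(s, f) \<in> roofs A S X Y \<longleftrightarrow> s \<in> S \<and> s \<in> Hom A (Dom A s) X \<and> f \<in> Hom A (Dom A s) Y"
  by (auto simp: roofs_def Hom_def S_arr)

text \<open>\<open>unit X \<cdot> s\<close> is inverted and \<open>L Y\<close> is local, so
  \<open>unit Y \<cdot> f\<close> extends uniquely along it.\<close>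

lemma roof_in_cls:
  assumes "(s, f) \<in> roofs A S X Y"
  shows "\<exists>!k. k \<in> Hom A (L X) (L Y) \<and> (s, f) \<in> cls X Y k"
proof -
  from assms have s: "s \<in> S" "s \<in> Hom A (Dom A s) X" and f: "f \<in> Hom A (Dom A s) Y"
    by (auto simp: roofs_iff)
  then have o: "X \<in> Obj A" "Y \<in> Obj A" using hom_obj by blast+
  have 1: "unit X \<cdot> s \<in> S" using comp_S s unit o by blast
  have 2: "unit X \<cdot> s \<in> Hom A (Dom A s) (L X)" using comp_hom s unit o by blast
  have 3: "unit Y \<cdot> f \<in> Hom A (Dom A s) (L Y)" using comp_hom f unit o by blast
  show ?thesis using local_hom[OF 1 2 _ _ 3] unit o assms by (simp add: cls_def)
qed

text \<open>The Ore condition for \<open>unit Y\<close> against \<open>k \<cdot> unit X\<close>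
  produces the roof. This is fullness: every arrow between reflections comes from the
  localization.\<close>

lemma cls_nonempty:
  assumes "X \<in> Obj A" "Y \<in> Obj A" "k \<in> Hom A (L X) (L Y)"
  shows "\<exists>r. r \<in> cls X Y k"
proof -
  have k: "k \<cdot> unit X \<in> Hom A X (Cod A (unit Y))"
    using comp_hom[OF unit(2) assms(3)] assms by (simp add: L_def)
  from ore[OF unit(1)[OF assms(2)] this] unit[OF assms(2)] obtain W u h where
    u: "u \<in> S" "u \<in> Hom A W X" "h \<in> Hom A W Y" "(k \<cdot> unit X) \<cdot> u = unit Y \<cdot> h"
    by (auto simp: Hom_def)
  moreover have "(k \<cdot> unit X) \<cdot> u = k \<cdot> (unit X \<cdot> u)"
    using comp_assoc[OF u(2) unit(2)[OF assms(1)] assms(3)] by simp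
  ultimately have "(u, h) \<in> cls X Y k" by (auto simp: cls_def roofs_iff Hom_def)
  then show ?thesis by blast
qed

lemma cls_unique:
  assumes "r \<in> cls X Y k" "r \<in> cls X Y l" "k \<in> Hom A (L X) (L Y)" "l \<in> Hom A (L X) (L Y)"
  shows "k = l"
proof (cases r)
  case (Pair s f)
  then have "(s, f) \<in> roofs A S X Y" using assms by (simp add: cls_def)
  from roof_in_cls[OF this] assms Pair show ?thesis by blast
qed

text \<open>The core of the localization argument: related roofs are exactly those that determine
  the same arrow between reflections. It follows that the classes are the sets
  \<open>cls X Y k\<close>; transitivity of \<open>roof_rel\<close> is contained in this
  description.\<close>

lemma roof_rel_iff:
  assumes k: "k \<in> Hom A (L X) (L Y)" and r: "(s, f) \<in> cls X Y k"
  shows "((s, f), (t, g)) \<in> roof_rel A S X Y \<longleftrightarrow> (t, g) \<in> cls X Y k"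
proof
  from r have sf: "(s, f) \<in> roofs A S X Y" and e: "k \<cdot> (unit X \<cdot> s) = unit Y \<cdot> f"
    by (auto simp: cls_def)
  from sf have s: "s \<in> S" "s \<in> Hom A (Dom A s) X" "f \<in> Hom A (Dom A s) Y"
    by (auto simp: roofs_iff)
  then have o: "X \<in> Obj A" "Y \<in> Obj A" using hom_obj by blast+
  note uX = unit[OF o(1)] and uY = unit[OF o(2)]
  {
    assume "((s, f), (t, g)) \<in> roof_rel A S X Y"
    then obtain W u v where tg: "(t, g) \<in> roofs A S X Y" and u: "u \<in> Hom A W (Dom A s)"
      and v: "v \<in> Hom A W (Dom A t)" and st: "s \<cdot> u = t \<cdot> v" "s \<cdot> u \<in> S" "f \<cdot> u = g \<cdot> v"
      by (auto simp: roof_rel_def)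
    from tg have t: "t \<in> S" "t \<in> Hom A (Dom A t) X" "g \<in> Hom A (Dom A t) Y"
      by (auto simp: roofs_iff)
    from roof_in_cls[OF tg] obtain l where l: "l \<in> Hom A (L X) (L Y)" "(t, g) \<in> cls X Y l"
      by blast
    then have e': "l \<cdot> (unit X \<cdot> t) = unit Y \<cdot> g" by (auto simp: cls_def)
    have su: "s \<cdot> u \<in> Hom A W X" using comp_hom s u by blast
    have usu: "unit X \<cdot> (s \<cdot> u) \<in> S" "unit X \<cdot> (s \<cdot> u) \<in> Hom A W (L X)"
      using comp_S[OF st(2) uX(1) su uX(2)] comp_hom[OF su uX(2)] .
    have "k \<cdot> (unit X \<cdot> (s \<cdot> u)) = (k \<cdot> (unit X \<cdot> s)) \<cdot> u"
      using comp_assoc4[OF u s(2) uX(2) k] .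
    also have "\<dots> = unit Y \<cdot> (f \<cdot> u)" using e comp_assoc[OF u s(3) uY(2)] by simp
    also have "\<dots> = (l \<cdot> (unit X \<cdot> t)) \<cdot> v" using e' st(3) comp_assoc[OF v t(3) uY(2)] by simp
    also have "\<dots> = l \<cdot> (unit X \<cdot> (s \<cdot> u))" unfolding st(1)
      using comp_assoc4[OF v t(2) uX(2) l(1)] by simp
    \<comment> \<open>Both arrows agree after the inverted arrow
      \<open>unit X \<cdot> (s \<cdot> u)\<close>, and their target is local.\<close>
    finally have "k = l" using local_eq usu uY k l by blast
    then show "(t, g) \<in> cls X Y k" using l by simp
  }
  {
    assume "(t, g) \<in> cls X Y k"
    then have tg: "(t, g) \<in> roofs A S X Y" and e': "k \<cdot> (unit X \<cdot> t) = unit Y \<cdot> g"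
      by (auto simp: cls_def)
    from tg have t: "t \<in> S" "t \<in> Hom A (Dom A t) X" "g \<in> Hom A (Dom A t) Y"
      by (auto simp: roofs_iff)
    have "s \<in> Hom A (Dom A s) (Cod A t)" using s t hom_arr by metis
    from ore[OF t(1) this] obtain W u v where u: "u \<in> S" "u \<in> Hom A W (Dom A s)"
      and v: "v \<in> Hom A W (Dom A t)" and st: "s \<cdot> u = t \<cdot> v" by blast
    have "unit Y \<cdot> (f \<cdot> u) = k \<cdot> (unit X \<cdot> (s \<cdot> u))"
      using e comp_assoc4[OF u(2) s(2) uX(2) k] comp_assoc[OF u(2) s(3) uY(2)] by simp
    also have "\<dots> = unit Y \<cdot> (g \<cdot> v)"
      unfolding st using e' comp_assoc4[OF v t(2) uX(2) k] comp_assoc[OF v t(3) uY(2)] by simp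
    finally have eq: "unit Y \<cdot> (f \<cdot> u) = unit Y \<cdot> (g \<cdot> v)" .
    have fu: "f \<cdot> u \<in> Hom A W (Dom A (unit Y))" "g \<cdot> v \<in> Hom A W (Dom A (unit Y))"
      using comp_hom[OF u(2) s(3)] comp_hom[OF v t(3)] hom_arr[OF uY(2)] by simp_all
    \<comment> \<open>The Ore square makes only the left legs agree. The right legs agree after
      \<open>unit Y\<close>, which need not be monic; passing to a further inverted arrow
      \<open>d\<close> removes the difference.\<close>
    from cancel[OF uY(1) fu eq] obtain W' d where d: "d \<in> S" "d \<in> Hom A W' W"
      and de: "(f \<cdot> u) \<cdot> d = (g \<cdot> v) \<cdot> d" by blast
    have 1: "u \<cdot> d \<in> Hom A W' (Dom A s)" "v \<cdot> d \<in> Hom A W' (Dom A t)"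
      using comp_hom u v d by blast+
    have 2: "s \<cdot> (u \<cdot> d) = t \<cdot> (v \<cdot> d)"
      using st comp_assoc[OF d(2) u(2) s(2)] comp_assoc[OF d(2) v t(2)] by simp
    have 3: "f \<cdot> (u \<cdot> d) = g \<cdot> (v \<cdot> d)"
      using de comp_assoc[OF d(2) u(2) s(3)] comp_assoc[OF d(2) v t(3)] by simp
    have 4: "s \<cdot> (u \<cdot> d) \<in> S"
      using comp_S[OF comp_S[OF d(1) u(1) d(2) u(2)] s(1) comp_hom[OF d(2) u(2)] s(2)] .
    show "((s, f), (t, g)) \<in> roof_rel A S X Y" using 1 2 3 4 sf tg unfolding roof_rel_def by blast
  }
qed

lemma roof_class:
  assumes "k \<in> Hom A (L X) (L Y)" "r \<in> cls X Y k"
  shows "roof_rel A S X Y `` {r} = cls X Y k"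
proof (cases r)
  case (Pair s f)
  then show ?thesis using roof_rel_iff[of k X Y s f] assms by auto
qed

text \<open>Every roof determines an arrow, every arrow has a roof, and a relation class is the
  whole of the corresponding \<open>cls\<close>. With \<open>cls_inject\<close> this identifies the
  hom-sets of the localization with hom-sets of \<open>A\<close>.\<close>

lemma roof_classes:
  assumes "X \<in> Obj A" "Y \<in> Obj A"
  shows "roofs A S X Y // roof_rel A S X Y = cls X Y ` Hom A (L X) (L Y)"
proof (intro equalityI subsetI)
  fix F assume "F \<in> roofs A S X Y // roof_rel A S X Y"
  then obtain s f where r: "(s, f) \<in> roofs A S X Y" "F = roof_rel A S X Y `` {(s, f)}"
    by (auto elim!: quotientE)
  then show "F \<in> cls X Y ` Hom A (L X) (L Y)" using roof_in_cls[OF r(1)] roof_class by fast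
next
  fix F assume "F \<in> cls X Y ` Hom A (L X) (L Y)"
  then obtain k where k: "k \<in> Hom A (L X) (L Y)" "F = cls X Y k" by blast
  then obtain r where "r \<in> cls X Y k" using cls_nonempty assms by blast
  moreover from this have "r \<in> roofs A S X Y" by (auto simp: cls_def)
  ultimately show "F \<in> roofs A S X Y // roof_rel A S X Y"
    using roof_class[OF k(1)] k(2) by (metis quotientI)
qed

lemma cls_inject:
  assumes "X \<in> Obj A" "Y \<in> Obj A" "k \<in> Hom A (L X) (L Y)" "l \<in> Hom A (L X) (L Y)"
  shows "cls X Y k = cls X Y l \<longleftrightarrow> k = l"
  using assms cls_nonempty cls_unique by metis

text \<open>A chase through the completed square that never uses which completion was chosen;
  composition of roofs is therefore independent of that choice.\<close>

lemma composite_in_cls: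
  assumes k: "k \<in> Hom A (L X) (L Y)" and l: "l \<in> Hom A (L Y) (L Z)"
    and o: "X \<in> Obj A" "Y \<in> Obj A" "Z \<in> Obj A"
    and r: "r \<in> roof_composites A S (cls Y Z l) (cls X Y k)"
  shows "r \<in> cls X Z (l \<cdot> k)"
proof -
  note uX = unit[OF o(1)] and uY = unit[OF o(2)] and uZ = unit[OF o(3)]
  from r obtain s f t g u h W where r: "r = (s \<cdot> u, g \<cdot> h)" and F: "(s, f) \<in> cls X Y k"
    and G: "(t, g) \<in> cls Y Z l" and u: "u \<in> S" "u \<in> Hom A W (Dom A s)"
    and h: "h \<in> Hom A W (Dom A t)" and sq: "f \<cdot> u = t \<cdot> h"
    unfolding roof_composites_def by blast
  from F have s: "s \<in> S" "s \<in> Hom A (Dom A s) X" "f \<in> Hom A (Dom A s) Y"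
    and e: "k \<cdot> (unit X \<cdot> s) = unit Y \<cdot> f" by (auto simp: cls_def roofs_iff)
  from G have t: "t \<in> S" "t \<in> Hom A (Dom A t) Y" "g \<in> Hom A (Dom A t) Z"
    and e': "l \<cdot> (unit Y \<cdot> t) = unit Z \<cdot> g" by (auto simp: cls_def roofs_iff)
  have su: "s \<cdot> u \<in> Hom A W X" "s \<cdot> u \<in> S" using comp_hom comp_S s u by blast+
  have gh: "g \<cdot> h \<in> Hom A W Z" using comp_hom t h by blast
  have 1: "unit X \<cdot> (s \<cdot> u) \<in> Hom A W (L X)" using comp_hom[OF su(1) uX(2)] .
  have "(l \<cdot> k) \<cdot> (unit X \<cdot> (s \<cdot> u)) = l \<cdot> (k \<cdot> (unit X \<cdot> (s \<cdot> u)))"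
    using comp_assoc[OF 1 k l] by simp
  also have "k \<cdot> (unit X \<cdot> (s \<cdot> u)) = (k \<cdot> (unit X \<cdot> s)) \<cdot> u"
    using comp_assoc4[OF u(2) s(2) uX(2) k] .
  also have "\<dots> = unit Y \<cdot> (t \<cdot> h)" using e sq comp_assoc[OF u(2) s(3) uY(2)] by simp
  also have "l \<cdot> (unit Y \<cdot> (t \<cdot> h)) = (l \<cdot> (unit Y \<cdot> t)) \<cdot> h"
    using comp_assoc4[OF h t(2) uY(2) l] .
  also have "\<dots> = unit Z \<cdot> (g \<cdot> h)" using e' comp_assoc[OF h t(3) uZ(2)] by simp
  finally show ?thesis using su gh by (simp add: r cls_def roofs_iff Hom_def)
qed

text \<open>All composites of representatives lie in one class by \<open>composite_in_cls\<close>,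
  and the Ore condition supplies at least one composite, so the union of their classes is that
  single class and not empty.\<close>

lemma composite_class:
  assumes k: "k \<in> Hom A (L X) (L Y)" and l: "l \<in> Hom A (L Y) (L Z)"
    and o: "X \<in> Obj A" "Y \<in> Obj A" "Z \<in> Obj A"
  shows "roof_rel A S X Z `` roof_composites A S (cls Y Z l) (cls X Y k) = cls X Z (l \<cdot> k)"
proof -
  let ?R = "roof_composites A S (cls Y Z l) (cls X Y k)"
  have lk: "l \<cdot> k \<in> Hom A (L X) (L Z)" using comp_hom k l by blast
  have "\<exists>r. r \<in> ?R"
  proof -
    obtain s f where F: "(s, f) \<in> cls X Y k" using cls_nonempty[OF o(1,2) k] by auto
    obtain t g where G: "(t, g) \<in> cls Y Z l" using cls_nonempty[OF o(2,3) l] by auto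
    from F G have "t \<in> S" "f \<in> Hom A (Dom A s) (Cod A t)" by (auto simp: cls_def roofs_iff Hom_def)
    from ore[OF this] F G show ?thesis unfolding roof_composites_def by blast
  qed
  moreover have "?R \<subseteq> cls X Z (l \<cdot> k)" using composite_in_cls[OF k l o] by blast
  moreover have "roof_rel A S X Z `` ?R = (\<Union>r\<in>?R. roof_rel A S X Z `` {r})" by blast
  ultimately show ?thesis using roof_class[OF lk] by blast
qed

section \<open>The localization, read through reflections\<close>

abbreviation "Loc \<equiv> localization A S"

lemma Loc_Obj [simp]: "Obj Loc = Obj A"
  by (simp add: localization_def)

lemma Loc_Hom:
  "Hom Loc X Y = {(X, Y, cls X Y k) | k. X \<in> Obj A \<and> Y \<in> Obj A \<and> k \<in> Hom A (L X) (L Y)}"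
proof -
  have "Hom Loc X Y = {(X, Y, F) | F. X \<in> Obj A \<and> Y \<in> Obj A \<and> F \<in> roofs A S X Y // roof_rel A S X Y}"
    by (auto simp: Hom_def localization_def)
  then show ?thesis using roof_classes by auto
qed

lemma Loc_Comp:
  assumes "X \<in> Obj A" "Y \<in> Obj A" "Z \<in> Obj A"
    "k \<in> Hom A (L X) (L Y)" "l \<in> Hom A (L Y) (L Z)"
  shows "(Y, Z, cls Y Z l) \<cdot>\<^bsub>Loc\<^esub> (X, Y, cls X Y k) = (X, Z, cls X Z (l \<cdot> k))"
  using composite_class assms by (simp add: localization_def)

lemma roof_of_arrow:
  assumes f: "f \<in> Hom A X Y" and k: "k \<in> Hom A (L X) (L Y)"
    and e: "k \<cdot> unit X = unit Y \<cdot> f"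
  shows "roof_rel A S X Y `` {(Ident A X, f)} = cls X Y k"
proof -
  have o: "X \<in> Obj A" using f hom_obj by blast
  then have "(Ident A X, f) \<in> cls X Y k"
    using e f ident_hom[OF o] S_ident[OF o] ident_right[OF unit(2)[OF o]]
    by (simp add: cls_def roofs_iff Hom_def)
  then show ?thesis using roof_class k by blast
qed

lemma Loc_Ident:
  assumes "X \<in> Obj A"
  shows "Ident Loc X = (X, X, cls X X (Ident A (L X)))"
  using roof_of_arrow[OF ident_hom[OF assms], of "Ident A (L X)"] assms unit[OF assms]
    ident_hom ident_left ident_right by (simp add: localization_def)

text \<open>With \<open>Loc_Hom\<close>, \<open>Loc_Comp\<close> and \<open>Loc_Ident\<close> each
  axiom is the same axiom in \<open>A\<close> for arrows between reflections.\<close>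

lemma Loc_category: "category Loc"
proof
  fix F assume "F \<in> Arr Loc"
  then show "Dom Loc F \<in> Obj Loc" "Cod Loc F \<in> Obj Loc" by (auto simp: localization_def)
next
  fix X assume "X \<in> Obj Loc"
  then show "Ident Loc X \<in> Hom Loc X X" using Loc_Ident unit ident_hom by (auto simp: Loc_Hom)
next
  fix F G X Y Z assume "F \<in> Hom Loc X Y" "G \<in> Hom Loc Y Z"
  then show "G \<cdot>\<^bsub>Loc\<^esub> F \<in> Hom Loc X Z" using Loc_Comp comp_hom by (fastforce simp: Loc_Hom)
next
  fix F X Y assume "F \<in> Hom Loc X Y"
  then obtain k where k: "F = (X, Y, cls X Y k)" "X \<in> Obj A" "Y \<in> Obj A" "k \<in> Hom A (L X) (L Y)"
    by (auto simp: Loc_Hom)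
  then show "Ident Loc Y \<cdot>\<^bsub>Loc\<^esub> F = F" "F \<cdot>\<^bsub>Loc\<^esub> Ident Loc X = F"
    using Loc_Ident Loc_Comp unit ident_hom ident_left ident_right by simp_all
next
  fix F G H W X Y Z assume "F \<in> Hom Loc W X" "G \<in> Hom Loc X Y" "H \<in> Hom Loc Y Z"
  then obtain k l m where k: "F = (W, X, cls W X k)" "k \<in> Hom A (L W) (L X)"
    and l: "G = (X, Y, cls X Y l)" "l \<in> Hom A (L X) (L Y)"
    and m: "H = (Y, Z, cls Y Z m)" "m \<in> Hom A (L Y) (L Z)"
    and "W \<in> Obj A" "X \<in> Obj A" "Y \<in> Obj A" "Z \<in> Obj A" by (auto simp: Loc_Hom)
  then show "H \<cdot>\<^bsub>Loc\<^esub> (G \<cdot>\<^bsub>Loc\<^esub> F) = (H \<cdot>\<^bsub>Loc\<^esub> G) \<cdot>\<^bsub>Loc\<^esub> F"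
    using Loc_Comp comp_hom[OF k(2) l(2)] comp_hom[OF l(2) m(2)] comp_assoc[OF k(2) l(2) m(2)]
    by simp
qed

section \<open>The full subcategory of local objects\<close>

abbreviation "Sub \<equiv> full_subcategory A P"

lemma Sub_simps [simp]:
  "Obj Sub = Obj A \<inter> P" "Dom Sub = Dom A" "Cod Sub = Cod A" "Ident Sub = Ident A" "Comp Sub = Comp A"
  by (simp_all add: full_subcategory_def)

lemma Sub_Hom: "Hom Sub X Y = {f \<in> Hom A X Y. X \<in> P \<and> Y \<in> P}"
  by (auto simp: full_subcategory_def Hom_def)

lemma Sub_category: "category Sub"
proof
  fix f assume "f \<in> Arr Sub"
  then show "Dom Sub f \<in> Obj Sub" "Cod Sub f \<in> Obj Sub"
    by (auto simp: full_subcategory_def dom_obj cod_obj)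
qed (auto simp: Sub_Hom ident_hom ident_left ident_right intro: comp_hom comp_assoc)

text \<open>The action of the reflection on arrows, determined by naturality of the units.\<close>

definition refl_arrow :: "'o \<Rightarrow> 'o \<Rightarrow> 'm \<Rightarrow> 'm" where
  "refl_arrow X Y f = (THE k. k \<in> Hom A (L X) (L Y) \<and> k \<cdot> unit X = unit Y \<cdot> f)"

lemma refl_arrow:
  assumes f: "f \<in> Hom A X Y"
  shows "refl_arrow X Y f \<in> Hom A (L X) (L Y)" "refl_arrow X Y f \<cdot> unit X = unit Y \<cdot> f"
proof -
  have o: "X \<in> Obj A" "Y \<in> Obj A" using f hom_obj by blast+
  have "unit Y \<cdot> f \<in> Hom A X (L Y)" using comp_hom[OF f] unit o by blast
  from local_hom[OF unit(1,2)[OF o(1)] unit(4,3)[OF o(2)] this]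
  have "\<exists>!k. k \<in> Hom A (L X) (L Y) \<and> k \<cdot> unit X = unit Y \<cdot> f" .
  from theI'[OF this, folded refl_arrow_def]
  show "refl_arrow X Y f \<in> Hom A (L X) (L Y)" "refl_arrow X Y f \<cdot> unit X = unit Y \<cdot> f"
    by auto
qed

lemma refl_arrow_eqI:
  assumes "f \<in> Hom A X Y" "k \<in> Hom A (L X) (L Y)" "k \<cdot> unit X = unit Y \<cdot> f"
  shows "refl_arrow X Y f = k"
  using local_eq[OF unit(1,2), of X "L Y"] refl_arrow[OF assms(1)] assms unit hom_obj by metis

definition counit :: "'o \<Rightarrow> 'm" where
  "counit X = (THE k. k \<in> Hom A (L X) X \<and> k \<cdot> unit X = Ident A X)"

text \<open>At a local object the identity extends along the unit. The extension is a left inverse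
  by construction, and a right inverse because endomorphisms of the local object \<open>L X\<close>
  can be compared after \<open>unit X\<close>.\<close>

lemma counit:
  assumes "X \<in> Obj A" "X \<in> P"
  shows "counit X \<in> Hom A (L X) X" "counit X \<cdot> unit X = Ident A X"
    "unit X \<cdot> counit X = Ident A (L X)"
proof -
  note u = unit[OF assms(1)]
  from theI'[OF local_hom[OF u(1,2) assms ident_hom[OF assms(1)]], folded counit_def]
  show c: "counit X \<in> Hom A (L X) X" "counit X \<cdot> unit X = Ident A X" by auto
  have 1: "unit X \<cdot> counit X \<in> Hom A (L X) (L X)" using comp_hom c u by blast
  have "(unit X \<cdot> counit X) \<cdot> unit X = unit X \<cdot> (counit X \<cdot> unit X)"
    using comp_assoc[OF u(2) c(1) u(2)] by simp
  also have "\<dots> = Ident A (L X) \<cdot> unit X" using c ident_left ident_right u by metis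
  finally show "unit X \<cdot> counit X = Ident A (L X)"
    using local_eq[OF u(1,2,3) 1 ident_hom[OF u(4)]] by simp
qed

text \<open>Tested after precomposition with \<open>unit X\<close>, where both sides reduce to
  \<open>f\<close>.\<close>

lemma counit_natural:
  assumes f: "f \<in> Hom A X Y" and P: "X \<in> P" "Y \<in> P"
  shows "counit Y \<cdot> refl_arrow X Y f = f \<cdot> counit X"
proof -
  have o: "X \<in> Obj A" "Y \<in> Obj A" using f hom_obj by blast+
  note u = unit[OF o(1)] unit[OF o(2)] and c = counit[OF o(1) P(1)] counit[OF o(2) P(2)]
    and r = refl_arrow[OF f]
  have "(counit Y \<cdot> refl_arrow X Y f) \<cdot> unit X = counit Y \<cdot> (unit Y \<cdot> f)"
    using comp_assoc[OF u(2) r(1) c(4)] r(2) by simp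
  also have "\<dots> = f" using comp_assoc[OF f u(6) c(4)] c(5) ident_left f by simp
  also have "f = (f \<cdot> counit X) \<cdot> unit X"
    using comp_assoc[OF u(2) c(1) f] c(2) ident_right f by simp
  finally show ?thesis
    using local_eq[OF u(1,2) P(2)] comp_hom[OF r(1) c(4)] comp_hom[OF c(1) f] by blast
qed

section \<open>The two functors of the equivalence\<close>

definition to_loc :: "('o, 'm, 'o, 'o \<times> 'o \<times> ('m \<times> 'm) set) cat_functor" where
  "to_loc = \<lparr>on_Obj = (\<lambda>X. X), on_Arr = (\<lambda>f. (Dom A f, Cod A f,
     cls (Dom A f) (Cod A f) (refl_arrow (Dom A f) (Cod A f) f)))\<rparr>"

text \<open>The description is unambiguous because distinct arrows between reflections extend
  distinct (indeed disjoint) sets of roofs.\<close>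

definition from_loc :: "('o, 'o \<times> 'o \<times> ('m \<times> 'm) set, 'o, 'm) cat_functor" where
  "from_loc = \<lparr>on_Obj = L, on_Arr = (\<lambda>(X, Y, F).
     THE k. k \<in> Hom A (L X) (L Y) \<and> F = cls X Y k)\<rparr>"

lemma to_loc_simps:
  "on_Obj to_loc X = X"
  "f \<in> Hom A X Y \<Longrightarrow> on_Arr to_loc f = (X, Y, cls X Y (refl_arrow X Y f))"
  by (auto simp: to_loc_def Hom_def)

lemma from_loc_simps:
  "on_Obj from_loc X = L X"
  "\<lbrakk>X \<in> Obj A; Y \<in> Obj A; k \<in> Hom A (L X) (L Y)\<rbrakk> \<Longrightarrow> on_Arr from_loc (X, Y, cls X Y k) = k"
proof -
  show "on_Obj from_loc X = L X" by (simp add: from_loc_def)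
  assume "X \<in> Obj A" "Y \<in> Obj A" "k \<in> Hom A (L X) (L Y)"
  then show "on_Arr from_loc (X, Y, cls X Y k) = k"
    using cls_inject by (auto simp: from_loc_def intro!: the_equality)
qed

lemma refl_arrow_ident:
  assumes "X \<in> Obj A"
  shows "refl_arrow X X (Ident A X) = Ident A (L X)"
  using refl_arrow_eqI[OF ident_hom[OF assms], of "Ident A (L X)"] unit[OF assms]
    ident_hom ident_left ident_right by metis

lemma refl_arrow_comp:
  assumes f: "f \<in> Hom A X Y" and g: "g \<in> Hom A Y Z"
  shows "refl_arrow X Z (g \<cdot> f) = refl_arrow Y Z g \<cdot> refl_arrow X Y f"
proof (rule refl_arrow_eqI)
  note u = unit(2)[OF conjunct1[OF hom_obj[OF f]]] unit(2)[OF conjunct1[OF hom_obj[OF g]]]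
    unit(2)[OF conjunct2[OF hom_obj[OF g]]]
    and rf = refl_arrow[OF f] and rg = refl_arrow[OF g]
  show "g \<cdot> f \<in> Hom A X Z" using comp_hom f g by blast
  show "refl_arrow Y Z g \<cdot> refl_arrow X Y f \<in> Hom A (L X) (L Z)" using comp_hom rf rg by blast
  show "(refl_arrow Y Z g \<cdot> refl_arrow X Y f) \<cdot> unit X = unit Z \<cdot> (g \<cdot> f)"
    using comp_assoc[OF u(1) rf(1) rg(1)] comp_assoc[OF f u(2) rg(1)] comp_assoc[OF f g u(3)] rf(2) rg(2)
    by simp
qed

lemma to_loc_functor: "is_functor Sub Loc to_loc"
proof -
  have 1: "on_Arr to_loc f \<in> Hom Loc X Y" if "f \<in> Hom A X Y" for f X Y
    using that hom_obj[OF that] refl_arrow[OF that] by (auto simp: to_loc_simps Loc_Hom)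
  have 2: "on_Arr to_loc (Ident A X) = Ident Loc X" if "X \<in> Obj A" for X
    using that ident_hom[OF that] by (simp add: to_loc_simps Loc_Ident refl_arrow_ident)
  have 3: "on_Arr to_loc (g \<cdot> f) = on_Arr to_loc g \<cdot>\<^bsub>Loc\<^esub> on_Arr to_loc f"
    if "f \<in> Hom A X Y" "g \<in> Hom A Y Z" for f g X Y Z
    using that comp_hom[OF that] hom_obj refl_arrow
    by (simp add: to_loc_simps refl_arrow_comp Loc_Comp)
  show ?thesis using 1 2 3 by (auto simp: is_functor_def Sub_Hom to_loc_simps(1))
qed

lemma from_loc_functor: "is_functor Loc Sub from_loc"
proof -
  have 1: "on_Arr from_loc F \<in> Hom Sub (L X) (L Y)" if "F \<in> Hom Loc X Y" for F X Y
    using that unit by (auto simp: Loc_Hom Sub_Hom from_loc_simps)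
  have 2: "on_Arr from_loc (Ident Loc X) = Ident A (L X)" if "X \<in> Obj A" for X
    using that unit ident_hom by (simp add: Loc_Ident from_loc_simps)
  have 3: "on_Arr from_loc (G \<cdot>\<^bsub>Loc\<^esub> F) = on_Arr from_loc G \<cdot> on_Arr from_loc F"
    if "F \<in> Hom Loc X Y" "G \<in> Hom Loc Y Z" for F G X Y Z
    using that comp_hom by (auto simp: Loc_Hom Loc_Comp from_loc_simps)
  show ?thesis using 1 2 3 unit by (auto simp: is_functor_def from_loc_simps(1))
qed

theorem equivalence: "equivalent_categories Sub Loc"
proof -
  have "naturally_isomorphic Sub Sub (comp_functor from_loc to_loc) id_functor"
    unfolding naturally_isomorphic_def
  proof (intro exI[of _ counit] conjI ballI allI)
    fix X assume "X \<in> Obj Sub"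
    then have o: "X \<in> Obj A" "X \<in> P" by auto
    note u = unit[OF o(1)] and c = counit[OF o]
    show h: "counit X \<in> Hom Sub (on_Obj (comp_functor from_loc to_loc) X) (on_Obj id_functor X)"
      using u c o by (simp add: comp_functor_def id_functor_def to_loc_simps from_loc_simps Sub_Hom)
    have "unit X \<in> Hom Sub (Cod Sub (counit X)) (Dom Sub (counit X))"
      using u o hom_arr[OF c(1)] by (simp add: Sub_Hom)
    then show "is_iso Sub (counit X)" using h c hom_arr[OF c(1)] by (auto simp: is_iso_def Hom_def)
  next
    fix X Y f assume "f \<in> Hom Sub X Y"
    then have f: "f \<in> Hom A X Y" "X \<in> P" "Y \<in> P" by (auto simp: Sub_Hom)
    then show "counit Y \<cdot>\<^bsub>Sub\<^esub> on_Arr (comp_functor from_loc to_loc) f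
        = on_Arr id_functor f \<cdot>\<^bsub>Sub\<^esub> counit X"
      using counit_natural[OF f] refl_arrow[OF f(1)] hom_obj[OF f(1)]
      by (simp add: comp_functor_def id_functor_def to_loc_simps from_loc_simps)
  qed
  moreover have "naturally_isomorphic Loc Loc (comp_functor to_loc from_loc) id_functor"
    unfolding naturally_isomorphic_def
  \<comment> \<open>An arrow from \<open>L X\<close> to \<open>X\<close> in the localization is an
    arrow from \<open>L (L X)\<close> to \<open>L X\<close> in \<open>A\<close>, so the counit at
    the local object \<open>L X\<close> serves; its inverse is the class given by
    \<open>unit (L X)\<close>.\<close>
  proof (intro exI[of _ "\<lambda>X. (L X, X, cls (L X) X (counit (L X)))"] conjI ballI allI)
    fix X assume "X \<in> Obj Loc"
    then have o: "X \<in> Obj A" by auto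
    note u = unit[OF o] and u' = unit[OF unit(4)[OF o]] and c = counit[OF unit(4,3)[OF o]]
    show h: "(L X, X, cls (L X) X (counit (L X))) \<in>
      Hom Loc (on_Obj (comp_functor to_loc from_loc) X) (on_Obj id_functor X)"
      using c o u by (auto simp: comp_functor_def id_functor_def to_loc_simps from_loc_simps Loc_Hom)
    have "(X, L X, cls X (L X) (unit (L X))) \<in> Hom Loc X (L X)"
      using u u' o by (auto simp: Loc_Hom)
    moreover have "(X, L X, cls X (L X) (unit (L X))) \<cdot>\<^bsub>Loc\<^esub>
        (L X, X, cls (L X) X (counit (L X))) = Ident Loc (L X)"
      using u u' o c by (simp add: Loc_Comp Loc_Ident)
    moreover have "(L X, X, cls (L X) X (counit (L X))) \<cdot>\<^bsub>Loc\<^esub>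
        (X, L X, cls X (L X) (unit (L X))) = Ident Loc X"
      using u u' o c by (simp add: Loc_Comp Loc_Ident)
    moreover have "Dom Loc (L X, X, cls (L X) X (counit (L X))) = L X"
      "Cod Loc (L X, X, cls (L X) X (counit (L X))) = X"
      by (simp_all add: localization_def)
    ultimately show "is_iso Loc (L X, X, cls (L X) X (counit (L X)))"
      using h unfolding is_iso_def by (auto simp only: Hom_def mem_Collect_eq)
  next
    fix X Y F assume "F \<in> Hom Loc X Y"
    then obtain k where F: "F = (X, Y, cls X Y k)" and o: "X \<in> Obj A" "Y \<in> Obj A"
      and k: "k \<in> Hom A (L X) (L Y)" by (auto simp: Loc_Hom)
    note u = unit[OF o(1)] unit[OF o(2)]
    note c = counit[OF u(4,3)] counit[OF u(8,7)]
    show "(L Y, Y, cls (L Y) Y (counit (L Y))) \<cdot>\<^bsub>Loc\<^esub> on_Arr (comp_functor to_loc from_loc) F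
      = on_Arr id_functor F \<cdot>\<^bsub>Loc\<^esub> (L X, X, cls (L X) X (counit (L X)))"
      using counit_natural[OF k u(3,7)] refl_arrow[OF k] k o u c
      by (simp add: F comp_functor_def id_functor_def to_loc_simps from_loc_simps Loc_Comp)
  qed
  ultimately show ?thesis unfolding equivalent_categories_def
    using Sub_category Loc_category to_loc_functor from_loc_functor by blast
qed

end

section \<open>Modules on a ringed site\<close>

lemma (in abelian_group) minus_zero_iff:
  assumes "v \<in> carrier G" "w \<in> carrier G"
  shows "v \<ominus> w = \<zero> \<longleftrightarrow> v = w"
  using assms by (metis a_assoc a_inv_closed l_neg l_zero minus_eq r_neg r_zero)

lemma (in abelian_group) left_inverse_ex: "v \<in> carrier G \<Longrightarrow> \<exists>w \<in> carrier G. w \<oplus> v = \<zero>"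
  using l_neg by (intro bexI[of _ "\<ominus> v"]) simp_all

lemma (in abelian_group_hom) hom_minus:
  assumes "v \<in> carrier G" "w \<in> carrier G"
  shows "h (v \<ominus>\<^bsub>G\<^esub> w) = h v \<ominus>\<^bsub>H\<^esub> h w"
  using assms by (simp add: a_minus_def)

lemma (in abelian_group) minus_swap: "\<lbrakk>v \<in> carrier G; w \<in> carrier G\<rbrakk> \<Longrightarrow> \<ominus> (v \<ominus> w) = w \<ominus> v"
  by (simp add: minus_eq minus_add a_comm)

lemma (in abelian_group) minus_trans:
  assumes "u \<in> carrier G" "v \<in> carrier G" "w \<in> carrier G"
  shows "(u \<ominus> v) \<oplus> (v \<ominus> w) = u \<ominus> w"
proof -
  have "(u \<ominus> v) \<oplus> (v \<ominus> w) = u \<oplus> ((\<ominus> v \<oplus> v) \<oplus> \<ominus> w)"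
    using assms by (simp add: minus_eq a_assoc)
  then show ?thesis using assms by (simp add: l_neg minus_eq)
qed

lemma (in abelian_group) minus_plus_plus:
  assumes "v \<in> carrier G" "w \<in> carrier G" "v' \<in> carrier G" "w' \<in> carrier G"
  shows "(v \<oplus> w) \<ominus> (v' \<oplus> w') = (v \<ominus> v') \<oplus> (w \<ominus> w')"
  using assms by (simp add: minus_eq minus_add a_ac)

section \<open>Ringed sites and the language of covers\<close>

locale ringed_site = category C + grothendieck_topology C J
  for C :: "('o, 'm) cat" (structure) and J :: "'o \<Rightarrow> 'm set set" +
  fixes \<O> :: "('o, 'm, 'r ring, 'r) presheaf"
  assumes ring_presheaf: "ring_presheaf C \<O>"
begin

lemma arr_hom: "f \<in> Arr C \<Longrightarrow> f \<in> Hom C (Dom C f) (Cod C f)"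
  by (simp add: Hom_def)

lemma comp_arr:
  assumes "f \<in> Arr C" "g \<in> Arr C" "Dom C g = Cod C f"
  shows "g \<cdot> f \<in> Arr C" "Dom C (g \<cdot> f) = Dom C f" "Cod C (g \<cdot> f) = Cod C g"
  using comp_hom[of f "Dom C f" "Cod C f" g "Cod C g"] assms by (auto simp: Hom_def)

lemma comp_assoc_arr:
  "\<lbrakk>f \<in> Arr C; g \<in> Arr C; h \<in> Arr C; Dom C g = Cod C f; Dom C h = Cod C g\<rbrakk>
    \<Longrightarrow> (h \<cdot> g) \<cdot> f = h \<cdot> (g \<cdot> f)"
  by (rule comp_assoc[symmetric, of f "Dom C f" "Cod C f" g "Cod C g" h "Cod C h"]) (auto simp: Hom_def)

lemma ident_arr:
  assumes "x \<in> Obj C"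
  shows "Ident C x \<in> Arr C" "Dom C (Ident C x) = x" "Cod C (Ident C x) = x"
  using ident_hom[OF assms] by (auto simp: Hom_def)

lemma sieveD:
  assumes "x \<in> Obj C" "R \<in> J x" "f \<in> R"
  shows "f \<in> Arr C" "Dom C f = x" "\<And>g. \<lbrakk>g \<in> Arr C; Dom C g = Cod C f\<rbrakk> \<Longrightarrow> g \<cdot> f \<in> R"
  using covers_sieve[OF assms(1,2)] assms(3) by (auto simp: sieve_def max_sieve_def)

text \<open>Pulled back along an arrow of the smaller cover, the larger sieve becomes maximal;
  transitivity then applies.\<close>

lemma cover_superset:
  assumes "x \<in> Obj C" "R \<in> J x" "sieve C x T" "R \<subseteq> T"
  shows "T \<in> J x"
proof (rule transitive[OF assms(1-3)])
  fix f assume f: "f \<in> R"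
  then have "pull_sieve C f T = max_sieve C (Cod C f)"
    using assms unfolding pull_sieve_def max_sieve_def sieve_def by blast
  then show "pull_sieve C f T \<in> J (Cod C f)"
    using max_covers cod_obj sieveD[OF assms(1,2) f] by simp
qed

text \<open>"\<open>Q\<close> holds locally at \<open>x\<close>." The arrows satisfying
  \<open>Q\<close> need not form a sieve, so local statements can be combined and refined without
  naming the sieves behind them.\<close>

definition cov :: "'o \<Rightarrow> ('m \<Rightarrow> bool) \<Rightarrow> bool" where
  "cov x Q \<longleftrightarrow> (\<exists>R \<in> J x. \<forall>f \<in> R. Q f)"

lemma covI: "\<lbrakk>R \<in> J x; \<And>f. f \<in> R \<Longrightarrow> Q f\<rbrakk> \<Longrightarrow> cov x Q"
  by (auto simp: cov_def)

lemma cov_mono: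
  assumes "cov x Q" "x \<in> Obj C" "\<And>f. \<lbrakk>f \<in> Arr C; Dom C f = x; Q f\<rbrakk> \<Longrightarrow> Q' f"
  shows "cov x Q'"
proof -
  obtain R where R: "R \<in> J x" "\<forall>f \<in> R. Q f" using assms(1) by (auto simp: cov_def)
  show ?thesis
  proof (rule covI[OF R(1)])
    fix f assume "f \<in> R"
    then show "Q' f" using R sieveD[OF assms(2) R(1)] assms(3) by blast
  qed
qed

lemma cov_all:
  assumes "x \<in> Obj C" "\<And>f. \<lbrakk>f \<in> Arr C; Dom C f = x\<rbrakk> \<Longrightarrow> Q f"
  shows "cov x Q"
  by (rule covI[OF max_covers[OF assms(1)]]) (use assms(2) in \<open>auto simp: max_sieve_def\<close>)

lemma cov_pull:
  assumes "cov (Dom C f) Q" "f \<in> Arr C"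
  shows "cov (Cod C f) (\<lambda>g. Q (g \<cdot> f))"
proof -
  obtain R where R: "R \<in> J (Dom C f)" "\<forall>f \<in> R. Q f" using assms(1) by (auto simp: cov_def)
  show ?thesis
    by (rule covI[OF stable[OF arr_hom[OF assms(2)] R(1)]]) (use R in \<open>auto simp: pull_sieve_def\<close>)
qed

lemma cov_trans:
  assumes "cov x (\<lambda>f. cov (Cod C f) (\<lambda>g. Q (g \<cdot> f)))" "x \<in> Obj C"
  shows "cov x Q"
proof -
  obtain R where R: "R \<in> J x" "\<And>f. f \<in> R \<Longrightarrow> cov (Cod C f) (\<lambda>g. Q (g \<cdot> f))"
    using assms(1) by (auto simp: cov_def)
  \<comment> \<open>The largest sieve on which \<open>Q\<close> holds. \<open>Q\<close> need not be
    stable under composition, and the transitivity axiom speaks only of sieves, so all composites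
    are required from the start; the identity gives back \<open>Q\<close> itself.\<close>
  let ?T = "{h \<in> Arr C. Dom C h = x \<and> (\<forall>g \<in> Arr C. Dom C g = Cod C h \<longrightarrow> Q (g \<cdot> h))}"
  have T: "sieve C x ?T"
    unfolding sieve_def
  proof (intro conjI ballI impI)
    show "?T \<subseteq> max_sieve C x" by (auto simp: max_sieve_def)
    fix f g assume f: "f \<in> ?T" and g: "g \<in> Arr C" "Dom C g = Cod C f"
    have "Q (h \<cdot> (g \<cdot> f))" if h: "h \<in> Arr C" "Dom C h = Cod C g" for h
    proof -
      have "h \<cdot> (g \<cdot> f) = (h \<cdot> g) \<cdot> f"
        using f g h by (simp add: comp_assoc_arr)
      then show ?thesis using f g h comp_arr[OF g(1) h] by auto
    qed
    then show "g \<cdot> f \<in> ?T" using f g comp_arr[of f g] by auto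
  qed
  have "?T \<in> J x"
  proof (rule transitive[OF assms(2) R(1) T])
    fix f assume f: "f \<in> R"
    note f' = sieveD[OF assms(2) R(1) f]
    have cf: "Cod C f \<in> Obj C" using cod_obj f' by blast
    obtain R' where R': "R' \<in> J (Cod C f)" "\<And>g. g \<in> R' \<Longrightarrow> Q (g \<cdot> f)"
      using R(2)[OF f] by (auto simp: cov_def)
    show "pull_sieve C f ?T \<in> J (Cod C f)"
    proof (rule cover_superset[OF cf R'(1)])
      show "sieve C (Cod C f) (pull_sieve C f ?T)"
        unfolding sieve_def
      proof (intro conjI ballI impI)
        show "pull_sieve C f ?T \<subseteq> max_sieve C (Cod C f)" by (auto simp: max_sieve_def pull_sieve_def)
        fix h g assume h: "h \<in> pull_sieve C f ?T" and g: "g \<in> Arr C" "Dom C g = Cod C h"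
        then have h': "h \<in> Arr C" "Dom C h = Cod C f" "h \<cdot> f \<in> ?T" by (auto simp: pull_sieve_def)
        have "g \<cdot> (h \<cdot> f) \<in> ?T"
          using T h' g comp_arr[OF f'(1) h'(1,2)] by (auto simp: sieve_def)
        moreover have "g \<cdot> (h \<cdot> f) = (g \<cdot> h) \<cdot> f"
          using f' g h' by (simp add: comp_assoc_arr)
        ultimately show "g \<cdot> h \<in> pull_sieve C f ?T"
          using comp_arr[OF h'(1) g] h' by (simp add: pull_sieve_def)
      qed
      show "R' \<subseteq> pull_sieve C f ?T"
      proof
        fix g assume g: "g \<in> R'"
        note g' = sieveD[OF cf R'(1) g]
        have "Q (h \<cdot> (g \<cdot> f))" if h: "h \<in> Arr C" "Dom C h = Cod C g" for h
        proof -
          have "h \<cdot> (g \<cdot> f) = (h \<cdot> g) \<cdot> f"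
            using f' g' h by (simp add: comp_assoc_arr)
          then show ?thesis using R'(2)[OF g'(3)[OF h]] by simp
        qed
        then show "g \<in> pull_sieve C f ?T"
          using comp_arr[OF f'(1) g'(1,2)] g' f' by (auto simp: pull_sieve_def)
      qed
    qed
  qed
  moreover have "Q h" if "h \<in> ?T" for h
    using that ident_arr[OF cod_obj, of h] ident_left[OF arr_hom, of h] by force
  ultimately show ?thesis by (rule covI)
qed

text \<open>Common refinement: \<open>Q'\<close> is pulled back along each arrow of a cover for
  \<open>Q\<close>, on which \<open>Q\<close> persists because the cover is a sieve. Transitivity of
  covers does the rest.\<close>

lemma cov_conj:
  assumes "cov x Q" "cov x Q'" "x \<in> Obj C"
  shows "cov x (\<lambda>f. Q f \<and> Q' f)"
proof (rule cov_trans[OF _ assms(3)])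
  obtain R where R: "R \<in> J x" "\<forall>f \<in> R. Q f" using assms(1) by (auto simp: cov_def)
  show "cov x (\<lambda>f. cov (Cod C f) (\<lambda>g. Q (g \<cdot> f) \<and> Q' (g \<cdot> f)))"
  proof (rule covI[OF R(1)])
    fix f assume f: "f \<in> R"
    note f' = sieveD[OF assms(3) R(1) f]
    from assms(2) f'(2) have "cov (Dom C f) Q'" by simp
    then have "cov (Cod C f) (\<lambda>g. Q' (g \<cdot> f))" using f'(1) by (rule cov_pull)
    then show "cov (Cod C f) (\<lambda>g. Q (g \<cdot> f) \<and> Q' (g \<cdot> f))"
      by (rule cov_mono) (use R f' cod_obj in auto)
  qed
qed

text \<open>Gluing needs a covering sieve that consists of all arrows with the property, not just
  some cover inside it. Stability under composition makes the two equivalent.\<close>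

lemma cov_sieve:
  assumes "cov x Q" "x \<in> Obj C"
    and "\<And>f g. \<lbrakk>f \<in> Arr C; Dom C f = x; g \<in> Arr C; Dom C g = Cod C f; Q f\<rbrakk> \<Longrightarrow> Q (g \<cdot> f)"
  shows "{f \<in> Arr C. Dom C f = x \<and> Q f} \<in> J x"
proof -
  obtain R where R: "R \<in> J x" "\<forall>f \<in> R. Q f" using assms(1) by (auto simp: cov_def)
  show ?thesis
  proof (rule cover_superset[OF assms(2) R(1)])
    show "sieve C x {f \<in> Arr C. Dom C f = x \<and> Q f}"
      using assms(3) comp_arr by (auto simp: sieve_def max_sieve_def)
    show "R \<subseteq> {f \<in> Arr C. Dom C f = x \<and> Q f}" using R sieveD[OF assms(2) R(1)] by auto
  qed
qed

section \<open>Modules over the structure presheaf, elementwise\<close>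

abbreviation el :: "('o, 'm, 'r, 'v) module_presheaf \<Rightarrow> 'o \<Rightarrow> 'v set" where
  "el V x \<equiv> carrier (Sec V x)"
abbreviation zr :: "('o, 'm, 'r, 'v) module_presheaf \<Rightarrow> 'o \<Rightarrow> 'v" where
  "zr V x \<equiv> zero (Sec V x)"
abbreviation pl :: "('o, 'm, 'r, 'v) module_presheaf \<Rightarrow> 'o \<Rightarrow> 'v \<Rightarrow> 'v \<Rightarrow> 'v" where
  "pl V x \<equiv> add (Sec V x)"
abbreviation mi :: "('o, 'm, 'r, 'v) module_presheaf \<Rightarrow> 'o \<Rightarrow> 'v \<Rightarrow> 'v \<Rightarrow> 'v" where
  "mi V x \<equiv> a_minus (Sec V x)"
abbreviation sm :: "('o, 'm, 'r, 'v) module_presheaf \<Rightarrow> 'o \<Rightarrow> 'r \<Rightarrow> 'v \<Rightarrow> 'v" where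
  "sm V x \<equiv> smult (Sec V x)"

abbreviation "scalars x \<equiv> carrier (Sec \<O> x)"

abbreviation Omod :: "('o, 'm, 'r, 'v) module_presheaf \<Rightarrow> bool" where
  "Omod V \<equiv> O_module C \<O> V"

lemma ring_sec: "x \<in> Obj C \<Longrightarrow> ring (Sec \<O> x)"
  using ring_presheaf by (simp add: ring_presheaf_def)

lemma ring_res: "f \<in> Arr C \<Longrightarrow> Res \<O> f \<in> ring_hom (Sec \<O> (Dom C f)) (Sec \<O> (Cod C f))"
  using ring_presheaf by (simp add: ring_presheaf_def)

lemma scalar_res:
  "\<lbrakk>f \<in> Arr C; a \<in> scalars (Dom C f)\<rbrakk> \<Longrightarrow> Res \<O> f a \<in> scalars (Cod C f)"
  using ring_res by (auto simp: ring_hom_def)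

lemma scalar_comp:
  "\<lbrakk>f \<in> Arr C; g \<in> Arr C; Dom C g = Cod C f; a \<in> scalars (Dom C f)\<rbrakk>
    \<Longrightarrow> Res \<O> (g \<cdot> f) a = Res \<O> g (Res \<O> f a)"
  using ring_presheaf unfolding ring_presheaf_def set_presheaf_def underlying_def
  by (auto simp: Hom_def)

lemma mod_left_module: "\<lbrakk>Omod V; x \<in> Obj C\<rbrakk> \<Longrightarrow> left_module (Sec \<O> x) (Sec V x)"
  by (simp add: O_module_def)

lemma mod_abelian: "\<lbrakk>Omod V; x \<in> Obj C\<rbrakk> \<Longrightarrow> abelian_group (Sec V x)"
  using mod_left_module by (auto simp: left_module_def)

lemma mod_res: "\<lbrakk>Omod V; f \<in> Arr C; v \<in> el V (Dom C f)\<rbrakk> \<Longrightarrow> Res V f v \<in> el V (Cod C f)"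
  by (auto simp: O_module_def set_presheaf_def underlying_def)

lemma mod_res_ident: "\<lbrakk>Omod V; x \<in> Obj C; v \<in> el V x\<rbrakk> \<Longrightarrow> Res V (Ident C x) v = v"
  by (auto simp: O_module_def set_presheaf_def underlying_def)

lemma mod_res_comp:
  "\<lbrakk>Omod V; f \<in> Arr C; g \<in> Arr C; Dom C g = Cod C f; v \<in> el V (Dom C f)\<rbrakk>
    \<Longrightarrow> Res V (g \<cdot> f) v = Res V g (Res V f v)"
  by (auto simp: O_module_def set_presheaf_def underlying_def Hom_def)

lemma mod_res_linear:
  "\<lbrakk>Omod V; f \<in> Arr C\<rbrakk> \<Longrightarrow> linear_along (Sec \<O> (Dom C f)) (Res \<O> f)
        (Sec V (Dom C f)) (Sec V (Cod C f)) (Res V f)"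
  by (simp add: O_module_def)

lemma mod_res_add:
  "\<lbrakk>Omod V; f \<in> Arr C; v \<in> el V (Dom C f); w \<in> el V (Dom C f)\<rbrakk>
    \<Longrightarrow> Res V f (pl V (Dom C f) v w) = pl V (Cod C f) (Res V f v) (Res V f w)"
  using mod_res_linear by (fastforce simp: linear_along_def hom_def)

lemma mod_res_smult:
  "\<lbrakk>Omod V; f \<in> Arr C; a \<in> scalars (Dom C f); v \<in> el V (Dom C f)\<rbrakk>
    \<Longrightarrow> Res V f (sm V (Dom C f) a v) = sm V (Cod C f) (Res \<O> f a) (Res V f v)"
  using mod_res_linear by (fastforce simp: linear_along_def hom_def)

lemmas mod_closed =
  mod_abelian[THEN abelian_group.axioms(1), THEN abelian_monoid.zero_closed]
  mod_abelian[THEN abelian_group.axioms(1), THEN abelian_monoid.a_closed]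
  mod_abelian[THEN abelian_group.minus_closed]
  mod_left_module[THEN left_module.smult_closed]

text \<open>The axioms element by element. Additive inverses are only asked to exist, so no formula
  for \<open>a_inv\<close> is needed in the modules constructed later.\<close>

lemma O_moduleI:
  assumes res: "\<And>f v. \<lbrakk>f \<in> Arr C; v \<in> el V (Dom C f)\<rbrakk> \<Longrightarrow> Res V f v \<in> el V (Cod C f)"
    and "\<And>x v. \<lbrakk>x \<in> Obj C; v \<in> el V x\<rbrakk> \<Longrightarrow> Res V (Ident C x) v = v"
    and "\<And>f g v. \<lbrakk>f \<in> Arr C; g \<in> Arr C; Dom C g = Cod C f; v \<in> el V (Dom C f)\<rbrakk>
      \<Longrightarrow> Res V (g \<cdot> f) v = Res V g (Res V f v)"
    and "\<And>f v w. \<lbrakk>f \<in> Arr C; v \<in> el V (Dom C f); w \<in> el V (Dom C f)\<rbrakk>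
      \<Longrightarrow> Res V f (pl V (Dom C f) v w) = pl V (Cod C f) (Res V f v) (Res V f w)"
    and "\<And>f a v. \<lbrakk>f \<in> Arr C; a \<in> scalars (Dom C f); v \<in> el V (Dom C f)\<rbrakk>
      \<Longrightarrow> Res V f (sm V (Dom C f) a v) = sm V (Cod C f) (Res \<O> f a) (Res V f v)"
    and "\<And>x. x \<in> Obj C \<Longrightarrow> zr V x \<in> el V x"
    and "\<And>x v w. \<lbrakk>x \<in> Obj C; v \<in> el V x; w \<in> el V x\<rbrakk> \<Longrightarrow> pl V x v w \<in> el V x"
    and "\<And>x a v. \<lbrakk>x \<in> Obj C; a \<in> scalars x; v \<in> el V x\<rbrakk> \<Longrightarrow> sm V x a v \<in> el V x"
    and "\<And>x u v w. \<lbrakk>x \<in> Obj C; u \<in> el V x; v \<in> el V x; w \<in> el V x\<rbrakk>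
      \<Longrightarrow> pl V x (pl V x u v) w = pl V x u (pl V x v w)"
    and "\<And>x v w. \<lbrakk>x \<in> Obj C; v \<in> el V x; w \<in> el V x\<rbrakk> \<Longrightarrow> pl V x v w = pl V x w v"
    and "\<And>x v. \<lbrakk>x \<in> Obj C; v \<in> el V x\<rbrakk> \<Longrightarrow> pl V x (zr V x) v = v"
    and "\<And>x v. \<lbrakk>x \<in> Obj C; v \<in> el V x\<rbrakk> \<Longrightarrow> \<exists>w \<in> el V x. pl V x w v = zr V x"
    and "\<And>x a b v. \<lbrakk>x \<in> Obj C; a \<in> scalars x; b \<in> scalars x; v \<in> el V x\<rbrakk>
      \<Longrightarrow> sm V x (add (Sec \<O> x) a b) v = pl V x (sm V x a v) (sm V x b v)"
    and "\<And>x a v w. \<lbrakk>x \<in> Obj C; a \<in> scalars x; v \<in> el V x; w \<in> el V x\<rbrakk>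
      \<Longrightarrow> sm V x a (pl V x v w) = pl V x (sm V x a v) (sm V x a w)"
    and "\<And>x a b v. \<lbrakk>x \<in> Obj C; a \<in> scalars x; b \<in> scalars x; v \<in> el V x\<rbrakk>
      \<Longrightarrow> sm V x (mult (Sec \<O> x) a b) v = sm V x a (sm V x b v)"
    and "\<And>x v. \<lbrakk>x \<in> Obj C; v \<in> el V x\<rbrakk> \<Longrightarrow> sm V x (one (Sec \<O> x)) v = v"
  shows "Omod V"
  unfolding O_module_def
proof (intro conjI ballI)
  show "set_presheaf C (underlying V)"
    using assms(1-3) by (auto simp: set_presheaf_def underlying_def Hom_def)
next
  fix x assume x: "x \<in> Obj C"
  interpret R: ring "Sec \<O> x" using ring_sec x .
  interpret M: abelian_group "Sec V x"
    by (rule abelian_groupI) (assumption | rule assms(6-12) x)+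
  show "left_module (Sec \<O> x) (Sec V x)"
    by unfold_locales (assumption | rule assms(8,13-16) x)+
next
  fix f assume "f \<in> Arr C"
  then show "linear_along (Sec \<O> (Dom C f)) (Res \<O> f) (Sec V (Dom C f)) (Sec V (Cod C f)) (Res V f)"
    using assms(1,4,5) by (auto simp: linear_along_def hom_def)
qed

lemmas mod_axioms =
  mod_abelian[THEN abelian_group.axioms(1), THEN abelian_monoid.a_assoc]
  mod_abelian[THEN abelian_group.axioms(1), THEN abelian_monoid.a_comm]
  mod_abelian[THEN abelian_group.axioms(1), THEN abelian_monoid.l_zero]
  mod_abelian[THEN abelian_group.left_inverse_ex]
  mod_left_module[THEN left_module.smult_l_distr]
  mod_left_module[THEN left_module.smult_r_distr]
  mod_left_module[THEN left_module.smult_assoc]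
  mod_left_module[THEN left_module.smult_one]

text \<open>Negation is a scalar multiple. Hence subsets closed under scalars are closed under
  negation, and germs obtain additive inverses from their scalar multiplication.\<close>

lemma mod_smult_neg_one:
  assumes "Omod V" "x \<in> Obj C" "v \<in> el V x"
  shows "sm V x (a_inv (Sec \<O> x) (one (Sec \<O> x))) v = a_inv (Sec V x) v"
proof -
  interpret left_module "Sec \<O> x" "Sec V x" using mod_left_module assms(1,2) .
  have "sm V x \<zero>\<^bsub>Sec \<O> x\<^esub> v = pl V x (sm V x \<zero>\<^bsub>Sec \<O> x\<^esub> v) (sm V x \<zero>\<^bsub>Sec \<O> x\<^esub> v)"
    using smult_l_distr[of "\<zero>\<^bsub>Sec \<O> x\<^esub>" "\<zero>\<^bsub>Sec \<O> x\<^esub>" v] assms by simp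
  then have z: "sm V x \<zero>\<^bsub>Sec \<O> x\<^esub> v = zr V x"
    using M.add.r_cancel_one'[of "sm V x \<zero>\<^bsub>Sec \<O> x\<^esub> v" "sm V x \<zero>\<^bsub>Sec \<O> x\<^esub> v"] smult_closed[of "\<zero>\<^bsub>Sec \<O> x\<^esub>" v] assms by simp
  have "pl V x (sm V x (a_inv (Sec \<O> x) (one (Sec \<O> x))) v) (sm V x (one (Sec \<O> x)) v) = zr V x"
    using smult_l_distr[of "a_inv (Sec \<O> x) (one (Sec \<O> x))" "one (Sec \<O> x)" v] z assms
    by (simp add: R.l_neg)
  then show ?thesis using assms smult_closed by (intro M.minus_equality[symmetric]) (auto simp: smult_one)
qed

lemma mod_diff_zero_iff:
  "\<lbrakk>Omod V; x \<in> Obj C; v \<in> el V x; w \<in> el V x\<rbrakk> \<Longrightarrow> mi V x v w = zr V x \<longleftrightarrow> v = w"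
  by (rule abelian_group.minus_zero_iff[OF mod_abelian])

lemma mod_res_hom: 
  assumes "Omod V" "f \<in> Arr C"
  shows "abelian_group_hom (Sec V (Dom C f)) (Sec V (Cod C f)) (Res V f)"
  using mod_abelian[OF assms(1)] dom_obj cod_obj assms mod_res_linear[OF assms]
  by (intro abelian_group_homI) (auto simp: group_hom_def group_hom_axioms_def linear_along_def
        abelian_group.a_group)

lemma mod_res_zero: "\<lbrakk>Omod V; f \<in> Arr C\<rbrakk> \<Longrightarrow> Res V f (zr V (Dom C f)) = zr V (Cod C f)"
  by (rule abelian_group_hom.hom_zero[OF mod_res_hom])

lemma mod_res_minus:
  "\<lbrakk>Omod V; f \<in> Arr C; v \<in> el V (Dom C f); w \<in> el V (Dom C f)\<rbrakk>
    \<Longrightarrow> Res V f (mi V (Dom C f) v w) = mi V (Cod C f) (Res V f v) (Res V f w)"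
  by (rule abelian_group_hom.hom_minus[OF mod_res_hom])

text \<open>
  Maps between modules with different types of elements: constructions that leave the type \<open>'v\<close>
  are transported back to it at the end.
\<close>

definition mod_map :: "('o, 'm, 'r, 'v) module_presheaf \<Rightarrow> ('o, 'm, 'r, 'w) module_presheaf \<Rightarrow>
    ('o \<Rightarrow> 'v \<Rightarrow> 'w) \<Rightarrow> bool" where
  "mod_map V W \<phi> \<longleftrightarrow>
     (\<forall>x \<in> Obj C. \<forall>v \<in> el V x. \<phi> x v \<in> el W x) \<and>
     (\<forall>x \<in> Obj C. \<forall>v \<in> el V x. \<forall>w \<in> el V x. \<phi> x (pl V x v w) = pl W x (\<phi> x v) (\<phi> x w)) \<and>
     (\<forall>x \<in> Obj C. \<forall>a \<in> scalars x. \<forall>v \<in> el V x. \<phi> x (sm V x a v) = sm W x a (\<phi> x v)) \<and>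
     (\<forall>f \<in> Arr C. \<forall>v \<in> el V (Dom C f). \<phi> (Cod C f) (Res V f v) = Res W f (\<phi> (Dom C f) v))"

lemma mod_mapD:
  assumes "mod_map V W \<phi>"
  shows "\<lbrakk>x \<in> Obj C; v \<in> el V x\<rbrakk> \<Longrightarrow> \<phi> x v \<in> el W x"
    "\<lbrakk>x \<in> Obj C; v \<in> el V x; w \<in> el V x\<rbrakk> \<Longrightarrow> \<phi> x (pl V x v w) = pl W x (\<phi> x v) (\<phi> x w)"
    "\<lbrakk>x \<in> Obj C; a \<in> scalars x; v \<in> el V x\<rbrakk> \<Longrightarrow> \<phi> x (sm V x a v) = sm W x a (\<phi> x v)"
    "\<lbrakk>f \<in> Arr C; v \<in> el V (Dom C f)\<rbrakk> \<Longrightarrow> \<phi> (Cod C f) (Res V f v) = Res W f (\<phi> (Dom C f) v)"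
  using assms by (auto simp: mod_map_def)

lemma mod_map_hom:
  assumes "Omod V" "Omod W" "mod_map V W \<phi>" "x \<in> Obj C"
  shows "abelian_group_hom (Sec V x) (Sec W x) (\<phi> x)"
  using mod_abelian[OF assms(1)] mod_abelian[OF assms(2)] assms mod_mapD[OF assms(3)]
  by (intro abelian_group_homI) (auto simp: group_hom_def group_hom_axioms_def hom_def
        abelian_group.a_group)

lemma mod_map_zero: "\<lbrakk>Omod V; Omod W; mod_map V W \<phi>; x \<in> Obj C\<rbrakk> \<Longrightarrow> \<phi> x (zr V x) = zr W x"
  by (rule abelian_group_hom.hom_zero[OF mod_map_hom])

lemma mod_map_minus:
  "\<lbrakk>Omod V; Omod W; mod_map V W \<phi>; x \<in> Obj C; v \<in> el V x; w \<in> el V x\<rbrakk>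
    \<Longrightarrow> \<phi> x (mi V x v w) = mi W x (\<phi> x v) (\<phi> x w)"
  by (rule abelian_group_hom.hom_minus[OF mod_map_hom])

lemma mod_map_eq_iff:
  "\<lbrakk>Omod V; Omod W; mod_map V W \<phi>; x \<in> Obj C; v \<in> el V x; w \<in> el V x\<rbrakk>
    \<Longrightarrow> \<phi> x v = \<phi> x w \<longleftrightarrow> \<phi> x (mi V x v w) = zr W x"
  by (simp add: mod_map_minus mod_diff_zero_iff mod_mapD(1))

lemma mod_map_comp:
  assumes "mod_map V W \<phi>" "mod_map W Z \<psi>"
  shows "mod_map V Z (\<lambda>x v. \<psi> x (\<phi> x v))"
  using assms dom_obj unfolding mod_map_def by simp

text \<open>Since \<open>q\<close> is onto, the axioms for \<open>\<psi>\<close> can be checked on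
  values of \<open>q\<close>, where they are those of \<open>\<chi>\<close>. This covers maps out of
  a quotient as well as inverses of bijective maps.\<close>

lemma mod_map_factor:
  assumes V: "Omod V" and q: "mod_map V Q q" "\<And>x. x \<in> Obj C \<Longrightarrow> el Q x = q x ` el V x"
    and \<chi>: "mod_map V Z \<chi>" and \<psi>: "\<And>x v. \<lbrakk>x \<in> Obj C; v \<in> el V x\<rbrakk> \<Longrightarrow> \<psi> x (q x v) = \<chi> x v"
  shows "mod_map Q Z \<psi>"
proof -
  note m = mod_mapD(2-4)[OF q(1), symmetric] mod_mapD[OF \<chi>] mod_closed[OF V] mod_res[OF V]
  show ?thesis
    unfolding mod_map_def by (auto simp: q(2) \<psi> m dom_obj cod_obj)
qed

lemma mod_map_ident: "mod_map V V (\<lambda>x v. v)"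
  by (simp add: mod_map_def)

section \<open>Submodules, products and the zero module\<close>

definition sub_mod :: "('o \<Rightarrow> 'v set) \<Rightarrow> ('o, 'm, 'r, 'v) module_presheaf \<Rightarrow>
    ('o, 'm, 'r, 'v) module_presheaf" where
  "sub_mod N V = \<lparr>Sec = (\<lambda>x. (Sec V x)\<lparr>carrier := N x\<rparr>), Res = Res V\<rparr>"

definition submodule_of where
  "submodule_of N V \<longleftrightarrow>
     (\<forall>x \<in> Obj C. N x \<subseteq> el V x \<and> zr V x \<in> N x \<and> (\<forall>v \<in> N x. \<forall>w \<in> N x. pl V x v w \<in> N x) \<and>
        (\<forall>a \<in> scalars x. \<forall>v \<in> N x. sm V x a v \<in> N x)) \<and>
     (\<forall>f \<in> Arr C. \<forall>v \<in> N (Dom C f). Res V f v \<in> N (Cod C f))"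

lemma sub_mod_simps [simp]:
  "el (sub_mod N V) x = N x" "zr (sub_mod N V) x = zr V x"
  "pl (sub_mod N V) x = pl V x" "sm (sub_mod N V) x = sm V x"
  "Res (sub_mod N V) = Res V"
  by (simp_all add: sub_mod_def)

lemma submodule_neg:
  assumes "Omod V" "submodule_of N V" "x \<in> Obj C" "v \<in> N x"
  shows "a_inv (Sec V x) v \<in> N x"
proof -
  interpret left_module "Sec \<O> x" "Sec V x" using mod_left_module assms(1,3) .
  have "v \<in> el V x" using assms by (auto simp: submodule_of_def)
  from mod_smult_neg_one[OF assms(1,3) this, symmetric] assms show ?thesis
    by (simp add: submodule_of_def)
qed

lemma sub_mod_module:
  assumes "Omod V" "submodule_of N V"
  shows "Omod (sub_mod N V)"
proof -
  have sub: "\<And>x v. x \<in> Obj C \<Longrightarrow> v \<in> N x \<Longrightarrow> v \<in> el V x" using assms(2) by (auto simp: submodule_of_def)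
  have "\<exists>w \<in> N x. pl V x w v = zr V x" if "x \<in> Obj C" "v \<in> N x" for x v
    using abelian_group.l_neg[OF mod_abelian[OF assms(1) that(1)] sub[OF that]]
      submodule_neg[OF assms that] by (intro bexI)
  then show ?thesis
    using assms sub dom_obj
    by (intro O_moduleI) (auto simp: submodule_of_def mod_res_ident mod_res_comp mod_res_add
        mod_res_smult mod_axioms(1,3,5-8) intro: mod_axioms(2))
qed

lemma sub_mod_incl: "submodule_of N V \<Longrightarrow> mod_map (sub_mod N V) V (\<lambda>x v. v)"
  by (auto simp: mod_map_def submodule_of_def)

definition prod_mod :: "('o, 'm, 'r, 'v) module_presheaf \<Rightarrow> ('o, 'm, 'r, 'w) module_presheaf \<Rightarrow>
    ('o, 'm, 'r, 'v \<times> 'w) module_presheaf" where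
  "prod_mod V W = \<lparr>Sec = (\<lambda>x. \<lparr>carrier = el V x \<times> el W x, mult = undefined, one = undefined,
     zero = (zr V x, zr W x), add = (\<lambda>p q. (pl V x (fst p) (fst q), pl W x (snd p) (snd q))),
     smult = (\<lambda>a p. (sm V x a (fst p), sm W x a (snd p)))\<rparr>),
     Res = (\<lambda>f p. (Res V f (fst p), Res W f (snd p)))\<rparr>"

lemma prod_mod_module:
  assumes "Omod V" "Omod W"
  shows "Omod (prod_mod V W)"
proof -
  have "\<exists>p \<in> el V x \<times> el W x. pl V x (fst p) v = zr V x \<and> pl W x (snd p) w = zr W x"
    if that': "x \<in> Obj C" "v \<in> el V x" "w \<in> el W x" for x v w
  proof -
    obtain v' where v: "v' \<in> el V x" "pl V x v' v = zr V x"
      using mod_axioms(4)[OF assms(1) that'(1,2)] by (elim bexE)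
    obtain w' where w: "w' \<in> el W x" "pl W x w' w = zr W x"
      using mod_axioms(4)[OF assms(2) that'(1,3)] by (elim bexE)
    show ?thesis using v w by (intro bexI[of _ "(v', w')"]) simp_all
  qed
  then show ?thesis
    using assms dom_obj
    by (intro O_moduleI) (auto simp: prod_mod_def mod_res mod_closed mod_res_ident mod_res_comp
        mod_res_add mod_res_smult mod_axioms(1,3,5-8) intro: mod_axioms(2))
qed

lemma prod_mod_maps:
  "mod_map (prod_mod V W) V (\<lambda>x. fst)" "mod_map (prod_mod V W) W (\<lambda>x. snd)"
  by (auto simp: mod_map_def prod_mod_def)

text \<open>\<open>undefined\<close> is an element of every type, so this gives a zero module over
  any type of elements.\<close>

definition zero_mod :: "('o, 'm, 'r, 'v) module_presheaf" where
  "zero_mod = \<lparr>Sec = (\<lambda>x. \<lparr>carrier = {undefined}, mult = undefined, one = undefined,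
     zero = undefined, add = (\<lambda>p q. undefined), smult = (\<lambda>a p. undefined)\<rparr>),
     Res = (\<lambda>f p. undefined)\<rparr>"

lemma zero_mod_module: "Omod zero_mod"
  by (intro O_moduleI) (auto simp: zero_mod_def)

lemma zero_mod_maps:
  assumes "Omod V"
  shows "mod_map V zero_mod (\<lambda>x v. undefined)" "mod_map zero_mod V (\<lambda>x v. zr V x)"
proof -
  show "mod_map V zero_mod (\<lambda>x v. undefined)" by (simp add: mod_map_def zero_mod_def)
  have "sm V x a (zr V x) = zr V x" if x: "x \<in> Obj C" and a: "a \<in> scalars x" for x a
  proof -
    interpret abelian_group "Sec V x" using mod_abelian[OF assms x] .
    have "pl V x (sm V x a (zr V x)) (sm V x a (zr V x)) = sm V x a (zr V x)"
      using mod_axioms(3,6)[OF assms x] mod_closed[OF assms x] a by metis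
    then show ?thesis
      using add.r_cancel_one'[of "sm V x a (zr V x)" "sm V x a (zr V x)"] mod_closed[OF assms x] a by simp
  qed
  then show "mod_map zero_mod V (\<lambda>x v. zr V x)"
    using assms mod_closed[OF assms] mod_axioms(3)[OF assms] mod_res_zero[OF assms]
    by (auto simp: mod_map_def zero_mod_def)
qed

text \<open>
  Covers both quotients, with \<open>q\<close> choosing representatives, and transport along an injection \<open>q\<close>.
\<close>

definition image_mod :: "('o \<Rightarrow> 'v \<Rightarrow> 'w) \<Rightarrow> ('o, 'm, 'r, 'v) module_presheaf \<Rightarrow>
    ('o, 'm, 'r, 'w) module_presheaf" where
  "image_mod q V = (let r = (\<lambda>x. inv_into (el V x) (q x)) in
     \<lparr>Sec = (\<lambda>x. \<lparr>carrier = q x ` el V x, mult = undefined, one = undefined,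
        zero = q x (zr V x), add = (\<lambda>v w. q x (pl V x (r x v) (r x w))),
        smult = (\<lambda>a v. q x (sm V x a (r x v)))\<rparr>),
      Res = (\<lambda>f v. q (Cod C f) (Res V f (r (Dom C f) v)))\<rparr>)"

text \<open>\<open>image_mod\<close> computes through representatives chosen by
  \<open>inv_into\<close>. Compatibility of the relation \<open>q x v = q x v'\<close> with all
  operations is what makes the result independent of them; an injective \<open>q\<close> satisfies
  it trivially.\<close>

definition congruence where
  "congruence q V \<longleftrightarrow>
     (\<forall>x \<in> Obj C. \<forall>v \<in> el V x. \<forall>v' \<in> el V x. q x v = q x v' \<longrightarrow>
        (\<forall>w \<in> el V x. \<forall>w' \<in> el V x. q x w = q x w' \<longrightarrow> q x (pl V x v w) = q x (pl V x v' w')) \<and>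
        (\<forall>a \<in> scalars x. q x (sm V x a v) = q x (sm V x a v')) \<and>
        (\<forall>f \<in> Arr C. Dom C f = x \<longrightarrow> q (Cod C f) (Res V f v) = q (Cod C f) (Res V f v')))"

lemma congruenceD:
  assumes "congruence q V" "x \<in> Obj C" "v \<in> el V x" "v' \<in> el V x" "q x v = q x v'"
  shows "\<lbrakk>w \<in> el V x; w' \<in> el V x; q x w = q x w'\<rbrakk> \<Longrightarrow> q x (pl V x v w) = q x (pl V x v' w')"
    "a \<in> scalars x \<Longrightarrow> q x (sm V x a v) = q x (sm V x a v')"
    "\<lbrakk>f \<in> Arr C; Dom C f = x\<rbrakk> \<Longrightarrow> q (Cod C f) (Res V f v) = q (Cod C f) (Res V f v')"
  using assms unfolding congruence_def by blast+

lemma image_mod_simps: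
  assumes "congruence q V" "Omod V"
  shows "el (image_mod q V) x = q x ` el V x"
    "zr (image_mod q V) x = q x (zr V x)"
    "\<lbrakk>x \<in> Obj C; v \<in> el V x; w \<in> el V x\<rbrakk> \<Longrightarrow> pl (image_mod q V) x (q x v) (q x w) = q x (pl V x v w)"
    "\<lbrakk>x \<in> Obj C; a \<in> scalars x; v \<in> el V x\<rbrakk> \<Longrightarrow> sm (image_mod q V) x a (q x v) = q x (sm V x a v)"
    "\<lbrakk>f \<in> Arr C; Dom C f = x; v \<in> el V x\<rbrakk> \<Longrightarrow>
      Res (image_mod q V) f (q x v) = q (Cod C f) (Res V f v)"
proof -
  have r: "inv_into (el V x) (q x) (q x v) \<in> el V x" "q x (inv_into (el V x) (q x) (q x v)) = q x v"
    if "v \<in> el V x" for x v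
    using inv_into_into[of "q x v" "q x" "el V x"] f_inv_into_f[of "q x v" "q x" "el V x"] that by auto
  show "el (image_mod q V) x = q x ` el V x" "zr (image_mod q V) x = q x (zr V x)"
    by (simp_all add: image_mod_def)
  show "\<lbrakk>x \<in> Obj C; v \<in> el V x; w \<in> el V x\<rbrakk> \<Longrightarrow> pl (image_mod q V) x (q x v) (q x w) = q x (pl V x v w)"
    unfolding image_mod_def Let_def
    by (simp, rule congruenceD(1)[OF assms(1)]) (simp_all add: r)
  show "\<lbrakk>x \<in> Obj C; a \<in> scalars x; v \<in> el V x\<rbrakk> \<Longrightarrow> sm (image_mod q V) x a (q x v) = q x (sm V x a v)"
    unfolding image_mod_def Let_def
    by (simp, rule congruenceD(2)[OF assms(1)]) (simp_all add: r)
  show "\<lbrakk>f \<in> Arr C; Dom C f = x; v \<in> el V x\<rbrakk> \<Longrightarrow>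
      Res (image_mod q V) f (q x v) = q (Cod C f) (Res V f v)"
    unfolding image_mod_def Let_def
    by (simp, rule congruenceD(3)[OF assms(1), of x]) (auto simp add: r dom_obj)
qed

lemma image_mod_map:
  assumes "congruence q V" "Omod V"
  shows "mod_map V (image_mod q V) q"
  using image_mod_simps[OF assms] by (auto simp: mod_map_def)

lemma image_mod_module:
  assumes "congruence q V" "Omod V"
  shows "Omod (image_mod q V)"
proof -
  note s = image_mod_simps[OF assms]
  have inv: "\<exists>w \<in> el V x. q x (pl V x w v) = q x (zr V x)" if "x \<in> Obj C" "v \<in> el V x" for x v
    using mod_axioms(4)[OF assms(2) that] by (elim bexE) (intro bexI, simp_all)
  note V = mod_res[OF assms(2)] mod_closed[OF assms(2)] scalar_res comp_arr ident_arr dom_obj cod_obj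
  have scalars: "\<lbrakk>x \<in> Obj C; a \<in> scalars x; b \<in> scalars x\<rbrakk> \<Longrightarrow>
      a \<oplus>\<^bsub>Sec \<O> x\<^esub> b \<in> scalars x \<and> a \<otimes>\<^bsub>Sec \<O> x\<^esub> b \<in> scalars x"
    "x \<in> Obj C \<Longrightarrow> \<one>\<^bsub>Sec \<O> x\<^esub> \<in> scalars x" for x a b
    using ring_sec by (simp_all add: ring.ring_simprules)
  show ?thesis
  proof (rule O_moduleI, unfold s(1,2), safe)
    fix x v w assume "x \<in> Obj C" "v \<in> el V x" "w \<in> el V x"
    then show "pl (image_mod q V) x (q x v) (q x w) = pl (image_mod q V) x (q x w) (q x v)"
      by (simp add: s(3) mod_axioms(2)[OF assms(2), of x v w])
  qed (simp_all add: s(3-5) inv V scalars mod_res_comp[OF assms(2)] mod_res_ident[OF assms(2)]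
      mod_res_add[OF assms(2)] mod_res_smult[OF assms(2)] mod_axioms(1,3,5-8)[OF assms(2)])
qed

section \<open>Local isomorphisms\<close>

text \<open>The kernel of \<open>\<phi>\<close> is torsion; correspondingly, \<open>loc_surj\<close>
  says that the cokernel is torsion. Formulated on elements, both make sense for maps between
  modules with different element types, which are not arrows of one category.\<close>

definition loc_inj where
  "loc_inj V W \<phi> \<longleftrightarrow> (\<forall>x \<in> Obj C. \<forall>v \<in> el V x. \<phi> x v = zr W x \<longrightarrow>
     cov x (\<lambda>f. Res V f v = zr V (Cod C f)))"

definition loc_surj where
  "loc_surj V W \<phi> \<longleftrightarrow> (\<forall>x \<in> Obj C. \<forall>w \<in> el W x.
     cov x (\<lambda>f. \<exists>v \<in> el V (Cod C f). \<phi> (Cod C f) v = Res W f w))"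

lemma torsion_element_iff:
  "torsion_element C J V x v \<longleftrightarrow> cov x (\<lambda>f. Res V f v = zr V (Cod C f))"
  by (simp add: torsion_element_def cov_def)

lemma torsion_local:
  assumes "Omod V" "x \<in> Obj C" "v \<in> el V x" "cov x (\<lambda>f. torsion_element C J V (Cod C f) (Res V f v))"
  shows "torsion_element C J V x v"
  unfolding torsion_element_iff
proof (rule cov_trans[OF _ assms(2)], rule cov_mono[OF assms(4,2)])
  fix f assume f: "f \<in> Arr C" "Dom C f = x" and "torsion_element C J V (Cod C f) (Res V f v)"
  then have "cov (Cod C f) (\<lambda>g. Res V g (Res V f v) = zr V (Cod C g))" by (simp add: torsion_element_iff)
  then show "cov (Cod C f) (\<lambda>g. Res V (g \<cdot> f) v = zr V (Cod C (g \<cdot> f)))"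
    by (rule cov_mono) (use f assms cod_obj in \<open>simp_all add: mod_res_comp comp_arr\<close>)
qed

text \<open>An element killed by the composite has a torsion image under \<open>\<phi>\<close>. So
  on a cover its restrictions are killed by \<open>\<phi>\<close>, hence torsion, and torsion is a
  local property.\<close>

lemma loc_inj_comp:
  assumes "Omod V" "Omod W" "mod_map V W \<phi>" "loc_inj V W \<phi>" "loc_inj W Z \<psi>"
  shows "loc_inj V Z (\<lambda>x v. \<psi> x (\<phi> x v))"
  unfolding loc_inj_def
proof (intro ballI impI)
  fix x v assume x: "x \<in> Obj C" and v: "v \<in> el V x" and "\<psi> x (\<phi> x v) = zr Z x"
  then have "cov x (\<lambda>f. Res W f (\<phi> x v) = zr W (Cod C f))"
    using assms(5) mod_mapD(1)[OF assms(3) x v] by (simp add: loc_inj_def)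
  then have "cov x (\<lambda>f. torsion_element C J V (Cod C f) (Res V f v))"
  proof (rule cov_mono[OF _ x])
    fix f assume f: "f \<in> Arr C" "Dom C f = x" and "Res W f (\<phi> x v) = zr W (Cod C f)"
    then have "\<phi> (Cod C f) (Res V f v) = zr W (Cod C f)" using mod_mapD(4)[OF assms(3)] v by simp
    then show "torsion_element C J V (Cod C f) (Res V f v)"
      using assms(4) f v cod_obj mod_res[OF assms(1)] by (simp add: loc_inj_def torsion_element_iff)
  qed
  then show "cov x (\<lambda>f. Res V f v = zr V (Cod C f))"
    using torsion_local[OF assms(1) x v] by (simp add: torsion_element_iff)
qed

text \<open>Lift along \<open>\<psi>\<close> on a cover, then lift each result along
  \<open>\<phi>\<close> on a finer one.\<close>

lemma loc_surj_comp:
  assumes "Omod W" "Omod Z" "mod_map V W \<phi>" "mod_map W Z \<psi>" "loc_surj V W \<phi>" "loc_surj W Z \<psi>"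
  shows "loc_surj V Z (\<lambda>x v. \<psi> x (\<phi> x v))"
  unfolding loc_surj_def
proof (intro ballI)
  fix x z assume x: "x \<in> Obj C" and z: "z \<in> el Z x"
  have "cov x (\<lambda>f. \<exists>w \<in> el W (Cod C f). \<psi> (Cod C f) w = Res Z f z)"
    using assms(6) x z by (simp add: loc_surj_def)
  then show "cov x (\<lambda>f. \<exists>v \<in> el V (Cod C f). \<psi> (Cod C f) (\<phi> (Cod C f) v) = Res Z f z)"
  proof (rule cov_trans[OF cov_mono[OF _ x] x])
    fix f assume f: "f \<in> Arr C" "Dom C f = x" and "\<exists>w \<in> el W (Cod C f). \<psi> (Cod C f) w = Res Z f z"
    then obtain w where w: "w \<in> el W (Cod C f)" "\<psi> (Cod C f) w = Res Z f z" by (elim bexE)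
    have "cov (Cod C f) (\<lambda>g. \<exists>v \<in> el V (Cod C g). \<phi> (Cod C g) v = Res W g w)"
      using assms(5) f cod_obj w by (simp add: loc_surj_def)
    then show "cov (Cod C f) (\<lambda>g. \<exists>v \<in> el V (Cod C (g \<cdot> f)).
        \<psi> (Cod C (g \<cdot> f)) (\<phi> (Cod C (g \<cdot> f)) v) = Res Z (g \<cdot> f) z)"
    proof (rule cov_mono)
      fix g assume g: "g \<in> Arr C" "Dom C g = Cod C f"
        and "\<exists>v \<in> el V (Cod C g). \<phi> (Cod C g) v = Res W g w"
      then obtain v where v: "v \<in> el V (Cod C g)" "\<phi> (Cod C g) v = Res W g w" by (elim bexE)
      have "\<psi> (Cod C g) (\<phi> (Cod C g) v) = Res Z (g \<cdot> f) z"
        using mod_mapD(4)[OF assms(4) g(1), of w] v w f g z mod_res_comp[OF assms(2) f(1) g]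
        by simp
      then show "\<exists>v \<in> el V (Cod C (g \<cdot> f)). \<psi> (Cod C (g \<cdot> f)) (\<phi> (Cod C (g \<cdot> f)) v) = Res Z (g \<cdot> f) z"
        using v(1) comp_arr[OF f(1) g] by (intro bexI[of _ v]) simp_all
    qed (use f cod_obj in simp)
  qed
qed

section \<open>Quotient modules\<close>

definition quot_map where
  "quot_map N V x v = (SOME w. w \<in> el V x \<and> mi V x w v \<in> N x)"

lemma submoduleD:
  assumes "submodule_of N V"
  shows "\<lbrakk>x \<in> Obj C; v \<in> N x\<rbrakk> \<Longrightarrow> v \<in> el V x" "x \<in> Obj C \<Longrightarrow> zr V x \<in> N x"
    "\<lbrakk>x \<in> Obj C; v \<in> N x; w \<in> N x\<rbrakk> \<Longrightarrow> pl V x v w \<in> N x"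
    "\<lbrakk>x \<in> Obj C; a \<in> scalars x; v \<in> N x\<rbrakk> \<Longrightarrow> sm V x a v \<in> N x"
    "\<lbrakk>f \<in> Arr C; v \<in> N (Dom C f)\<rbrakk> \<Longrightarrow> Res V f v \<in> N (Cod C f)"
  using assms by (auto simp: submodule_of_def)

lemma quot_map:
  assumes "Omod V" "submodule_of N V" "x \<in> Obj C" "v \<in> el V x"
  shows "quot_map N V x v \<in> el V x" "mi V x (quot_map N V x v) v \<in> N x"
proof -
  have "mi V x v v = zr V x" using mod_diff_zero_iff[OF assms(1,3,4,4)] by simp
  then have "v \<in> el V x \<and> mi V x v v \<in> N x" using assms submoduleD(2)[OF assms(2,3)] by simp
  from someI[of "\<lambda>w. w \<in> el V x \<and> mi V x w v \<in> N x", OF this]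
  show "quot_map N V x v \<in> el V x" "mi V x (quot_map N V x v) v \<in> N x"
    by (simp_all add: quot_map_def)
qed

lemma quot_map_eq_iff:
  assumes "Omod V" "submodule_of N V" "x \<in> Obj C" "v \<in> el V x" "w \<in> el V x"
  shows "quot_map N V x v = quot_map N V x w \<longleftrightarrow> mi V x v w \<in> N x"
proof -
  interpret abelian_group "Sec V x" using mod_abelian[OF assms(1,3)] .
  have sym: "mi V x b a \<in> N x" if "a \<in> el V x" "b \<in> el V x" "mi V x a b \<in> N x" for a b
    using submodule_neg[OF assms(1-3) that(3)] minus_swap[OF that(1,2)] by simp
  have trans: "mi V x a c \<in> N x" if "a \<in> el V x" "b \<in> el V x" "c \<in> el V x" "mi V x a b \<in> N x"
    "mi V x b c \<in> N x" for a b c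
    using submoduleD(3)[OF assms(2,3) that(4,5)] minus_trans[OF that(1-3)] by simp
  note v = quot_map[OF assms(1-4)] and w = quot_map[OF assms(1-3,5)]
  show ?thesis
  proof
    assume eq: "quot_map N V x v = quot_map N V x w"
    show "mi V x v w \<in> N x"
      using trans[OF assms(4) v(1) assms(5) sym[OF v(1) assms(4) v(2)]] w(2) eq by simp
  next
    assume vw: "mi V x v w \<in> N x"
    \<comment> \<open>Congruent elements define the same predicate, so \<open>SOME\<close> chooses
      the same representative for both.\<close>
    have "(\<lambda>u. u \<in> el V x \<and> mi V x u v \<in> N x) = (\<lambda>u. u \<in> el V x \<and> mi V x u w \<in> N x)"
      using trans[OF _ assms(4,5) _ vw] trans[OF _ assms(5,4) _ sym[OF assms(4,5) vw]]
      by (intro ext) auto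
    then show "quot_map N V x v = quot_map N V x w" by (simp add: quot_map_def)
  qed
qed

lemma quot_congruence:
  assumes "Omod V" "submodule_of N V"
  shows "congruence (quot_map N V) V"
  unfolding congruence_def
proof (intro ballI impI conjI)
  fix x v v' assume x: "x \<in> Obj C" and v: "v \<in> el V x" "v' \<in> el V x"
    and "quot_map N V x v = quot_map N V x v'"
  then have vN: "mi V x v v' \<in> N x" using quot_map_eq_iff[OF assms x v] by simp
  interpret abelian_group "Sec V x" using mod_abelian[OF assms(1) x] .
  {
    fix w w' assume w: "w \<in> el V x" "w' \<in> el V x" and "quot_map N V x w = quot_map N V x w'"
    then have "mi V x w w' \<in> N x" using quot_map_eq_iff[OF assms x w] by simp
    then show "quot_map N V x (pl V x v w) = quot_map N V x (pl V x v' w')"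
      using vN v w minus_plus_plus[OF v(1) w(1) v(2) w(2)] submoduleD(3)[OF assms(2) x]
      by (simp add: quot_map_eq_iff[OF assms x])
  }
  {
    fix a assume a: "a \<in> scalars x"
    have "abelian_group_hom (Sec V x) (Sec V x) (sm V x a)"
      using a_group mod_closed(4)[OF assms(1) x a] mod_axioms(6)[OF assms(1) x a]
      by (intro abelian_group_homI) (auto simp: group_hom_def group_hom_axioms_def hom_def abelian_group_axioms)
    then have "sm V x a (mi V x v v') = mi V x (sm V x a v) (sm V x a v')"
      using v by (rule abelian_group_hom.hom_minus)
    then show "quot_map N V x (sm V x a v) = quot_map N V x (sm V x a v')"
      using submoduleD(4)[OF assms(2) x a vN] v a
      by (simp add: quot_map_eq_iff[OF assms x] mod_closed[OF assms(1) x])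
  }
  fix f assume f: "f \<in> Arr C" "Dom C f = x"
  then show "quot_map N V (Cod C f) (Res V f v) = quot_map N V (Cod C f) (Res V f v')"
    using submoduleD(5)[OF assms(2) f(1), of "mi V x v v'"] mod_res_minus[OF assms(1) f(1), of v v'] vN v
    by (simp add: quot_map_eq_iff[OF assms cod_obj] mod_res[OF assms(1)])
qed

text \<open>The elements are chosen representatives instead of cosets. The quotient thus keeps the
  element type of \<open>V\<close>, and its carriers are subsets of those of \<open>V\<close>, so
  they stay in the universe.\<close>

definition quot where
  "quot N V = image_mod (quot_map N V) V"

lemma quot_module:
  assumes "Omod V" "submodule_of N V"
  shows "Omod (quot N V)" "mod_map V (quot N V) (quot_map N V)"
    "el (quot N V) x = quot_map N V x ` el V x"
    "\<lbrakk>x \<in> Obj C; v \<in> el V x\<rbrakk> \<Longrightarrow> quot_map N V x v = zr (quot N V) x \<longleftrightarrow> v \<in> N x"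
    "x \<in> Obj C \<Longrightarrow> el (quot N V) x \<subseteq> el V x"
proof -
  note c = quot_congruence[OF assms]
  show "Omod (quot N V)" "mod_map V (quot N V) (quot_map N V)"
    unfolding quot_def using image_mod_module[OF c assms(1)] image_mod_map[OF c assms(1)] .
  show e: "el (quot N V) x = quot_map N V x ` el V x" for x
    unfolding quot_def by (rule image_mod_simps(1)[OF c assms(1)])
  show "x \<in> Obj C \<Longrightarrow> el (quot N V) x \<subseteq> el V x" using quot_map(1)[OF assms] by (auto simp: e)
  assume x: "x \<in> Obj C" and v: "v \<in> el V x"
  interpret abelian_group "Sec V x" using mod_abelian[OF assms(1) x] .
  have "zr (quot N V) x = quot_map N V x (zr V x)"
    unfolding quot_def by (rule image_mod_simps(2)[OF c assms(1)])
  moreover have "mi V x v (zr V x) = v" using v by (simp add: minus_eq)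
  ultimately show "quot_map N V x v = zr (quot N V) x \<longleftrightarrow> v \<in> N x"
    using quot_map_eq_iff[OF assms x v, of "zr V x"] by simp
qed

section \<open>Equalizers, kernels and images\<close>

definition kernel_of where
  "kernel_of V W \<phi> x = {v \<in> el V x. \<phi> x v = zr W x}"

definition equalizer_of where
  "equalizer_of V \<phi> \<psi> x = {v \<in> el V x. \<phi> x v = \<psi> x v}"

lemma equalizer_submodule:
  assumes "Omod V" "Omod W" "mod_map V W \<phi>" "mod_map V W \<psi>"
  shows "submodule_of (equalizer_of V \<phi> \<psi>) V"
  unfolding submodule_of_def equalizer_of_def
  by (simp add: dom_obj mod_closed[OF assms(1)] mod_res[OF assms(1)] mod_mapD[OF assms(3)]
      mod_mapD[OF assms(4)] mod_map_zero[OF assms(1-3)] mod_map_zero[OF assms(1,2,4)])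

lemma zero_map:
  assumes "Omod V" "Omod W"
  shows "mod_map V W (\<lambda>x v. zr W x)"
  using mod_map_comp[OF zero_mod_maps(1)[OF assms(1)] zero_mod_maps(2)[OF assms(2)]] .

lemma kernel_submodule:
  assumes "Omod V" "Omod W" "mod_map V W \<phi>"
  shows "submodule_of (kernel_of V W \<phi>) V"
proof -
  have "kernel_of V W \<phi> = equalizer_of V \<phi> (\<lambda>x v. zr W x)"
    by (intro ext) (simp add: kernel_of_def equalizer_of_def)
  then show ?thesis using equalizer_submodule[OF assms zero_map[OF assms(1,2)]] by simp
qed

definition image_of where
  "image_of V \<phi> x = \<phi> x ` el V x"

lemma image_submodule:
  assumes "Omod V" "Omod W" "mod_map V W \<phi>"
  shows "submodule_of (image_of V \<phi>) W"
  unfolding submodule_of_def image_of_def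
proof (intro conjI ballI; (elim imageE, hypsubst)?)
  fix x assume x: "x \<in> Obj C"
  show "\<phi> x ` el V x \<subseteq> el W x" using mod_mapD(1)[OF assms(3) x] by auto
  show "zr W x \<in> \<phi> x ` el V x"
    using mod_map_zero[OF assms x] mod_closed(1)[OF assms(1) x] by (intro image_eqI) simp_all
  fix v assume v: "v \<in> el V x"
  show "pl W x (\<phi> x v) (\<phi> x w) \<in> \<phi> x ` el V x" if "w \<in> el V x" for w
    using mod_mapD(2)[OF assms(3) x v that] mod_closed(2)[OF assms(1) x v that]
    by (intro image_eqI) simp_all
  show "sm W x a (\<phi> x v) \<in> \<phi> x ` el V x" if "a \<in> scalars x" for a
    using mod_mapD(3)[OF assms(3) x that v] mod_closed(4)[OF assms(1) x that v]
    by (intro image_eqI) simp_all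
next
  fix f v assume "f \<in> Arr C" "v \<in> el V (Dom C f)"
  then show "Res W f (\<phi> (Dom C f) v) \<in> \<phi> (Cod C f) ` el V (Cod C f)"
    using mod_mapD(4)[OF assms(3)] mod_res[OF assms(1)] by (intro image_eqI[of _ _ "Res V f v"]) simp_all
qed

section \<open>The torsion submodule and separated modules\<close>

definition torsion_of where
  "torsion_of V x = {v \<in> el V x. torsion_element C J V x v}"

lemma torsion_of_iff:
  "v \<in> torsion_of V x \<longleftrightarrow> v \<in> el V x \<and> cov x (\<lambda>f. Res V f v = zr V (Cod C f))"
  by (simp add: torsion_of_def torsion_element_iff)

text \<open>Sums use a common refinement of two covers, restrictions use stability of covers under
  pullback, and scalars act linearly on a restriction that is already zero.\<close>

lemma torsion_submodule:
  assumes V: "Omod V"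
  shows "submodule_of (torsion_of V) V"
  unfolding submodule_of_def
proof (intro conjI ballI)
  fix x assume x: "x \<in> Obj C"
  show "torsion_of V x \<subseteq> el V x" by (auto simp: torsion_of_def)
  show "zr V x \<in> torsion_of V x"
    using mod_closed(1)[OF V x] mod_res_zero[OF V] by (auto simp: torsion_of_iff intro!: cov_all[OF x])
  fix v assume v: "v \<in> torsion_of V x"
  show "pl V x v w \<in> torsion_of V x" if w: "w \<in> torsion_of V x" for w
  proof -
    have "cov x (\<lambda>f. Res V f v = zr V (Cod C f) \<and> Res V f w = zr V (Cod C f))"
      using v w cov_conj x by (simp add: torsion_of_iff)
    then have "cov x (\<lambda>f. Res V f (pl V x v w) = zr V (Cod C f))"
    proof (rule cov_mono[OF _ x])
      fix f assume f: "f \<in> Arr C" "Dom C f = x"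
        and "Res V f v = zr V (Cod C f) \<and> Res V f w = zr V (Cod C f)"
      then show "Res V f (pl V x v w) = zr V (Cod C f)"
        using mod_res_add[OF V f(1), of v w] v w mod_axioms(3)[OF V cod_obj] mod_closed(1)[OF V cod_obj]
        by (simp add: torsion_of_iff)
    qed
    then show ?thesis using mod_closed(2)[OF V x] v w by (simp add: torsion_of_iff)
  qed
  show "sm V x a v \<in> torsion_of V x" if a: "a \<in> scalars x" for a
  proof -
    have "cov x (\<lambda>f. Res V f v = zr V (Cod C f))" using v by (simp add: torsion_of_iff)
    then have "cov x (\<lambda>f. Res V f (sm V x a v) = zr V (Cod C f))"
    proof (rule cov_mono[OF _ x])
      fix f assume f: "f \<in> Arr C" "Dom C f = x" and "Res V f v = zr V (Cod C f)"
      then show "Res V f (sm V x a v) = zr V (Cod C f)"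
        using mod_res_smult[OF V f(1), of a v] a v scalar_res[OF f(1), of a]
          mod_mapD(3)[OF zero_mod_maps(2)[OF V] cod_obj[OF f(1)], of "Res \<O> f a" undefined]
        by (simp add: zero_mod_def torsion_of_iff)
    qed
    then show ?thesis using mod_closed(4)[OF V x a] v by (simp add: torsion_of_iff)
  qed
next
  fix f v assume f: "f \<in> Arr C" and v: "v \<in> torsion_of V (Dom C f)"
  then have "cov (Cod C f) (\<lambda>g. Res V (g \<cdot> f) v = zr V (Cod C (g \<cdot> f)))"
    using cov_pull[of f "\<lambda>f. Res V f v = zr V (Cod C f)"] by (simp add: torsion_of_iff)
  then have "cov (Cod C f) (\<lambda>g. Res V g (Res V f v) = zr V (Cod C g))"
    by (rule cov_mono) (use f v in \<open>simp_all add: cod_obj mod_res_comp[OF V] comp_arr torsion_of_iff\<close>)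
  then show "Res V f v \<in> torsion_of V (Cod C f)"
    using mod_res[OF V f] v by (simp add: torsion_of_iff)
qed

definition separated where
  "separated V \<longleftrightarrow> (\<forall>x \<in> Obj C. \<forall>v \<in> el V x. \<forall>w \<in> el V x.
     cov x (\<lambda>f. Res V f v = Res V f w) \<longrightarrow> v = w)"

lemma separatedD:
  "\<lbrakk>separated V; x \<in> Obj C; v \<in> el V x; w \<in> el V x; cov x (\<lambda>f. Res V f v = Res V f w)\<rbrakk> \<Longrightarrow> v = w"
  by (auto simp: separated_def)

text \<open>If two classes agree locally, the difference of their representatives is locally
  torsion, hence torsion by transitivity, and the classes coincide. So dividing once leaves no
  torsion behind, and the projection is a local isomorphism whose kernel is precisely the
  torsion.\<close>

lemma quot_torsion:
  assumes V: "Omod V"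
  defines "T \<equiv> torsion_of V"
  shows "separated (quot T V)" "loc_inj V (quot T V) (quot_map T V)" "loc_surj V (quot T V) (quot_map T V)"
proof -
  have T: "submodule_of T V" unfolding T_def by (rule torsion_submodule[OF V])
  note q = quot_module[OF V T]
  show "loc_inj V (quot T V) (quot_map T V)"
    by (auto simp: loc_inj_def q(4)) (auto simp: T_def torsion_of_iff)
  show "loc_surj V (quot T V) (quot_map T V)"
    unfolding loc_surj_def q(3)
  proof (intro ballI cov_all; elim imageE)
    fix x f w v assume "f \<in> Arr C" "Dom C f = x" "w = quot_map T V x v" "v \<in> el V x"
    then show "\<exists>u \<in> el V (Cod C f). quot_map T V (Cod C f) u = Res (quot T V) f w"
      using mod_mapD(4)[OF q(2), of f v] mod_res[OF V, of f v] by (intro bexI[of _ "Res V f v"]) simp_all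
  qed
  show "separated (quot T V)"
    unfolding separated_def q(3)
  proof (intro ballI impI; elim imageE; hypsubst)
    fix x v w assume x: "x \<in> Obj C" and v: "v \<in> el V x" and w: "w \<in> el V x"
      and c: "cov x (\<lambda>f. Res (quot T V) f (quot_map T V x v) = Res (quot T V) f (quot_map T V x w))"
    have "cov x (\<lambda>f. torsion_element C J V (Cod C f) (Res V f (mi V x v w)))"
    proof (rule cov_mono[OF c x])
      fix f assume f: "f \<in> Arr C" "Dom C f = x"
        and "Res (quot T V) f (quot_map T V x v) = Res (quot T V) f (quot_map T V x w)"
      then have "quot_map T V (Cod C f) (Res V f v) = quot_map T V (Cod C f) (Res V f w)"
        using mod_mapD(4)[OF q(2)] v w by simp
      then have "Res V f (mi V x v w) \<in> T (Cod C f)"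
        using f v w mod_res_minus[OF V f(1), of v w]
        by (simp add: quot_map_eq_iff[OF V T cod_obj] mod_res[OF V])
      then show "torsion_element C J V (Cod C f) (Res V f (mi V x v w))"
        by (simp add: T_def torsion_of_def)
    qed
    then have "mi V x v w \<in> T x"
      using torsion_local[OF V x mod_closed(3)[OF V x v w]] mod_closed(3)[OF V x v w]
      by (simp add: T_def torsion_of_def)
    then show "quot_map T V x v = quot_map T V x w" using quot_map_eq_iff[OF V T x v w] by simp
  qed
qed

section \<open>Sheaves\<close>

definition gluing where
  "gluing V \<longleftrightarrow> (\<forall>x \<in> Obj C. \<forall>R \<in> J x. \<forall>\<eta>.
     (\<forall>f \<in> R. \<eta> f \<in> el V (Cod C f)) \<longrightarrow>
     (\<forall>f \<in> R. \<forall>g \<in> Arr C. Dom C g = Cod C f \<longrightarrow> \<eta> (g \<cdot> f) = Res V g (\<eta> f)) \<longrightarrow>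
     (\<exists>v \<in> el V x. \<forall>f \<in> R. Res V f v = \<eta> f))"

lemma gluingD:
  "\<lbrakk>gluing V; x \<in> Obj C; R \<in> J x; \<And>f. f \<in> R \<Longrightarrow> \<eta> f \<in> el V (Cod C f);
    \<And>f g. \<lbrakk>f \<in> R; g \<in> Arr C; Dom C g = Cod C f\<rbrakk> \<Longrightarrow> \<eta> (g \<cdot> f) = Res V g (\<eta> f)\<rbrakk>
    \<Longrightarrow> \<exists>v \<in> el V x. \<forall>f \<in> R. Res V f v = \<eta> f"
  unfolding gluing_def by blast

text \<open>The Yoneda lemma: a natural transformation on the maximal sieve is determined by its
  value at the identity.\<close>

lemma Nat_max_sieve:
  assumes V: "Omod V" and x: "x \<in> Obj C"
  shows "Nat_sieve C (max_sieve C x) (underlying V) = (\<lambda>v. \<lambda>f \<in> max_sieve C x. Res V f v) ` el V x"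
proof (intro equalityI subsetI)
  fix \<eta> assume "\<eta> \<in> Nat_sieve C (max_sieve C x) (underlying V)"
  then have e: "\<eta> \<in> (\<Pi>\<^sub>E f \<in> max_sieve C x. el V (Cod C f))"
    and n: "\<And>f g. \<lbrakk>f \<in> max_sieve C x; g \<in> Arr C; Dom C g = Cod C f\<rbrakk> \<Longrightarrow> \<eta> (g \<cdot> f) = Res V g (\<eta> f)"
    by (auto simp: Nat_sieve_def underlying_def)
  note i = ident_arr[OF x]
  have im: "Ident C x \<in> max_sieve C x" using i by (simp add: max_sieve_def)
  have "\<eta> (Ident C x) \<in> el V x" using PiE_mem[OF e im] i by simp
  moreover have "\<eta> = (\<lambda>f \<in> max_sieve C x. Res V f (\<eta> (Ident C x)))"
  proof
    fix f
    show "\<eta> f = (\<lambda>f \<in> max_sieve C x. Res V f (\<eta> (Ident C x))) f"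
    proof (cases "f \<in> max_sieve C x")
      case True
      then have f: "f \<in> Arr C" "Dom C f = x" by (auto simp: max_sieve_def)
      then have "f \<cdot> Ident C x = f" using ident_right[OF arr_hom[OF f(1)]] by simp
      then show ?thesis using n[OF im f(1)] f i True by simp
    next
      case False
      then show ?thesis using PiE_arb[OF e] by simp
    qed
  qed
  ultimately show "\<eta> \<in> (\<lambda>v. \<lambda>f \<in> max_sieve C x. Res V f v) ` el V x" by blast
next
  fix \<eta> assume "\<eta> \<in> (\<lambda>v. \<lambda>f \<in> max_sieve C x. Res V f v) ` el V x"
  then obtain v where "v \<in> el V x" "\<eta> = (\<lambda>f \<in> max_sieve C x. Res V f v)" by (elim imageE)
  then show "\<eta> \<in> Nat_sieve C (max_sieve C x) (underlying V)"
    by (auto simp: Nat_sieve_def underlying_def max_sieve_def mod_res[OF V] mod_res_comp[OF V] comp_arr)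
qed

lemma restrict_to_cover:
  assumes "x \<in> Obj C" "R \<in> J x"
  shows "restrict (\<lambda>f \<in> max_sieve C x. Res V f v) R = (\<lambda>f \<in> R. Res V f v)"
  using sieveD[OF assms] by (auto simp: max_sieve_def)

text \<open>By Yoneda the restriction map of the sheaf condition starts at the elements over
  \<open>x\<close>. Its injectivity is separatedness, and its surjectivity is gluing of matching
  families.\<close>

lemma is_sheaf_iff:
  assumes V: "Omod V"
  shows "is_sheaf C J (underlying V) \<longleftrightarrow> separated V \<and> gluing V"
proof -
  let ?y = "\<lambda>x v. \<lambda>f \<in> max_sieve C x. Res V f v"
  have Nat: "Nat_sieve C R (underlying V) = {\<eta> \<in> (\<Pi>\<^sub>E f \<in> R. el V (Cod C f)).
     \<forall>f \<in> R. \<forall>g \<in> Arr C. Dom C g = Cod C f \<longrightarrow> \<eta> (g \<cdot> f) = Res V g (\<eta> f)}" for R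
    by (simp add: Nat_sieve_def underlying_def)
  have pre: "set_presheaf C (underlying V)" using V by (simp add: O_module_def)
  show ?thesis
  proof (intro iffI conjI)
    assume "is_sheaf C J (underlying V)"
    then have b: "bij_betw (\<lambda>\<eta>. restrict \<eta> R) (?y x ` el V x) (Nat_sieve C R (underlying V))"
      if "x \<in> Obj C" "R \<in> J x" for x R
      using that Nat_max_sieve[OF V that(1)] by (auto simp: is_sheaf_def)
    show "separated V"
      unfolding separated_def
    proof (intro ballI impI)
      fix x v w assume x: "x \<in> Obj C" and v: "v \<in> el V x" and w: "w \<in> el V x"
        and "cov x (\<lambda>f. Res V f v = Res V f w)"
      then obtain R where R: "R \<in> J x" "\<forall>f \<in> R. Res V f v = Res V f w" by (auto simp: cov_def)
      have "restrict (?y x v) R = restrict (?y x w) R"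
        unfolding restrict_to_cover[OF x R(1)] using R(2) by (intro restrict_ext) simp
      then have "?y x v = ?y x w"
        using inj_onD[OF bij_betw_imp_inj_on[OF b[OF x R(1)]]] v w by blast
      from fun_cong[OF this, of "Ident C x"] show "v = w"
        using ident_arr[OF x] mod_res_ident[OF V x] v w by (simp add: max_sieve_def)
    qed
    show "gluing V"
      unfolding gluing_def
    proof (intro ballI allI impI)
      fix x R \<eta> assume x: "x \<in> Obj C" and R: "R \<in> J x"
        and e: "\<forall>f \<in> R. \<eta> f \<in> el V (Cod C f)"
        and n: "\<forall>f \<in> R. \<forall>g \<in> Arr C. Dom C g = Cod C f \<longrightarrow> \<eta> (g \<cdot> f) = Res V g (\<eta> f)"
      have "restrict \<eta> R \<in> Nat_sieve C R (underlying V)"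
        unfolding Nat using e n sieveD(3)[OF x R] by simp
      also have "\<dots> = (\<lambda>\<eta>. restrict \<eta> R) ` ?y x ` el V x"
        using bij_betw_imp_surj_on[OF b[OF x R]] by simp
      finally obtain v where v: "v \<in> el V x" "restrict \<eta> R = restrict (?y x v) R" by blast
      have "Res V f v = \<eta> f" if "f \<in> R" for f
        using fun_cong[OF v(2)[unfolded restrict_to_cover[OF x R]], of f] that by simp
      then show "\<exists>v \<in> el V x. \<forall>f \<in> R. Res V f v = \<eta> f" using v(1) by blast
    qed
  next
    assume V': "separated V \<and> gluing V"
    show "is_sheaf C J (underlying V)"
      unfolding is_sheaf_def
    proof (intro conjI ballI pre)
      fix x R assume x: "x \<in> Obj C" and R: "R \<in> J x"
      show "bij_betw (\<lambda>\<eta>. restrict \<eta> R) (Nat_sieve C (max_sieve C x) (underlying V)) (Nat_sieve C R (underlying V))"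
        unfolding Nat_max_sieve[OF V x]
      proof (rule bij_betw_imageI)
        show "inj_on (\<lambda>\<eta>. restrict \<eta> R) (?y x ` el V x)"
        proof (intro inj_onI, elim imageE)
          fix \<eta> \<theta> v w assume v: "v \<in> el V x" "\<eta> = ?y x v" and w: "w \<in> el V x" "\<theta> = ?y x w"
            and eq: "restrict \<eta> R = restrict \<theta> R"
          have "cov x (\<lambda>f. Res V f v = Res V f w)"
          proof (rule covI[OF R])
            fix f assume "f \<in> R"
            then show "Res V f v = Res V f w"
              using fun_cong[OF eq[unfolded v(2) w(2) restrict_to_cover[OF x R]], of f] by simp
          qed
          then have "v = w" using V' separatedD[OF _ x v(1) w(1)] by blast
          then show "\<eta> = \<theta>" by (simp add: v(2) w(2))
        qed
        show "(\<lambda>\<eta>. restrict \<eta> R) ` ?y x ` el V x = Nat_sieve C R (underlying V)"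
        proof (intro equalityI subsetI)
          fix \<eta> assume "\<eta> \<in> (\<lambda>\<eta>. restrict \<eta> R) ` ?y x ` el V x"
          then obtain v where v: "v \<in> el V x" "\<eta> = (\<lambda>f \<in> R. Res V f v)"
            unfolding image_image restrict_to_cover[OF x R] by (elim imageE)
          then show "\<eta> \<in> Nat_sieve C R (underlying V)"
            unfolding Nat using sieveD[OF x R]
            by (auto simp: mod_res[OF V] mod_res_comp[OF V])
        next
          fix \<eta> assume "\<eta> \<in> Nat_sieve C R (underlying V)"
          then have e: "\<eta> \<in> (\<Pi>\<^sub>E f \<in> R. el V (Cod C f))"
            and n: "\<And>f g. \<lbrakk>f \<in> R; g \<in> Arr C; Dom C g = Cod C f\<rbrakk> \<Longrightarrow> \<eta> (g \<cdot> f) = Res V g (\<eta> f)"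
            by (auto simp: Nat)
          obtain v where v: "v \<in> el V x" "\<forall>f \<in> R. Res V f v = \<eta> f"
            using gluingD[OF conjunct2[OF V'] x R PiE_mem[OF e] n] by blast
          have "\<eta> = restrict \<eta> R" by (rule PiE_restrict[OF e, symmetric])
          also have "\<dots> = (\<lambda>f \<in> R. Res V f v)" using v(2) by (intro restrict_ext) simp
          finally show "\<eta> \<in> (\<lambda>\<eta>. restrict \<eta> R) ` ?y x ` el V x"
            unfolding image_image restrict_to_cover[OF x R] using v(1) by (intro image_eqI)
        qed
      qed
    qed
  qed
qed

section \<open>Extension of maps into sheaves along local isomorphisms\<close>

lemma sheaf_local_unique:
  assumes "separated F" "Omod Y" "Omod F" "mod_map X Y s" "loc_surj X Y s" "mod_map Y F \<phi>" "mod_map Y F \<psi>"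
    and eq: "\<And>x v. \<lbrakk>x \<in> Obj C; v \<in> el X x\<rbrakk> \<Longrightarrow> \<phi> x (s x v) = \<psi> x (s x v)"
    and x: "x \<in> Obj C" and y: "y \<in> el Y x"
  shows "\<phi> x y = \<psi> x y"
proof (rule separatedD[OF assms(1) x])
  \<comment> \<open>On a cover \<open>y\<close> comes from \<open>X\<close>, where the two maps are
    known to agree.\<close>
  have "cov x (\<lambda>f. \<exists>v \<in> el X (Cod C f). s (Cod C f) v = Res Y f y)"
    using assms(5) x y by (simp add: loc_surj_def)
  then show "cov x (\<lambda>f. Res F f (\<phi> x y) = Res F f (\<psi> x y))"
  proof (rule cov_mono[OF _ x])
    fix f assume f: "f \<in> Arr C" "Dom C f = x"
      and "\<exists>v \<in> el X (Cod C f). s (Cod C f) v = Res Y f y"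
    then obtain v where v: "v \<in> el X (Cod C f)" "s (Cod C f) v = Res Y f y" by (elim bexE)
    then have "\<phi> (Cod C f) (Res Y f y) = \<psi> (Cod C f) (Res Y f y)"
      using eq[OF cod_obj[OF f(1)] v(1)] by simp
    then show "Res F f (\<phi> x y) = Res F f (\<psi> x y)"
      using mod_mapD(4)[OF assms(6) f(1), of y] mod_mapD(4)[OF assms(7) f(1), of y] f y by simp
  qed
qed (use mod_mapD(1)[OF assms(6) x y] mod_mapD(1)[OF assms(7) x y] in simp_all)

text \<open>The value at \<open>y\<close> is glued from the values of \<open>\<chi>\<close> at local
  preimages of \<open>y\<close>. Local surjectivity provides the preimages, local injectivity and
  separatedness make the choice harmless, and gluing assembles the result.\<close>

lemma sheaf_local_exists:
  assumes F: "separated F" "gluing F" and M: "Omod X" "Omod Y" "Omod F"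
    and s: "mod_map X Y s" "loc_inj X Y s" "loc_surj X Y s" and \<chi>: "mod_map X F \<chi>"
  shows "\<exists>\<phi>. mod_map Y F \<phi> \<and> (\<forall>x \<in> Obj C. \<forall>v \<in> el X x. \<phi> x (s x v) = \<chi> x v)"
proof -
  let ?L = "\<lambda>f y z. \<exists>v \<in> el X (Cod C f). s (Cod C f) v = Res Y f y \<and> \<chi> (Cod C f) v = Res F f z"
  \<comment> \<open>The graph of the extension: \<open>y\<close> and \<open>z\<close> come locally
    from a common element of \<open>X\<close>. Once the graph is single-valued, each identity for
    the extension reduces to exhibiting such elements on a cover.\<close>
  define ext where "ext x y z \<longleftrightarrow> z \<in> el F x \<and>
    cov x (\<lambda>f. ?L f y z)" for x y z
  \<comment> \<open>The difference of two preimages is killed by \<open>s\<close>, hence locally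
    zero. So the two values of \<open>\<chi>\<close> agree locally, and \<open>F\<close> is
    separated.\<close>
  have indep: "\<chi> x v = \<chi> x w" if x: "x \<in> Obj C" and v: "v \<in> el X x" and w: "w \<in> el X x"
    and eq: "s x v = s x w" for x v w
  proof (rule separatedD[OF F(1) x])
    have "s x (mi X x v w) = zr Y x" using mod_map_eq_iff[OF M(1,2) s(1) x v w] eq by simp
    then have "cov x (\<lambda>f. Res X f (mi X x v w) = zr X (Cod C f))"
      using s(2) x mod_closed(3)[OF M(1) x v w] by (simp add: loc_inj_def)
    then show "cov x (\<lambda>f. Res F f (\<chi> x v) = Res F f (\<chi> x w))"
    proof (rule cov_mono[OF _ x])
      fix f assume f: "f \<in> Arr C" "Dom C f = x" and "Res X f (mi X x v w) = zr X (Cod C f)"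
      then have "Res X f v = Res X f w"
        using mod_res_minus[OF M(1) f(1), of v w] mod_res[OF M(1) f(1), of v] mod_res[OF M(1) f(1), of w] v w
          mod_diff_zero_iff[OF M(1) cod_obj[OF f(1)], of "Res X f v" "Res X f w"] by simp
      then show "Res F f (\<chi> x v) = Res F f (\<chi> x w)"
        using mod_mapD(4)[OF \<chi> f(1), of v] mod_mapD(4)[OF \<chi> f(1), of w] f v w by simp
    qed
  qed (use mod_mapD(1)[OF \<chi> x] v w in simp_all)
  have uniq: "z = z'" if x: "x \<in> Obj C" and z: "ext x y z" "ext x y z'" for x y z z'
  proof (rule separatedD[OF F(1) x])
    from z have "cov x (\<lambda>f. ?L f y z \<and> ?L f y z')"
      unfolding ext_def using cov_conj x by blast
    then show "cov x (\<lambda>f. Res F f z = Res F f z')"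
    proof (rule cov_mono[OF _ x])
      fix f assume f: "f \<in> Arr C" "Dom C f = x" and
        "?L f y z \<and> ?L f y z'"
      then obtain v v' where v: "v \<in> el X (Cod C f)" "s (Cod C f) v = Res Y f y" "\<chi> (Cod C f) v = Res F f z"
        and v': "v' \<in> el X (Cod C f)" "s (Cod C f) v' = Res Y f y" "\<chi> (Cod C f) v' = Res F f z'"
        by (elim conjE bexE)
      then show "Res F f z = Res F f z'" using indep[OF cod_obj[OF f(1)] v(1) v'(1)] by simp
    qed
  qed (use z in \<open>simp_all add: ext_def\<close>)
  have ex: "\<exists>z. ext x y z" if x: "x \<in> Obj C" and y: "y \<in> el Y x" for x y
  proof -
    let ?Q = "\<lambda>f. \<exists>v \<in> el X (Cod C f). s (Cod C f) v = Res Y f y"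
    let ?R = "{f \<in> Arr C. Dom C f = x \<and> ?Q f}"
    \<comment> \<open>An arbitrary local preimage is chosen for each arrow. No coherence between the
      choices is required, since by \<open>indep\<close> they all give the same value; for a
      composite arrow the restricted preimage may be used.\<close>
    let ?\<eta> = "\<lambda>f. \<chi> (Cod C f) (SOME v. v \<in> el X (Cod C f) \<and> s (Cod C f) v = Res Y f y)"
    have \<eta>: "?\<eta> f = \<chi> (Cod C f) v" if f: "f \<in> Arr C" and v: "v \<in> el X (Cod C f)" "s (Cod C f) v = Res Y f y"
      for f v
    proof -
      have "v \<in> el X (Cod C f) \<and> s (Cod C f) v = Res Y f y" using v by simp
      from someI[of "\<lambda>v. v \<in> el X (Cod C f) \<and> s (Cod C f) v = Res Y f y", OF this]
      show ?thesis using v by (intro indep[OF cod_obj[OF f]]) simp_all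
    qed
    have push: "s (Cod C g) (Res X g v) = Res Y (g \<cdot> f) y"
      if "f \<in> Arr C" "Dom C f = x" "g \<in> Arr C" "Dom C g = Cod C f" "v \<in> el X (Cod C f)" "s (Cod C f) v = Res Y f y" for f g v
      using that mod_mapD(4)[OF s(1) that(3), of v] mod_res_comp[OF M(2) that(1,3,4), of y] y by simp
    have R: "?R \<in> J x"
    proof (rule cov_sieve[OF _ x])
      show "cov x ?Q" using s(3) x y by (simp add: loc_surj_def)
      fix f g assume f: "f \<in> Arr C" "Dom C f = x" and g: "g \<in> Arr C" "Dom C g = Cod C f" and "?Q f"
      then obtain v where v: "v \<in> el X (Cod C f)" "s (Cod C f) v = Res Y f y" by (elim bexE)
      show "?Q (g \<cdot> f)"
        using push[OF f g v] comp_arr[OF f(1) g] mod_res[OF M(1) g(1), of v] v(1) g(2)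
        by (intro bexI[of _ "Res X g v"]) simp_all
    qed
    have "\<exists>z \<in> el F x. \<forall>f \<in> ?R. Res F f z = ?\<eta> f"
    proof (rule gluingD[OF F(2) x R])
      fix f assume "f \<in> ?R"
      then obtain v where f: "f \<in> Arr C" "Dom C f = x"
        and v: "v \<in> el X (Cod C f)" "s (Cod C f) v = Res Y f y" by (elim CollectE conjE bexE)
      then show "?\<eta> f \<in> el F (Cod C f)" using \<eta>[OF f(1) v] mod_mapD(1)[OF \<chi> cod_obj[OF f(1)] v(1)] by simp
      fix g assume g: "g \<in> Arr C" "Dom C g = Cod C f"
      have "?\<eta> (g \<cdot> f) = \<chi> (Cod C (g \<cdot> f)) (Res X g v)"
        using push[OF f g v] mod_res[OF M(1) g(1), of v] v(1) g(2) comp_arr[OF f(1) g]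
        by (intro \<eta>) simp_all
      also have "\<dots> = Res F g (?\<eta> f)"
        using \<eta>[OF f(1) v] mod_mapD(4)[OF \<chi> g(1), of v] v(1) g(2) comp_arr[OF f(1) g] by simp
      finally show "?\<eta> (g \<cdot> f) = Res F g (?\<eta> f)" .
    qed
    then obtain z where z: "z \<in> el F x" "\<forall>f \<in> ?R. Res F f z = ?\<eta> f" by (elim bexE)
    have "cov x (\<lambda>f. ?L f y z)"
    proof (rule covI[OF R])
      fix f assume fR: "f \<in> ?R"
      then obtain v where f: "f \<in> Arr C" "Dom C f = x"
        and v: "v \<in> el X (Cod C f)" "s (Cod C f) v = Res Y f y" by (elim CollectE conjE bexE)
      then show "?L f y z"
        using \<eta>[OF f(1) v] bspec[OF z(2) fR] by (intro bexI[of _ v]) simp_all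
    qed
    then show ?thesis using z(1) by (auto simp: ext_def)
  qed
  define \<phi> where "\<phi> x y = (THE z. ext x y z)" for x y
  have \<phi>: "ext x y (\<phi> x y)" if "x \<in> Obj C" "y \<in> el Y x" for x y
    unfolding \<phi>_def using ex[OF that] uniq[OF that(1)] by (metis theI)
  have eqI: "\<phi> x y = z" if "x \<in> Obj C" "y \<in> el Y x" "ext x y z" for x y z
    using uniq[OF that(1) \<phi>[OF that(1,2)] that(3)] .
  have el: "\<phi> x y \<in> el F x" if "x \<in> Obj C" "y \<in> el Y x" for x y
    using \<phi>[OF that] by (simp add: ext_def)
  have cov\<phi>: "cov x (\<lambda>f. ?L f y (\<phi> x y))"
    if "x \<in> Obj C" "y \<in> el Y x" for x y
    using \<phi>[OF that] by (simp add: ext_def)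
  have "mod_map Y F \<phi>"
    unfolding mod_map_def
  proof (intro conjI ballI)
    fix x y assume x: "x \<in> Obj C" and y: "y \<in> el Y x"
    show "\<phi> x y \<in> el F x" using el x y .
    show "\<phi> x (pl Y x y y') = pl F x (\<phi> x y) (\<phi> x y')" if y': "y' \<in> el Y x" for y'
    proof (rule eqI[OF x])
      show "pl Y x y y' \<in> el Y x" using mod_closed(2)[OF M(2) x y y'] .
      have "cov x (\<lambda>f. ?L f (pl Y x y y') (pl F x (\<phi> x y) (\<phi> x y')))"
      proof (rule cov_mono[OF cov_conj[OF cov\<phi>[OF x y] cov\<phi>[OF x y'] x] x], elim conjE bexE)
        fix f v v' assume f: "f \<in> Arr C" "Dom C f = x"
          and v: "v \<in> el X (Cod C f)" "s (Cod C f) v = Res Y f y" "\<chi> (Cod C f) v = Res F f (\<phi> x y)"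
          and v': "v' \<in> el X (Cod C f)" "s (Cod C f) v' = Res Y f y'" "\<chi> (Cod C f) v' = Res F f (\<phi> x y')"
        note c = cod_obj[OF f(1)]
        show "?L f (pl Y x y y') (pl F x (\<phi> x y) (\<phi> x y'))"
          using v v' f y y' el[OF x y] el[OF x y'] mod_closed(2)[OF M(1) c v(1) v'(1)]
            mod_mapD(2)[OF s(1) c v(1) v'(1)] mod_mapD(2)[OF \<chi> c v(1) v'(1)]
            mod_res_add[OF M(2) f(1), of y y'] mod_res_add[OF M(3) f(1), of "\<phi> x y" "\<phi> x y'"]
          by (intro bexI[of _ "pl X (Cod C f) v v'"]) simp_all
      qed
      then show "ext x (pl Y x y y') (pl F x (\<phi> x y) (\<phi> x y'))"
        using mod_closed(2)[OF M(3) x el[OF x y] el[OF x y']] by (simp add: ext_def)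
    qed
    show "\<phi> x (sm Y x a y) = sm F x a (\<phi> x y)" if a: "a \<in> scalars x" for a
    proof (rule eqI[OF x])
      show "sm Y x a y \<in> el Y x" using mod_closed(4)[OF M(2) x a y] .
      have "cov x (\<lambda>f. ?L f (sm Y x a y) (sm F x a (\<phi> x y)))"
      proof (rule cov_mono[OF cov\<phi>[OF x y] x], elim conjE bexE)
        fix f v assume f: "f \<in> Arr C" "Dom C f = x"
          and v: "v \<in> el X (Cod C f)" "s (Cod C f) v = Res Y f y" "\<chi> (Cod C f) v = Res F f (\<phi> x y)"
        note c = cod_obj[OF f(1)]
        have b: "Res \<O> f a \<in> scalars (Cod C f)" using scalar_res[OF f(1)] a f(2) by simp
        show "?L f (sm Y x a y) (sm F x a (\<phi> x y))"
          using v f y a el[OF x y] mod_closed(4)[OF M(1) c b v(1)]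
            mod_mapD(3)[OF s(1) c b v(1)] mod_mapD(3)[OF \<chi> c b v(1)]
            mod_res_smult[OF M(2) f(1), of a y] mod_res_smult[OF M(3) f(1), of a "\<phi> x y"]
          by (intro bexI[of _ "sm X (Cod C f) (Res \<O> f a) v"]) simp_all
      qed
      then show "ext x (sm Y x a y) (sm F x a (\<phi> x y))"
        using mod_closed(4)[OF M(3) x a el[OF x y]] by (simp add: ext_def)
    qed
  next
    fix f y assume f: "f \<in> Arr C" and y: "y \<in> el Y (Dom C f)"
    note c = cod_obj[OF f] and d = dom_obj[OF f]
    show "\<phi> (Cod C f) (Res Y f y) = Res F f (\<phi> (Dom C f) y)"
    proof (rule eqI[OF c])
      show "Res Y f y \<in> el Y (Cod C f)" using mod_res[OF M(2) f y] .
      have "cov (Cod C f) (\<lambda>g. \<exists>v \<in> el X (Cod C g). s (Cod C g) v = Res Y g (Res Y f y) \<and>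
          \<chi> (Cod C g) v = Res F g (Res F f (\<phi> (Dom C f) y)))"
        using cov_pull[OF cov\<phi>[OF d y] f]
        by (rule cov_mono[OF _ c])
          (use y el[OF d y] in \<open>simp add: comp_arr[OF f] mod_res_comp[OF M(2) f] mod_res_comp[OF M(3) f]\<close>)
      then show "ext (Cod C f) (Res Y f y) (Res F f (\<phi> (Dom C f) y))"
        using mod_res[OF M(3) f el[OF d y]] by (simp add: ext_def)
    qed
  qed
  moreover have "\<phi> x (s x v) = \<chi> x v" if x: "x \<in> Obj C" and v: "v \<in> el X x" for x v
  proof (rule eqI[OF x mod_mapD(1)[OF s(1) x v]])
    have "cov x (\<lambda>f. ?L f (s x v) (\<chi> x v))"
    proof (rule cov_all[OF x])
      fix f assume "f \<in> Arr C" "Dom C f = x"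
      then show "?L f (s x v) (\<chi> x v)"
        using mod_mapD(4)[OF s(1), of f v] mod_mapD(4)[OF \<chi>, of f v] v mod_res[OF M(1), of f v]
        by (intro bexI[of _ "Res X f v"]) simp_all
    qed
    then show "ext x (s x v) (\<chi> x v)" using mod_mapD(1)[OF \<chi> x v] by (simp add: ext_def)
  qed
  ultimately show ?thesis by blast
qed

section \<open>Sheafification of separated modules\<close>

definition pairs where
  "pairs V x = {(f, v). f \<in> Arr C \<and> Dom C f = x \<and> v \<in> el V (Cod C f)}"

text \<open>
  A matching family on a cover is represented by its graph, and its germ by the largest graph that
  agrees with it locally. So elements of \<open>V\<^sup>+\<close> are sets rather than classes of families, and
  restriction is a preimage.
\<close>

definition matching where
  "matching V x G \<longleftrightarrow> G \<subseteq> pairs V x \<and>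
     (\<forall>f v w. (f, v) \<in> G \<longrightarrow> (f, w) \<in> G \<longrightarrow> v = w) \<and>
     (\<forall>f v g. (f, v) \<in> G \<longrightarrow> g \<in> Arr C \<longrightarrow> Dom C g = Cod C f \<longrightarrow> (g \<cdot> f, Res V g v) \<in> G) \<and>
     cov x (\<lambda>f. \<exists>v. (f, v) \<in> G)"

definition sat where
  "sat V x G = {(f, v) \<in> pairs V x. cov (Cod C f) (\<lambda>g. (g \<cdot> f, Res V g v) \<in> G)}"

text \<open>Over a module every matching family lies in its saturation
  (\<open>matching_sat\<close>), so the stated inclusion makes germs the fixed points of
  \<open>sat\<close>.\<close>

definition germs where
  "germs V x = {G. matching V x G \<and> sat V x G \<subseteq> G}"

lemma matchingD:
  assumes "matching V x G"
  shows "(f, v) \<in> G \<Longrightarrow> f \<in> Arr C" "(f, v) \<in> G \<Longrightarrow> Dom C f = x" "(f, v) \<in> G \<Longrightarrow> v \<in> el V (Cod C f)"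
    "\<lbrakk>(f, v) \<in> G; (f, w) \<in> G\<rbrakk> \<Longrightarrow> v = w"
    "\<lbrakk>(f, v) \<in> G; g \<in> Arr C; Dom C g = Cod C f\<rbrakk> \<Longrightarrow> (g \<cdot> f, Res V g v) \<in> G"
    "cov x (\<lambda>f. \<exists>v. (f, v) \<in> G)"
  using assms by (auto simp: matching_def pairs_def)

lemma matchingI:
  assumes "\<And>f v. (f, v) \<in> G \<Longrightarrow> f \<in> Arr C \<and> Dom C f = x \<and> v \<in> el V (Cod C f)"
    "\<And>f v w. \<lbrakk>(f, v) \<in> G; (f, w) \<in> G\<rbrakk> \<Longrightarrow> v = w"
    "\<And>f v g. \<lbrakk>(f, v) \<in> G; g \<in> Arr C; Dom C g = Cod C f\<rbrakk> \<Longrightarrow> (g \<cdot> f, Res V g v) \<in> G"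
    "cov x (\<lambda>f. \<exists>v. (f, v) \<in> G)"
  shows "matching V x G"
  unfolding matching_def pairs_def
  by (intro conjI allI impI subsetI) (use assms in \<open>auto simp del: split_paired_All\<close>)

lemma matching_sat:
  assumes "Omod V" "matching V x G" "x \<in> Obj C"
  shows "G \<subseteq> sat V x G"
proof (rule subrelI)
  fix f v assume fv: "(f, v) \<in> G"
  note m = matchingD(1-3)[OF assms(2) fv]
  have "cov (Cod C f) (\<lambda>g. (g \<cdot> f, Res V g v) \<in> G)"
    by (rule cov_all) (use m cod_obj matchingD(5)[OF assms(2) fv] in simp_all)
  then show "(f, v) \<in> sat V x G" using m by (simp add: sat_def pairs_def)
qed

text \<open>Two values that the saturation assigns to one arrow agree on a cover, where both
  restrict into \<open>G\<close>; separatedness is needed to conclude that they are equal. A second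
  saturation adds nothing because covers of covers are covers.\<close>

lemma sat_germ:
  assumes V: "Omod V" "separated V" and G: "matching V x G" and x: "x \<in> Obj C"
  shows "sat V x G \<in> germs V x"
proof -
  have satD: "f \<in> Arr C" "Dom C f = x" "v \<in> el V (Cod C f)" "cov (Cod C f) (\<lambda>g. (g \<cdot> f, Res V g v) \<in> G)"
    if "(f, v) \<in> sat V x G" for f v using that by (auto simp: sat_def pairs_def)
  have "matching V x (sat V x G)"
  proof (rule matchingI)
    show "f \<in> Arr C \<and> Dom C f = x \<and> v \<in> el V (Cod C f)" if "(f, v) \<in> sat V x G" for f v
      using satD[OF that] by simp
    show "v = w" if fv: "(f, v) \<in> sat V x G" and fw: "(f, w) \<in> sat V x G" for f v w
    proof (rule separatedD[OF V(2)])
      show c: "Cod C f \<in> Obj C" using cod_obj satD(1)[OF fv] .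
      show "v \<in> el V (Cod C f)" "w \<in> el V (Cod C f)" using satD(3)[OF fv] satD(3)[OF fw] .
      show "cov (Cod C f) (\<lambda>g. Res V g v = Res V g w)"
        by (rule cov_mono[OF cov_conj[OF satD(4)[OF fv] satD(4)[OF fw] c] c], elim conjE)
          (rule matchingD(4)[OF G])
    qed
    show "(g \<cdot> f, Res V g v) \<in> sat V x G" if fv: "(f, v) \<in> sat V x G" and g: "g \<in> Arr C" "Dom C g = Cod C f"
      for f v g
    proof -
      note f = satD[OF fv]
      have "cov (Cod C g) (\<lambda>h. ((h \<cdot> g) \<cdot> f, Res V (h \<cdot> g) v) \<in> G)"
        using cov_pull[OF _ g(1), of "\<lambda>g. (g \<cdot> f, Res V g v) \<in> G"] f(4) g(2) by simp
      then have "cov (Cod C g) (\<lambda>h. (h \<cdot> (g \<cdot> f), Res V h (Res V g v)) \<in> G)"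
        by (rule cov_mono[OF _ cod_obj[OF g(1)]])
          (use f g in \<open>simp add: comp_assoc_arr mod_res_comp[OF V(1)]\<close>)
      then show ?thesis using f g comp_arr[OF f(1) g] mod_res[OF V(1) g(1)] by (simp add: sat_def pairs_def)
    qed
    show "cov x (\<lambda>f. \<exists>v. (f, v) \<in> sat V x G)"
      by (rule cov_mono[OF matchingD(6)[OF G] x]) (use matching_sat[OF V(1) G x] in blast)
  qed
  moreover have "(f, v) \<in> sat V x G" if "(f, v) \<in> sat V x (sat V x G)" for f v
  proof -
    have f: "f \<in> Arr C" "Dom C f = x" "v \<in> el V (Cod C f)"
      and c: "cov (Cod C f) (\<lambda>g. (g \<cdot> f, Res V g v) \<in> sat V x G)"
      using that by (auto simp: sat_def pairs_def)
    have "cov (Cod C f) (\<lambda>g. (g \<cdot> f, Res V g v) \<in> G)"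
    proof (rule cov_trans[OF cov_mono[OF c]])
      fix g assume g: "g \<in> Arr C" "Dom C g = Cod C f" and gv: "(g \<cdot> f, Res V g v) \<in> sat V x G"
      have "cov (Cod C g) (\<lambda>h. (h \<cdot> (g \<cdot> f), Res V h (Res V g v)) \<in> G)"
        using satD(4)[OF gv] comp_arr[OF f(1) g] by simp
      then show "cov (Cod C g) (\<lambda>h. (h \<cdot> g \<cdot> f, Res V (h \<cdot> g) v) \<in> G)"
        by (rule cov_mono[OF _ cod_obj[OF g(1)]])
          (use f g in \<open>simp add: comp_assoc_arr mod_res_comp[OF V(1)]\<close>)
    qed (use f cod_obj in simp_all)
    then show ?thesis using f by (simp add: sat_def pairs_def)
  qed
  ultimately show ?thesis by (auto simp: germs_def)
qed

lemma germs_matching: "G \<in> germs V x \<Longrightarrow> matching V x G"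
  by (simp add: germs_def)

lemmas germsD = matchingD[OF germs_matching]

text \<open>A pair of \<open>G\<close> restricts into \<open>H\<close> along the pulled-back cover,
  so it lies in the saturation of \<open>H\<close>, which is \<open>H\<close>. Equality of germs is
  therefore tested on any one cover.\<close>

lemma germs_subset:
  assumes V: "Omod V" and G: "G \<in> germs V x" "H \<in> germs V x" and x: "x \<in> Obj C"
    and c: "cov x (\<lambda>f. \<exists>v. (f, v) \<in> G \<and> (f, v) \<in> H)"
  shows "G \<subseteq> H"
proof (rule subrelI)
  fix f v assume fv: "(f, v) \<in> G"
  note m = germsD[OF G(1)]
  note f = m(1-3)[OF fv]
  have "cov (Cod C f) (\<lambda>g. \<exists>w. (g \<cdot> f, w) \<in> G \<and> (g \<cdot> f, w) \<in> H)"
    using cov_pull[of f "\<lambda>f. \<exists>v. (f, v) \<in> G \<and> (f, v) \<in> H"] c f by simp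
  then have "cov (Cod C f) (\<lambda>g. (g \<cdot> f, Res V g v) \<in> H)"
  proof (rule cov_mono[OF _ cod_obj[OF f(1)]])
    fix g assume g: "g \<in> Arr C" "Dom C g = Cod C f" and "\<exists>w. (g \<cdot> f, w) \<in> G \<and> (g \<cdot> f, w) \<in> H"
    then obtain w where w: "(g \<cdot> f, w) \<in> G" "(g \<cdot> f, w) \<in> H" by blast
    have "w = Res V g v" using m(4)[OF w(1) m(5)[OF fv g]] .
    then show "(g \<cdot> f, Res V g v) \<in> H" using w by simp
  qed
  then have "(f, v) \<in> sat V x H" using f by (simp add: sat_def pairs_def)
  then show "(f, v) \<in> H" using G(2) by (auto simp: germs_def)
qed

lemma germs_eqI:
  assumes "Omod V" "G \<in> germs V x" "H \<in> germs V x" "x \<in> Obj C"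
    "cov x (\<lambda>f. \<exists>v. (f, v) \<in> G \<and> (f, v) \<in> H)"
  shows "G = H"
proof (rule equalityI)
  show "G \<subseteq> H" by (rule germs_subset[OF assms])
  show "H \<subseteq> G"
    by (rule germs_subset[OF assms(1,3,2,4) cov_mono[OF assms(5,4)]]) blast
qed

section \<open>The module of germs\<close>

definition germ where
  "germ V x v = {(f, w). f \<in> Arr C \<and> Dom C f = x \<and> w = Res V f v}"

text \<open>Sums and multiples are formed where the graphs are defined and then saturated, since
  pointwise operations need not give the largest graph. Restriction needs no saturation: the
  preimage of a saturated graph is saturated.\<close>

definition Plus :: "('o, 'm, 'r, 'v) module_presheaf \<Rightarrow> ('o, 'm, 'r, ('m \<times> 'v) set) module_presheaf" where
  "Plus V = \<lparr>Sec = (\<lambda>x. \<lparr>carrier = germs V x, mult = undefined, one = undefined,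
     zero = germ V x (zr V x),
     add = (\<lambda>G H. sat V x {(f, pl V (Cod C f) v w) | f v w. (f, v) \<in> G \<and> (f, w) \<in> H}),
     smult = (\<lambda>a G. sat V x {(f, sm V (Cod C f) (Res \<O> f a) v) | f v. (f, v) \<in> G})\<rparr>),
     Res = (\<lambda>f G. {(g, v). g \<in> Arr C \<and> Dom C g = Cod C f \<and> (g \<cdot> f, v) \<in> G})\<rparr>"

lemma plus_simps [simp]:
  "el (Plus V) x = germs V x" "zr (Plus V) x = germ V x (zr V x)"
  by (simp_all add: Plus_def)

lemma plus_Res: "(g, v) \<in> Res (Plus V) f G \<longleftrightarrow> g \<in> Arr C \<and> Dom C g = Cod C f \<and> (g \<cdot> f, v) \<in> G"
  by (simp add: Plus_def)

lemma germ_iff: "(f, w) \<in> germ V x v \<longleftrightarrow> f \<in> Arr C \<and> Dom C f = x \<and> w = Res V f v"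
  by (simp add: germ_def)

text \<open>The graph of \<open>v\<close> is defined on every arrow out of \<open>x\<close>. By
  separatedness, an element that is locally a restriction of \<open>v\<close> is one already, so the
  graph is saturated as it stands.\<close>

lemma germ_germs:
  assumes V: "Omod V" "separated V" and x: "x \<in> Obj C" and v: "v \<in> el V x"
  shows "germ V x v \<in> germs V x"
proof -
  have "matching V x (germ V x v)"
    by (rule matchingI)
      (use v x in \<open>auto simp: germ_iff comp_arr mod_res[OF V(1)] mod_res_comp[OF V(1)] intro!: cov_all\<close>)
  moreover have "(f, w) \<in> germ V x v" if "(f, w) \<in> sat V x (germ V x v)" for f w
  proof -
    have f: "f \<in> Arr C" "Dom C f = x" "w \<in> el V (Cod C f)"
      and c: "cov (Cod C f) (\<lambda>g. (g \<cdot> f, Res V g w) \<in> germ V x v)"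
      using that by (auto simp: sat_def pairs_def)
    have "w = Res V f v"
    proof (rule separatedD[OF V(2) cod_obj[OF f(1)] f(3)])
      show "cov (Cod C f) (\<lambda>g. Res V g w = Res V g (Res V f v))"
        by (rule cov_mono[OF c cod_obj[OF f(1)]])
          (use f v in \<open>simp add: germ_iff mod_res_comp[OF V(1)]\<close>)
    qed (use mod_res[OF V(1) f(1)] f v in simp)
    then show ?thesis using f by (simp add: germ_iff)
  qed
  ultimately show ?thesis by (auto simp: germs_def)
qed

context
  fixes V :: "('o, 'm, 'r, 'v) module_presheaf"
  assumes V: "Omod V" and sep: "separated V"
begin

text \<open>The pointwise sums form a matching family, defined on a cover because two covers have a
  common refinement. The second claim gives access to the sum without unfolding \<open>sat\<close>;
  germs being determined on a cover, it is enough for computing with sums.\<close>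

lemma plus_add:
  assumes x: "x \<in> Obj C" and G: "G \<in> germs V x" and H: "H \<in> germs V x"
  shows "pl (Plus V) x G H \<in> germs V x"
    "\<lbrakk>(f, v) \<in> G; (f, w) \<in> H\<rbrakk> \<Longrightarrow> (f, pl V (Cod C f) v w) \<in> pl (Plus V) x G H"
proof -
  let ?S = "{(f, pl V (Cod C f) v w) | f v w. (f, v) \<in> G \<and> (f, w) \<in> H}"
  note g = germsD[OF G] and h = germsD[OF H]
  have m: "matching V x ?S"
  proof (rule matchingI; (elim CollectE exE conjE Pair_inject; hypsubst)?)
    fix f v w assume v: "(f, v) \<in> G" and w: "(f, w) \<in> H"
    show "f \<in> Arr C \<and> Dom C f = x \<and> pl V (Cod C f) v w \<in> el V (Cod C f)"
      using g(1-3)[OF v] h(3)[OF w] mod_closed(2)[OF V cod_obj] by simp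
    show "pl V (Cod C f) v w = pl V (Cod C f) v' w'" if "(f, v') \<in> G" "(f, w') \<in> H" for v' w'
      using g(4)[OF v that(1)] h(4)[OF w that(2)] by simp
    fix k assume k: "k \<in> Arr C" "Dom C k = Cod C f"
    have "Res V k (pl V (Cod C f) v w) = pl V (Cod C (k \<cdot> f)) (Res V k v) (Res V k w)"
      using mod_res_add[OF V k(1), of v w] g(3)[OF v] h(3)[OF w] k comp_arr[OF g(1)[OF v] k] by simp
    then show "(k \<cdot> f, Res V k (pl V (Cod C f) v w)) \<in> ?S"
      using g(5)[OF v k] h(5)[OF w k] by blast
  next
    show "cov x (\<lambda>f. \<exists>v. (f, v) \<in> ?S)"
      by (rule cov_mono[OF cov_conj[OF g(6) h(6) x] x]) blast
  qed
  have e: "pl (Plus V) x G H = sat V x ?S" by (simp add: Plus_def)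
  show "pl (Plus V) x G H \<in> germs V x" unfolding e by (rule sat_germ[OF V sep m x])
  show "\<lbrakk>(f, v) \<in> G; (f, w) \<in> H\<rbrakk> \<Longrightarrow> (f, pl V (Cod C f) v w) \<in> pl (Plus V) x G H"
    unfolding e using matching_sat[OF V m x] by blast
qed

text \<open>At an arrow \<open>f\<close> the scalar acts through its restriction along
  \<open>f\<close>; functoriality of the ring restrictions makes the scaled family matching.\<close>

lemma plus_smult:
  assumes x: "x \<in> Obj C" and a: "a \<in> scalars x" and G: "G \<in> germs V x"
  shows "sm (Plus V) x a G \<in> germs V x"
    "(f, v) \<in> G \<Longrightarrow> (f, sm V (Cod C f) (Res \<O> f a) v) \<in> sm (Plus V) x a G"
proof -
  let ?S = "{(f, sm V (Cod C f) (Res \<O> f a) v) | f v. (f, v) \<in> G}"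
  note g = germsD[OF G]
  have m: "matching V x ?S"
  proof (rule matchingI; (elim CollectE exE conjE Pair_inject; hypsubst)?)
    fix f v assume v: "(f, v) \<in> G"
    have b: "Res \<O> f a \<in> scalars (Cod C f)" using scalar_res[of f a] g(1-2)[OF v] a by simp
    show "f \<in> Arr C \<and> Dom C f = x \<and> sm V (Cod C f) (Res \<O> f a) v \<in> el V (Cod C f)"
      using g(1-3)[OF v] mod_closed(4)[OF V cod_obj b] by simp
    show "sm V (Cod C f) (Res \<O> f a) v = sm V (Cod C f) (Res \<O> f a) v'" if "(f, v') \<in> G" for v'
      using g(4)[OF v that] by simp
    fix k assume k: "k \<in> Arr C" "Dom C k = Cod C f"
    have "Res V k (sm V (Cod C f) (Res \<O> f a) v) = sm V (Cod C (k \<cdot> f)) (Res \<O> (k \<cdot> f) a) (Res V k v)"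
      using mod_res_smult[OF V k(1), of "Res \<O> f a" v] b g(1-3)[OF v] k comp_arr[OF g(1)[OF v] k]
        scalar_comp[OF g(1)[OF v] k, of a] a by simp
    then show "(k \<cdot> f, Res V k (sm V (Cod C f) (Res \<O> f a) v)) \<in> ?S"
      using g(5)[OF v k] by blast
  next
    show "cov x (\<lambda>f. \<exists>v. (f, v) \<in> ?S)"
      by (rule cov_mono[OF g(6) x]) blast
  qed
  have e: "sm (Plus V) x a G = sat V x ?S" by (simp add: Plus_def)
  show "sm (Plus V) x a G \<in> germs V x" unfolding e by (rule sat_germ[OF V sep m x])
  show "(f, v) \<in> G \<Longrightarrow> (f, sm V (Cod C f) (Res \<O> f a) v) \<in> sm (Plus V) x a G"
    unfolding e using matching_sat[OF V m x] by blast
qed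

lemma plus_res_germs:
  assumes f: "f \<in> Arr C" and G: "G \<in> germs V (Dom C f)"
  shows "Res (Plus V) f G \<in> germs V (Cod C f)"
proof -
  note g = germsD[OF G]
  have "matching V (Cod C f) (Res (Plus V) f G)"
  proof (rule matchingI)
    fix k v assume "(k, v) \<in> Res (Plus V) f G"
    then have k: "k \<in> Arr C" "Dom C k = Cod C f" and v: "(k \<cdot> f, v) \<in> G" by (simp_all add: plus_Res)
    show "k \<in> Arr C \<and> Dom C k = Cod C f \<and> v \<in> el V (Cod C k)"
      using k g(3)[OF v] comp_arr[OF f k] by simp
    show "v = w" if "(k, w) \<in> Res (Plus V) f G" for w using g(4)[OF v] that by (simp add: plus_Res)
    fix l assume l: "l \<in> Arr C" "Dom C l = Cod C k"
    then have "(l \<cdot> (k \<cdot> f), Res V l v) \<in> G" using g(5)[OF v l(1)] comp_arr[OF f k] by simp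
    then show "(l \<cdot> k, Res V l v) \<in> Res (Plus V) f G"
      using comp_arr[OF k(1) l] k l f by (simp add: comp_assoc_arr plus_Res)
  next
    show "cov (Cod C f) (\<lambda>k. \<exists>v. (k, v) \<in> Res (Plus V) f G)"
      by (rule cov_mono[OF cov_pull[OF g(6) f] cod_obj[OF f]]) (simp add: plus_Res)
  qed
  moreover have "(k, v) \<in> Res (Plus V) f G" if "(k, v) \<in> sat V (Cod C f) (Res (Plus V) f G)" for k v
  proof -
    have k: "k \<in> Arr C" "Dom C k = Cod C f" "v \<in> el V (Cod C k)"
      and c: "cov (Cod C k) (\<lambda>l. (l \<cdot> k, Res V l v) \<in> Res (Plus V) f G)"
      using that by (auto simp: sat_def pairs_def)
    have "cov (Cod C k) (\<lambda>l. (l \<cdot> (k \<cdot> f), Res V l v) \<in> G)"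
      by (rule cov_mono[OF c cod_obj[OF k(1)]]) (use f k in \<open>simp add: plus_Res comp_assoc_arr\<close>)
    then have "(k \<cdot> f, v) \<in> sat V (Dom C f) G" using k comp_arr[OF f k(1,2)] by (simp add: sat_def pairs_def)
    then show ?thesis using G k by (auto simp: germs_def plus_Res)
  qed
  ultimately show ?thesis by (auto simp: germs_def)
qed

lemma plus_eqI:
  assumes "x \<in> Obj C" "G \<in> germs V x" "H \<in> germs V x" "cov x Q"
    "\<And>f. \<lbrakk>f \<in> Arr C; Dom C f = x; Q f\<rbrakk> \<Longrightarrow> \<exists>v. (f, v) \<in> G \<and> (f, v) \<in> H"
  shows "G = H"
  by (rule germs_eqI[OF V assms(2,3,1) cov_mono[OF assms(4,1,5)]])

text \<open>Every law is tested by \<open>plus_eqI\<close> on a cover where all germs involved have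
  values. There it becomes the corresponding law in \<open>V\<close>, combined with the ring
  homomorphism laws for restricted scalars.\<close>

lemma plus_module: "Omod (Plus V)"
proof (rule O_moduleI; unfold plus_simps)
  fix f G assume "f \<in> Arr C" "G \<in> germs V (Dom C f)"
  then show "Res (Plus V) f G \<in> germs V (Cod C f)" by (rule plus_res_germs)
next
  fix x G assume x: "x \<in> Obj C" and G: "G \<in> germs V x"
  note g = germsD[OF G]
  have "(f, v) \<in> Res (Plus V) (Ident C x) G \<longleftrightarrow> (f, v) \<in> G" for f v
    using ident_arr[OF x] ident_right[OF arr_hom, of f] g(1,2)[of f v] by (auto simp: plus_Res)
  then show "Res (Plus V) (Ident C x) G = G" by auto
next
  fix f g G assume f: "f \<in> Arr C" and g: "g \<in> Arr C" "Dom C g = Cod C f"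
  have "(h, v) \<in> Res (Plus V) (g \<cdot> f) G \<longleftrightarrow> (h, v) \<in> Res (Plus V) g (Res (Plus V) f G)" for h v
    using f g comp_arr[OF f g] comp_arr[OF g(1), of h] by (auto simp: plus_Res comp_assoc_arr)
  then show "Res (Plus V) (g \<cdot> f) G = Res (Plus V) g (Res (Plus V) f G)" by auto
next
  fix f G H assume f: "f \<in> Arr C" and G: "G \<in> germs V (Dom C f)" and H: "H \<in> germs V (Dom C f)"
  note m = germsD[OF G] germsD[OF H]
  note d = dom_obj[OF f] and c = cod_obj[OF f]
  note rG = plus_res_germs[OF f G] and rH = plus_res_germs[OF f H]
  show "Res (Plus V) f (pl (Plus V) (Dom C f) G H) =
    pl (Plus V) (Cod C f) (Res (Plus V) f G) (Res (Plus V) f H)"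
  proof (rule plus_eqI[OF c plus_res_germs[OF f plus_add(1)[OF d G H]] plus_add(1)[OF c rG rH]
        cov_conj[OF cov_pull[OF m(6) f] cov_pull[OF m(12) f] c]], elim conjE exE)
    fix g v w assume g: "g \<in> Arr C" "Dom C g = Cod C f" and v: "(g \<cdot> f, v) \<in> G" and w: "(g \<cdot> f, w) \<in> H"
    have "(g \<cdot> f, pl V (Cod C g) v w) \<in> pl (Plus V) (Dom C f) G H"
      using plus_add(2)[OF d G H v w] comp_arr[OF f g] by simp
    moreover have "(g, pl V (Cod C g) v w) \<in> pl (Plus V) (Cod C f) (Res (Plus V) f G) (Res (Plus V) f H)"
      by (rule plus_add(2)[OF c rG rH]) (use g v w in \<open>simp_all add: plus_Res\<close>)
    ultimately show "\<exists>u. (g, u) \<in> Res (Plus V) f (pl (Plus V) (Dom C f) G H) \<and>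
      (g, u) \<in> pl (Plus V) (Cod C f) (Res (Plus V) f G) (Res (Plus V) f H)"
      using g by (auto simp: plus_Res)
  qed
next
  fix f a G assume f: "f \<in> Arr C" and a: "a \<in> scalars (Dom C f)" and G: "G \<in> germs V (Dom C f)"
  note m = germsD[OF G]
  note d = dom_obj[OF f] and c = cod_obj[OF f] and b = scalar_res[OF f a]
  note rG = plus_res_germs[OF f G]
  show "Res (Plus V) f (sm (Plus V) (Dom C f) a G) = sm (Plus V) (Cod C f) (Res \<O> f a) (Res (Plus V) f G)"
  proof (rule plus_eqI[OF c plus_res_germs[OF f plus_smult(1)[OF d a G]] plus_smult(1)[OF c b rG]
        cov_pull[OF m(6) f]], elim conjE exE)
    fix g v assume g: "g \<in> Arr C" "Dom C g = Cod C f" and v: "(g \<cdot> f, v) \<in> G"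
    have "(g \<cdot> f, sm V (Cod C g) (Res \<O> g (Res \<O> f a)) v) \<in> sm (Plus V) (Dom C f) a G"
      using plus_smult(2)[OF d a G v] comp_arr[OF f g] scalar_comp[OF f g a] by simp
    moreover have "(g, sm V (Cod C g) (Res \<O> g (Res \<O> f a)) v) \<in> sm (Plus V) (Cod C f) (Res \<O> f a) (Res (Plus V) f G)"
      by (rule plus_smult(2)[OF c b rG]) (use g v in \<open>simp add: plus_Res\<close>)
    ultimately show "\<exists>u. (g, u) \<in> Res (Plus V) f (sm (Plus V) (Dom C f) a G) \<and>
      (g, u) \<in> sm (Plus V) (Cod C f) (Res \<O> f a) (Res (Plus V) f G)"
      using g by (auto simp: plus_Res)
  qed
next
  fix x assume "x \<in> Obj C"
  then show "germ V x (zr V x) \<in> germs V x" using germ_germs[OF V sep] mod_closed(1)[OF V] by simp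
next
  fix x G H assume x: "x \<in> Obj C" and G: "G \<in> germs V x" and H: "H \<in> germs V x"
  then show "pl (Plus V) x G H \<in> germs V x" by (rule plus_add(1))
  note m = germsD[OF G] germsD[OF H]
  show "pl (Plus V) x G H = pl (Plus V) x H G"
  proof (rule plus_eqI[OF x plus_add(1)[OF x G H] plus_add(1)[OF x H G] cov_conj[OF m(6) m(12) x]], elim conjE exE)
    fix f v w assume "f \<in> Arr C" and v: "(f, v) \<in> G" and w: "(f, w) \<in> H"
    then show "\<exists>u. (f, u) \<in> pl (Plus V) x G H \<and> (f, u) \<in> pl (Plus V) x H G"
      using plus_add(2)[OF x G H v w] plus_add(2)[OF x H G w v]
        mod_axioms(2)[OF V cod_obj m(3)[OF v] m(9)[OF w]]
      by (intro exI[of _ "pl V (Cod C f) v w"]) simp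
  qed
next
  fix x a G assume x: "x \<in> Obj C" and a: "a \<in> scalars x" and G: "G \<in> germs V x"
  then show "sm (Plus V) x a G \<in> germs V x" by (rule plus_smult(1))
next
  fix x G H K assume x: "x \<in> Obj C" and G: "G \<in> germs V x" and H: "H \<in> germs V x" and K: "K \<in> germs V x"
  note m = germsD[OF G] germsD[OF H] germsD[OF K]
  note GH = plus_add(1)[OF x G H] and HK = plus_add(1)[OF x H K]
  show "pl (Plus V) x (pl (Plus V) x G H) K = pl (Plus V) x G (pl (Plus V) x H K)"
  proof (rule plus_eqI[OF x plus_add(1)[OF x GH K] plus_add(1)[OF x G HK]
        cov_conj[OF cov_conj[OF m(6) m(12) x] m(18) x]], elim conjE exE)
    fix f u v w assume f: "f \<in> Arr C" and u: "(f, u) \<in> G" and v: "(f, v) \<in> H" and w: "(f, w) \<in> K"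
    show "\<exists>z. (f, z) \<in> pl (Plus V) x (pl (Plus V) x G H) K \<and> (f, z) \<in> pl (Plus V) x G (pl (Plus V) x H K)"
      using plus_add(2)[OF x GH K plus_add(2)[OF x G H u v] w] plus_add(2)[OF x G HK u plus_add(2)[OF x H K v w]]
        mod_axioms(1)[OF V cod_obj[OF f] m(3)[OF u] m(9)[OF v] m(15)[OF w]]
      by (intro exI conjI) simp_all
  qed
next
  fix x G assume x: "x \<in> Obj C" and G: "G \<in> germs V x"
  note m = germsD[OF G]
  have z: "germ V x (zr V x) \<in> germs V x" using germ_germs[OF V sep x] mod_closed(1)[OF V x] by simp
  have zf: "(f, zr V (Cod C f)) \<in> germ V x (zr V x)" if "f \<in> Arr C" "Dom C f = x" for f
    using that mod_res_zero[OF V that(1)] by (simp add: germ_iff)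
  show "pl (Plus V) x (germ V x (zr V x)) G = G"
  proof (rule plus_eqI[OF x plus_add(1)[OF x z G] G m(6)], elim exE)
    fix f v assume f: "f \<in> Arr C" "Dom C f = x" and v: "(f, v) \<in> G"
    show "\<exists>u. (f, u) \<in> pl (Plus V) x (germ V x (zr V x)) G \<and> (f, u) \<in> G"
      using plus_add(2)[OF x z G zf[OF f] v] mod_axioms(3)[OF V cod_obj[OF f(1)] m(3)[OF v]] v
      by (intro exI[of _ v]) simp
  qed
  interpret R: ring "Sec \<O> x" using ring_sec[OF x] .
  \<comment> \<open>The additive inverse of a germ is its multiple by minus one; ring restrictions
    preserve this scalar, so it acts as negation on every value of the germ.\<close>
  let ?n = "\<ominus>\<^bsub>Sec \<O> x\<^esub> \<one>\<^bsub>Sec \<O> x\<^esub>"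
  have n: "?n \<in> scalars x" by simp
  show "\<exists>H \<in> germs V x. pl (Plus V) x H G = germ V x (zr V x)"
  proof (rule bexI[OF _ plus_smult(1)[OF x n G]])
    show "pl (Plus V) x (sm (Plus V) x ?n G) G = germ V x (zr V x)"
    proof (rule plus_eqI[OF x plus_add(1)[OF x plus_smult(1)[OF x n G] G] z m(6)], elim exE)
      fix f v assume f: "f \<in> Arr C" "Dom C f = x" and v: "(f, v) \<in> G"
      note c = cod_obj[OF f(1)]
      have "Res \<O> f ?n = \<ominus>\<^bsub>Sec \<O> (Cod C f)\<^esub> \<one>\<^bsub>Sec \<O> (Cod C f)\<^esub>"
      proof -
        interpret h: ring_hom_ring "Sec \<O> x" "Sec \<O> (Cod C f)" "Res \<O> f"
          using ring_hom_ringI2[OF ring_sec[OF x] ring_sec[OF c]] ring_res[OF f(1)] f(2) by simp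
        show ?thesis by simp
      qed
      then have s: "sm V (Cod C f) (Res \<O> f ?n) v = a_inv (Sec V (Cod C f)) v"
        using mod_smult_neg_one[OF V c m(3)[OF v]] by simp
      show "\<exists>u. (f, u) \<in> pl (Plus V) x (sm (Plus V) x ?n G) G \<and> (f, u) \<in> germ V x (zr V x)"
        using plus_add(2)[OF x plus_smult(1)[OF x n G] G plus_smult(2)[OF x n G v] v]
          abelian_group.l_neg[OF mod_abelian[OF V c] m(3)[OF v]] zf[OF f]
        by (intro exI[of _ "zr V (Cod C f)"]) (simp add: s)
    qed
  qed
  show "sm (Plus V) x \<one>\<^bsub>Sec \<O> x\<^esub> G = G"
  proof (rule plus_eqI[OF x plus_smult(1)[OF x R.one_closed G] G m(6)], elim exE)
    fix f v assume f: "f \<in> Arr C" "Dom C f = x" and v: "(f, v) \<in> G"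
    have "Res \<O> f \<one>\<^bsub>Sec \<O> x\<^esub> = \<one>\<^bsub>Sec \<O> (Cod C f)\<^esub>" using ring_hom_one[OF ring_res[OF f(1)]] f(2) by simp
    then show "\<exists>u. (f, u) \<in> sm (Plus V) x \<one>\<^bsub>Sec \<O> x\<^esub> G \<and> (f, u) \<in> G"
      using plus_smult(2)[OF x R.one_closed G v] mod_axioms(8)[OF V cod_obj[OF f(1)] m(3)[OF v]] v
      by (intro exI[of _ v]) simp
  qed
next
  fix x a b G assume x: "x \<in> Obj C" and a: "a \<in> scalars x" and b: "b \<in> scalars x"
    and G: "G \<in> germs V x"
  note m = germsD[OF G]
  interpret R: ring "Sec \<O> x" using ring_sec[OF x] .
  have ab: "a \<oplus>\<^bsub>Sec \<O> x\<^esub> b \<in> scalars x" "a \<otimes>\<^bsub>Sec \<O> x\<^esub> b \<in> scalars x" using a b by simp_all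
  note sa = plus_smult[OF x a G] and sb = plus_smult[OF x b G]
  have r: "Res \<O> f (a \<oplus>\<^bsub>Sec \<O> x\<^esub> b) = Res \<O> f a \<oplus>\<^bsub>Sec \<O> (Cod C f)\<^esub> Res \<O> f b"
      "Res \<O> f (a \<otimes>\<^bsub>Sec \<O> x\<^esub> b) = Res \<O> f a \<otimes>\<^bsub>Sec \<O> (Cod C f)\<^esub> Res \<O> f b"
      "Res \<O> f a \<in> scalars (Cod C f)" "Res \<O> f b \<in> scalars (Cod C f)"
    if f: "f \<in> Arr C" "Dom C f = x" for f
    using ring_hom_add[OF ring_res[OF f(1)], of a b] ring_hom_mult[OF ring_res[OF f(1)], of a b]
      scalar_res[OF f(1)] a b f(2) by simp_all
  show "sm (Plus V) x (a \<oplus>\<^bsub>Sec \<O> x\<^esub> b) G = pl (Plus V) x (sm (Plus V) x a G) (sm (Plus V) x b G)"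
  proof (rule plus_eqI[OF x plus_smult(1)[OF x ab(1) G] plus_add(1)[OF x sa(1) sb(1)] m(6)], elim exE)
    fix f v assume f: "f \<in> Arr C" "Dom C f = x" and v: "(f, v) \<in> G"
    show "\<exists>u. (f, u) \<in> sm (Plus V) x (a \<oplus>\<^bsub>Sec \<O> x\<^esub> b) G \<and>
        (f, u) \<in> pl (Plus V) x (sm (Plus V) x a G) (sm (Plus V) x b G)"
      using plus_smult(2)[OF x ab(1) G v] plus_add(2)[OF x sa(1) sb(1) sa(2)[OF v] sb(2)[OF v]]
        mod_axioms(5)[OF V cod_obj[OF f(1)] r(3,4)[OF f] m(3)[OF v]] r(1)[OF f]
      by (intro exI conjI) simp_all
  qed
  show "sm (Plus V) x (a \<otimes>\<^bsub>Sec \<O> x\<^esub> b) G = sm (Plus V) x a (sm (Plus V) x b G)"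
  proof (rule plus_eqI[OF x plus_smult(1)[OF x ab(2) G] plus_smult(1)[OF x a sb(1)] m(6)], elim exE)
    fix f v assume f: "f \<in> Arr C" "Dom C f = x" and v: "(f, v) \<in> G"
    show "\<exists>u. (f, u) \<in> sm (Plus V) x (a \<otimes>\<^bsub>Sec \<O> x\<^esub> b) G \<and>
        (f, u) \<in> sm (Plus V) x a (sm (Plus V) x b G)"
      using plus_smult(2)[OF x ab(2) G v] plus_smult(2)[OF x a sb(1) sb(2)[OF v]]
        mod_axioms(7)[OF V cod_obj[OF f(1)] r(3,4)[OF f] m(3)[OF v]] r(2)[OF f]
      by (intro exI conjI) simp_all
  qed
next
  fix x a G H assume x: "x \<in> Obj C" and a: "a \<in> scalars x" and G: "G \<in> germs V x" and H: "H \<in> germs V x"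
  note m = germsD[OF G] germsD[OF H]
  note GH = plus_add(1)[OF x G H] and sG = plus_smult[OF x a G] and sH = plus_smult[OF x a H]
  show "sm (Plus V) x a (pl (Plus V) x G H) = pl (Plus V) x (sm (Plus V) x a G) (sm (Plus V) x a H)"
  proof (rule plus_eqI[OF x plus_smult(1)[OF x a GH] plus_add(1)[OF x sG(1) sH(1)] cov_conj[OF m(6) m(12) x]],
      elim conjE exE)
    fix f v w assume f: "f \<in> Arr C" "Dom C f = x" and v: "(f, v) \<in> G" and w: "(f, w) \<in> H"
    have "Res \<O> f a \<in> scalars (Cod C f)" using scalar_res[OF f(1)] a f(2) by simp
    then show "\<exists>u. (f, u) \<in> sm (Plus V) x a (pl (Plus V) x G H) \<and>
        (f, u) \<in> pl (Plus V) x (sm (Plus V) x a G) (sm (Plus V) x a H)"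
      using plus_smult(2)[OF x a GH plus_add(2)[OF x G H v w]] plus_add(2)[OF x sG(1) sH(1) sG(2)[OF v] sH(2)[OF w]]
        mod_axioms(6)[OF V cod_obj[OF f(1)] _ m(3)[OF v] m(9)[OF w], of "Res \<O> f a"]
      by (intro exI conjI) simp_all
  qed
qed

section \<open>The germ map and the sheaf property\<close>

lemma germ_map: "mod_map V (Plus V) (germ V)"
  unfolding mod_map_def plus_simps
proof (intro conjI ballI)
  fix x v assume x: "x \<in> Obj C" and v: "v \<in> el V x"
  note gv = germ_germs[OF V sep x v]
  show "germ V x v \<in> germs V x" by (rule gv)
  show "germ V x (pl V x v w) = pl (Plus V) x (germ V x v) (germ V x w)" if w: "w \<in> el V x" for w
  proof (rule plus_eqI[OF x germ_germs[OF V sep x mod_closed(2)[OF V x v w]]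
        plus_add(1)[OF x gv germ_germs[OF V sep x w]] cov_all[OF x TrueI]])
    fix f assume f: "f \<in> Arr C" "Dom C f = x"
    have "(f, Res V f v) \<in> germ V x v" "(f, Res V f w) \<in> germ V x w" using f by (simp_all add: germ_iff)
    from plus_add(2)[OF x gv germ_germs[OF V sep x w] this]
    show "\<exists>u. (f, u) \<in> germ V x (pl V x v w) \<and> (f, u) \<in> pl (Plus V) x (germ V x v) (germ V x w)"
      using f v w mod_res_add[OF V f(1), of v w] by (intro exI conjI) (simp_all add: germ_iff)
  qed
  show "germ V x (sm V x a v) = sm (Plus V) x a (germ V x v)" if a: "a \<in> scalars x" for a
  proof (rule plus_eqI[OF x germ_germs[OF V sep x mod_closed(4)[OF V x a v]]
        plus_smult(1)[OF x a gv] cov_all[OF x TrueI]])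
    fix f assume f: "f \<in> Arr C" "Dom C f = x"
    have "(f, Res V f v) \<in> germ V x v" using f by (simp add: germ_iff)
    from plus_smult(2)[OF x a gv this]
    show "\<exists>u. (f, u) \<in> germ V x (sm V x a v) \<and> (f, u) \<in> sm (Plus V) x a (germ V x v)"
      using f v a mod_res_smult[OF V f(1), of a v] by (intro exI conjI) (simp_all add: germ_iff)
  qed
next
  fix f v assume f: "f \<in> Arr C" and v: "v \<in> el V (Dom C f)"
  have "(g, w) \<in> germ V (Cod C f) (Res V f v) \<longleftrightarrow> (g, w) \<in> Res (Plus V) f (germ V (Dom C f) v)" for g w
    using f v comp_arr[OF f, of g] mod_res_comp[OF V f, of g v] by (auto simp: germ_iff plus_Res)
  then show "germ V (Cod C f) (Res V f v) = Res (Plus V) f (germ V (Dom C f) v)" by auto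
qed

lemma germ_loc_inj: "loc_inj V (Plus V) (germ V)"
  unfolding loc_inj_def plus_simps
proof (intro ballI impI cov_all)
  fix x v f assume x: "x \<in> Obj C" and eq: "germ V x v = germ V x (zr V x)" and f: "f \<in> Arr C" "Dom C f = x"
  have "(f, Res V f v) \<in> germ V x (zr V x)" using f unfolding eq[symmetric] by (simp add: germ_iff)
  then show "Res V f v = zr V (Cod C f)" using mod_res_zero[OF V f(1)] f by (simp add: germ_iff)
qed

text \<open>Restricted to an arrow of its domain, a germ is the germ of an honest element. As the
  domain contains a cover, this is the source of local surjectivity.\<close>

lemma germ_Res:
  assumes x: "x \<in> Obj C" and G: "G \<in> germs V x" and fv: "(f, v) \<in> G"
  shows "germ V (Cod C f) v = Res (Plus V) f G"
proof -
  note m = germsD[OF G]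
  note f = m(1-3)[OF fv]
  note c = cod_obj[OF f(1)]
  have rG: "Res (Plus V) f G \<in> germs V (Cod C f)" using plus_res_germs[OF f(1)] G f(2) by simp
  show ?thesis
  proof (rule plus_eqI[OF c germ_germs[OF V sep c f(3)] rG cov_all[OF c TrueI]])
    fix g assume "g \<in> Arr C" "Dom C g = Cod C f"
    then show "\<exists>w. (g, w) \<in> germ V (Cod C f) v \<and> (g, w) \<in> Res (Plus V) f G"
      using m(5)[OF fv] by (simp add: germ_iff plus_Res)
  qed
qed

lemma germ_loc_surj: "loc_surj V (Plus V) (germ V)"
  unfolding loc_surj_def plus_simps
proof (intro ballI)
  fix x G assume x: "x \<in> Obj C" and G: "G \<in> germs V x"
  note m = germsD[OF G]
  show "cov x (\<lambda>f. \<exists>v \<in> el V (Cod C f). germ V (Cod C f) v = Res (Plus V) f G)"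
    by (rule cov_mono[OF m(6) x]) (use germ_Res[OF x G] m(3) in blast)
qed

text \<open>Equal restrictions along \<open>f\<close> mean the same pairs over composites with
  \<open>f\<close>. Refining by the pulled-back domain of \<open>G\<close> gives common pairs on a
  cover, which is the equality test for germs.\<close>

lemma plus_separated: "separated (Plus V)"
  unfolding separated_def plus_simps
proof (intro ballI impI)
  fix x G H assume x: "x \<in> Obj C" and G: "G \<in> germs V x" and H: "H \<in> germs V x"
    and c: "cov x (\<lambda>f. Res (Plus V) f G = Res (Plus V) f H)"
  note m = germsD[OF G]
  show "G = H"
  proof (rule plus_eqI[OF x G H])
    show "cov x (\<lambda>f. \<exists>v. (f, v) \<in> G \<and> (f, v) \<in> H)"
    proof (rule cov_trans[OF cov_mono[OF c x] x])
      fix f assume f: "f \<in> Arr C" "Dom C f = x" and eq: "Res (Plus V) f G = Res (Plus V) f H"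
      have "cov (Cod C f) (\<lambda>g. \<exists>v. (g \<cdot> f, v) \<in> G)" using cov_pull[OF _ f(1)] m(6) f(2) by simp
      then show "cov (Cod C f) (\<lambda>g. \<exists>v. (g \<cdot> f, v) \<in> G \<and> (g \<cdot> f, v) \<in> H)"
      proof (rule cov_mono[OF _ cod_obj[OF f(1)]], elim exE)
        fix g v assume g: "g \<in> Arr C" "Dom C g = Cod C f" and v: "(g \<cdot> f, v) \<in> G"
        then have "(g, v) \<in> Res (Plus V) f H" unfolding eq[symmetric] by (simp add: plus_Res)
        then show "\<exists>v. (g \<cdot> f, v) \<in> G \<and> (g \<cdot> f, v) \<in> H" using v by (auto simp: plus_Res)
      qed
    qed
  qed
qed

text \<open>The local germs are amalgamated into one graph, which is matching by compatibility of
  the family, and the glued germ is its saturation.\<close>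

lemma plus_gluing: "gluing (Plus V)"
  unfolding gluing_def plus_simps
proof (intro ballI allI impI)
  fix x R \<eta> assume x: "x \<in> Obj C" and R: "R \<in> J x" and e: "\<forall>f \<in> R. \<eta> f \<in> germs V (Cod C f)"
    and n: "\<forall>f \<in> R. \<forall>g \<in> Arr C. Dom C g = Cod C f \<longrightarrow> \<eta> (g \<cdot> f) = Res (Plus V) g (\<eta> f)"
  note r = sieveD[OF x R]
  \<comment> \<open>Each local germ is evaluated at an identity. If the identity lies outside the
    domain of \<open>\<eta> f\<close>, no value is recorded at \<open>f\<close>, and the information
    reappears at composites with \<open>f\<close>.\<close>
  define G where "G = {(f, v). f \<in> R \<and> (Ident C (Cod C f), v) \<in> \<eta> f}"
  have m: "f \<in> R \<Longrightarrow> matching V (Cod C f) (\<eta> f)" for f using e germs_matching by blast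
  \<comment> \<open>Along \<open>f\<close> the amalgamated graph is the germ \<open>\<eta> f\<close>
    itself. Hence the domain of \<open>G\<close> contains a cover by transitivity, and the
    restriction of the glued germ along \<open>f\<close> agrees with
    \<open>\<eta> f\<close>.\<close>
  have key: "(g \<cdot> f, v) \<in> G \<longleftrightarrow> (g, v) \<in> \<eta> f" if f: "f \<in> R" and g: "g \<in> Arr C" "Dom C g = Cod C f" for f g v
    using r(3)[OF f g] n f g comp_arr[OF r(1)[OF f] g] ident_arr[OF cod_obj[OF g(1)]] ident_left[OF arr_hom[OF g(1)]]
    by (simp add: G_def plus_Res)
  have mG: "matching V x G"
  proof (rule matchingI)
    fix f v assume fv: "(f, v) \<in> G"
    then have f: "f \<in> R" and v: "(Ident C (Cod C f), v) \<in> \<eta> f" by (auto simp: G_def)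
    note i = ident_arr[OF cod_obj[OF r(1)[OF f]]]
    show "f \<in> Arr C \<and> Dom C f = x \<and> v \<in> el V (Cod C f)"
      using r[OF f] matchingD(3)[OF m[OF f] v] i by simp
    show "v = w" if "(f, w) \<in> G" for w
      using that matchingD(4)[OF m[OF f] v] by (simp add: G_def)
    fix g assume g: "g \<in> Arr C" "Dom C g = Cod C f"
    have "(g \<cdot> Ident C (Cod C f), Res V g v) \<in> \<eta> f" using matchingD(5)[OF m[OF f] v g(1)] g(2) i by simp
    then show "(g \<cdot> f, Res V g v) \<in> G"
      using key[OF f g] ident_right[OF arr_hom[OF g(1)]] g(2) by simp
  next
    show "cov x (\<lambda>f. \<exists>v. (f, v) \<in> G)"
    proof (rule cov_trans[OF covI[OF R] x])
      fix f assume f: "f \<in> R"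
      show "cov (Cod C f) (\<lambda>g. \<exists>v. (g \<cdot> f, v) \<in> G)"
        by (rule cov_mono[OF matchingD(6)[OF m[OF f]] cod_obj[OF r(1)[OF f]]]) (simp add: key[OF f])
    qed
  qed
  show "\<exists>H \<in> germs V x. \<forall>f \<in> R. Res (Plus V) f H = \<eta> f"
  proof (intro bexI[OF _ sat_germ[OF V sep mG x]] ballI)
    fix f assume f: "f \<in> R"
    note c = cod_obj[OF r(1)[OF f]]
    have "Res (Plus V) f (sat V x G) \<in> germs V (Cod C f)"
      using plus_res_germs[OF r(1)[OF f]] sat_germ[OF V sep mG x] r(2)[OF f] by simp
    moreover have "\<eta> f \<in> germs V (Cod C f)" using e f by blast
    ultimately show "Res (Plus V) f (sat V x G) = \<eta> f"
    proof (rule plus_eqI[OF c _ _ matchingD(6)[OF m[OF f]]], elim exE)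
      fix g v assume g: "g \<in> Arr C" "Dom C g = Cod C f" and v: "(g, v) \<in> \<eta> f"
      then have "(g \<cdot> f, v) \<in> sat V x G" using key[OF f g] matching_sat[OF V mG x] by blast
      then show "\<exists>v. (g, v) \<in> Res (Plus V) f (sat V x G) \<and> (g, v) \<in> \<eta> f"
        using g v by (auto simp: plus_Res)
    qed
  qed
qed

end

end

section \<open>The category of modules in a universe\<close>

lemma lepoll_total: "A \<lesssim> B \<or> B \<lesssim> A"
  using ordLeq_total[OF card_of_Well_order[of A] card_of_Well_order[of B]]
  by (simp add: lepoll_def card_of_ordLeq)

lemma infinite_times_self: "infinite A \<Longrightarrow> A \<times> A \<approx> A"
  by (simp add: eqpoll_iff_card_of_ordIso card_of_Times_same_infinite)

locale ringed_site_universe = ringed_site C J \<O>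
  for C :: "('o, 'm) cat" (structure) and J :: "'o \<Rightarrow> 'm set set"
    and \<O> :: "('o, 'm, 'r ring, 'r) presheaf" +
  fixes U :: "'v set set"
  assumes universe: "universe_over (Arr C) U"
begin

lemma U_infinite: "\<exists>A \<in> U. infinite A"
  using universe by (simp add: universe_over_def)

lemma U_lepoll: "\<lbrakk>A \<in> U; B \<lesssim> A\<rbrakk> \<Longrightarrow> B \<in> U"
  using universe by (simp add: universe_over_def)

lemma U_PiE: "A \<in> Arr C \<rightarrow> U \<Longrightarrow> \<exists>B \<in> U. (\<Pi>\<^sub>E k \<in> Arr C. A k) \<lesssim> B"
  using universe by (simp add: universe_over_def)

lemma U_subset: "\<lbrakk>A \<in> U; B \<subseteq> A\<rbrakk> \<Longrightarrow> B \<in> U"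
  using U_lepoll subset_imp_lepoll by blast

text \<open>Membership in \<open>U\<close> up to size, for sets over any type: pairs and germs are
  not elements of the type underlying \<open>U\<close>.\<close>

definition small :: "'w set \<Rightarrow> bool" where
  "small A \<longleftrightarrow> (\<exists>B \<in> U. A \<lesssim> B)"

lemma small_lepoll: "\<lbrakk>small A; B \<lesssim> A\<rbrakk> \<Longrightarrow> small B"
  unfolding small_def using lepoll_trans by blast

lemma small_finite: "finite A \<Longrightarrow> small A"
  unfolding small_def using U_infinite finite_lepoll_infinite by blast

lemma small_infinite:
  assumes "small A"
  shows "\<exists>B \<in> U. infinite B \<and> A \<lesssim> B"
proof -
  obtain B Z where B: "B \<in> U" "A \<lesssim> B" and Z: "Z \<in> U" "infinite Z"
    using assms U_infinite by (auto simp: small_def)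
  show ?thesis
  proof (cases "finite B")
    case True
    then have "A \<lesssim> Z" using lepoll_trans[OF B(2) finite_lepoll_infinite[OF Z(2)]] by blast
    then show ?thesis using Z by blast
  qed (use B in blast)
qed

text \<open>Closure under products over arrows says nothing about pairs when \<open>C\<close> has
  fewer than two arrows. Instead both factors are embedded in one infinite member of
  \<open>U\<close>, which is equipotent to its square.\<close>

lemma small_times:
  assumes "A \<in> U" "B \<in> U"
  shows "small (A \<times> B)"
proof -
  obtain M where M: "M \<in> U" "A \<lesssim> M" "B \<lesssim> M" using lepoll_total[of A B] assms lepoll_refl by blast
  then obtain Z where Z: "Z \<in> U" "infinite Z" "M \<lesssim> Z"
    using small_infinite[of M] lepoll_refl[of M] by (auto simp: small_def)
  have "A \<times> B \<lesssim> Z \<times> Z"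
    by (rule times_lepoll_mono[OF lepoll_trans[OF M(2) Z(3)] lepoll_trans[OF M(3) Z(3)]])
  then have "A \<times> B \<lesssim> Z" using infinite_times_self[OF Z(2)] lepoll_trans2 by blast
  then show ?thesis using Z(1) by (auto simp: small_def)
qed

text \<open>The additional value \<open>None\<close> will mark the arrows at which a germ has no
  value.\<close>

lemma small_option:
  assumes "A \<in> U"
  shows "small (insert None (Some ` A))"
proof (cases "finite A")
  case False
  then have "insert None (Some ` A) \<lesssim> Some ` A"
    by (intro eqpoll_imp_lepoll infinite_insert_eqpoll) (simp add: finite_image_iff)
  then show ?thesis unfolding small_def using assms lepoll_trans[OF _ image_lepoll] by blast
qed (simp add: small_finite)

abbreviation "M \<equiv> O_Mod C \<O> U"

abbreviation mod_comp (infixl \<open>\<bullet>\<close> 75) where "g \<bullet> f \<equiv> g \<cdot>\<^bsub>M\<^esub> f"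

lemma Mod_Obj: "V \<in> Obj M \<longleftrightarrow> Omod V \<and> (\<forall>x \<in> Obj C. el V x \<in> U)"
  by (simp add: O_Mod_def Let_def)

text \<open>A single-valued graph is a function from arrows to optional elements. Germs therefore
  inject into a product over the arrows of \<open>C\<close> of members of \<open>U\<close>, and the
  closure property of the universe bounds that product.\<close>

lemma small_germs:
  assumes "V \<in> Obj M" "x \<in> Obj C"
  shows "small (germs V x)"
proof -
  have "\<exists>B i. B \<in> U \<and> inj_on i (insert None (Some ` el V (Cod C f))) \<and>
      i ` insert None (Some ` el V (Cod C f)) \<subseteq> B" if "f \<in> Arr C" for f
    using small_option[of "el V (Cod C f)"] assms(1) cod_obj[OF that]
    unfolding small_def lepoll_def Mod_Obj by blast
  then obtain B i where B: "\<And>f. f \<in> Arr C \<Longrightarrow> B f \<in> U"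
    and i: "\<And>f. f \<in> Arr C \<Longrightarrow> inj_on (i f) (insert None (Some ` el V (Cod C f)))"
    "\<And>f. f \<in> Arr C \<Longrightarrow> i f ` insert None (Some ` el V (Cod C f)) \<subseteq> B f"
    by metis
  obtain Z where Z: "Z \<in> U" "(\<Pi>\<^sub>E f \<in> Arr C. B f) \<lesssim> Z" using U_PiE[of B] B by blast
  \<comment> \<open>The germ as a partial function; single-valuedness makes \<open>THE\<close> well
    defined wherever the germ has a value.\<close>
  define opt where "opt G f = (if \<exists>v. (f, v) \<in> G then Some (THE v. (f, v) \<in> G) else None)"
    for G :: "('m \<times> 'v) set" and f
  have opt: "(f, v) \<in> G \<longleftrightarrow> opt G f = Some v" if "G \<in> germs V x" for G f v
  proof -
    have the: "(THE v. (f, v) \<in> G) = w" if w: "(f, w) \<in> G" for w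
      by (rule the_equality, rule w) (rule germsD(4)[OF \<open>G \<in> germs V x\<close> _ w])
    show ?thesis
    proof
      show "opt G f = Some v" if "(f, v) \<in> G"
        using that the[OF that] unfolding opt_def by auto
      assume o: "opt G f = Some v"
      then obtain w where w: "(f, w) \<in> G" by (auto simp: opt_def split: if_splits)
      then have "opt G f = Some w" using the[OF w] unfolding opt_def by auto
      then show "(f, v) \<in> G" using w o by simp
    qed
  qed
  have opt_range: "opt G f \<in> insert None (Some ` el V (Cod C f))" if "G \<in> germs V x" for G f
  proof (cases "opt G f")
    case (Some v)
    then show ?thesis using opt[OF that] germsD(3)[OF that] by blast
  qed simp
  define e where "e G = (\<lambda>f \<in> Arr C. i f (opt G f))" for G
  have "inj_on e (germs V x)"
  proof (rule inj_onI)
    fix G H assume G: "G \<in> germs V x" and H: "H \<in> germs V x" and eq: "e G = e H"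
    have oeq: "opt G f = opt H f" if "f \<in> Arr C" for f
      using fun_cong[OF eq, of f] that inj_onD[OF i(1)[OF that] _ opt_range[OF G] opt_range[OF H]]
      by (simp add: e_def)
    have "(f, v) \<in> G \<longleftrightarrow> (f, v) \<in> H" for f v
      using germsD(1)[OF G] germsD(1)[OF H] opt[OF G] opt[OF H] oeq
      by metis
    then show "G = H" by auto
  qed
  moreover have "i f (opt G f) \<in> B f" if "f \<in> Arr C" "G \<in> germs V x" for f G
    using subsetD[OF i(2)[OF that(1)] imageI[OF opt_range[OF that(2)]]] .
  then have "e ` germs V x \<subseteq> (\<Pi>\<^sub>E f \<in> Arr C. B f)" by (auto simp: e_def)
  ultimately have "germs V x \<lesssim> (\<Pi>\<^sub>E f \<in> Arr C. B f)" by (auto simp: lepoll_def)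
  then show ?thesis using Z lepoll_trans by (auto simp: small_def)
qed

section \<open>Isomorphic copies inside the universe\<close>

definition iso_map where
  "iso_map V W \<phi> \<longleftrightarrow> mod_map V W \<phi> \<and> (\<forall>x \<in> Obj C. bij_betw (\<phi> x) (el V x) (el W x))"

text \<open>Each carrier is injected into a member of \<open>U\<close>, and the module structure is
  carried along by \<open>image_mod\<close>, for which an injective family is a congruence.\<close>

lemma transport:
  assumes V: "Omod V" and s: "\<And>x. x \<in> Obj C \<Longrightarrow> small (el V x)"
  shows "\<exists>W \<phi>. W \<in> Obj M \<and> iso_map V W \<phi>"
proof -
  have "\<exists>B i. B \<in> U \<and> inj_on i (el V x) \<and> i ` el V x \<subseteq> B" if "x \<in> Obj C" for x
    using s[OF that] unfolding small_def lepoll_def by blast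
  then obtain B i where B: "\<And>x. x \<in> Obj C \<Longrightarrow> B x \<in> U"
    and i: "\<And>x. x \<in> Obj C \<Longrightarrow> inj_on (i x) (el V x)" "\<And>x. x \<in> Obj C \<Longrightarrow> i x ` el V x \<subseteq> B x"
    by metis
  have c: "congruence i V"
    unfolding congruence_def
  proof (intro ballI impI)
    fix x v v' assume "x \<in> Obj C" "v \<in> el V x" "v' \<in> el V x" "i x v = i x v'"
    then have v: "v = v'" using inj_onD[OF i(1)] by blast
    have "w = w'" if "x \<in> Obj C" "w \<in> el V x" "w' \<in> el V x" "i x w = i x w'" for w w'
      using that inj_onD[OF i(1)] by blast
    then show "(\<forall>w \<in> el V x. \<forall>w' \<in> el V x. i x w = i x w' \<longrightarrow> i x (pl V x v w) = i x (pl V x v' w')) \<and>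
        (\<forall>a \<in> scalars x. i x (sm V x a v) = i x (sm V x a v')) \<and>
        (\<forall>f \<in> Arr C. Dom C f = x \<longrightarrow> i (Cod C f) (Res V f v) = i (Cod C f) (Res V f v'))"
      using v \<open>x \<in> Obj C\<close> by auto
  qed
  have e: "el (image_mod i V) x = i x ` el V x" for x by (rule image_mod_simps(1)[OF c V])
  have "image_mod i V \<in> Obj M"
    unfolding Mod_Obj e using image_mod_module[OF c V] U_subset B i(2) by blast
  moreover have "iso_map V (image_mod i V) i"
    unfolding iso_map_def e using image_mod_map[OF c V] i(1) inj_on_imp_bij_betw by blast
  ultimately show ?thesis by blast
qed

lemma iso_map_inverse:
  assumes V: "Omod V" and i: "iso_map V W \<phi>"
  defines "\<psi> \<equiv> \<lambda>x. inv_into (el V x) (\<phi> x)"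
  shows "iso_map W V \<psi>" "\<lbrakk>x \<in> Obj C; v \<in> el V x\<rbrakk> \<Longrightarrow> \<psi> x (\<phi> x v) = v"
    "\<lbrakk>x \<in> Obj C; w \<in> el W x\<rbrakk> \<Longrightarrow> \<phi> x (\<psi> x w) = w"
proof -
  from i have m: "mod_map V W \<phi>" and b: "\<And>x. x \<in> Obj C \<Longrightarrow> bij_betw (\<phi> x) (el V x) (el W x)"
    by (auto simp: iso_map_def)
  show l: "\<psi> x (\<phi> x v) = v" if "x \<in> Obj C" "v \<in> el V x" for x v
    unfolding \<psi>_def using bij_betw_inv_into_left[OF b] that .
  show r: "\<phi> x (\<psi> x w) = w" if "x \<in> Obj C" "w \<in> el W x" for x w
    unfolding \<psi>_def using bij_betw_inv_into_right[OF b] that .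
  have b': "bij_betw (\<psi> x) (el W x) (el V x)" if "x \<in> Obj C" for x
    unfolding \<psi>_def using bij_betw_inv_into[OF b[OF that]] .
  have "mod_map W V \<psi>"
    using mod_map_factor[OF V m bij_betw_imp_surj_on[OF b, symmetric] mod_map_ident l] .
  then show "iso_map W V \<psi>" using b' by (simp add: iso_map_def)
qed

lemma iso_map_loc:
  assumes V: "Omod V" "Omod W" and i: "iso_map V W \<phi>"
  shows "loc_inj V W \<phi>" "loc_surj V W \<phi>"
proof -
  from i have m: "mod_map V W \<phi>" and b: "\<And>x. x \<in> Obj C \<Longrightarrow> bij_betw (\<phi> x) (el V x) (el W x)"
    by (auto simp: iso_map_def)
  show "loc_inj V W \<phi>"
    unfolding loc_inj_def
  proof (intro ballI impI cov_all)
    fix x v f assume x: "x \<in> Obj C" and v: "v \<in> el V x" "\<phi> x v = zr W x" and f: "f \<in> Arr C" "Dom C f = x"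
    then have "v = zr V x"
      using inj_onD[OF bij_betw_imp_inj_on[OF b[OF x]]] mod_map_zero[OF V m x] mod_closed(1)[OF V(1) x] by simp
    then show "Res V f v = zr V (Cod C f)" using mod_res_zero[OF V(1) f(1)] f(2) by simp
  qed
  show "loc_surj V W \<phi>"
    unfolding loc_surj_def
  proof (intro ballI cov_all)
    fix x w f assume x: "x \<in> Obj C" and w: "w \<in> el W x" and f: "f \<in> Arr C" "Dom C f = x"
    have "Res W f w \<in> \<phi> (Cod C f) ` el V (Cod C f)"
      using bij_betw_imp_surj_on[OF b[OF cod_obj[OF f(1)]]] mod_res[OF V(2) f(1)] w f(2) by simp
    then show "\<exists>v \<in> el V (Cod C f). \<phi> (Cod C f) v = Res W f w" by (elim imageE) (intro bexI, simp_all)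
  qed
qed

lemma iso_map_separated:
  assumes V: "Omod V" and i: "iso_map V W \<phi>" and s: "separated V"
  shows "separated W"
  unfolding separated_def
proof (intro ballI impI)
  fix x v w assume x: "x \<in> Obj C" and v: "v \<in> el W x" and w: "w \<in> el W x"
    and c: "cov x (\<lambda>f. Res W f v = Res W f w)"
  let ?\<psi> = "\<lambda>x. inv_into (el V x) (\<phi> x)"
  note inv = iso_map_inverse[OF V i]
  from inv(1) have m: "mod_map W V ?\<psi>" by (simp add: iso_map_def)
  have "?\<psi> x v = ?\<psi> x w"
  proof (rule separatedD[OF s x mod_mapD(1)[OF m x v] mod_mapD(1)[OF m x w]])
    show "cov x (\<lambda>f. Res V f (?\<psi> x v) = Res V f (?\<psi> x w))"
    proof (rule cov_mono[OF c x])
      fix f assume f: "f \<in> Arr C" "Dom C f = x" and "Res W f v = Res W f w"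
      then show "Res V f (?\<psi> x v) = Res V f (?\<psi> x w)"
        using mod_mapD(4)[OF m f(1), of v] mod_mapD(4)[OF m f(1), of w] v w by simp
    qed
  qed
  then have "\<phi> x (?\<psi> x v) = \<phi> x (?\<psi> x w)" by (rule arg_cong)
  then show "v = w" unfolding inv(3)[OF x v] inv(3)[OF x w] .
qed

lemma iso_map_gluing:
  assumes V: "Omod V" and i: "iso_map V W \<phi>" and g: "gluing V"
  shows "gluing W"
  unfolding gluing_def
proof (intro ballI allI impI)
  fix x R \<eta> assume x: "x \<in> Obj C" and R: "R \<in> J x" and e: "\<forall>f \<in> R. \<eta> f \<in> el W (Cod C f)"
    and n: "\<forall>f \<in> R. \<forall>g \<in> Arr C. Dom C g = Cod C f \<longrightarrow> \<eta> (g \<cdot> f) = Res W g (\<eta> f)"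
  let ?\<psi> = "\<lambda>x. inv_into (el V x) (\<phi> x)"
  note inv = iso_map_inverse[OF V i]
  from inv(1) have m: "mod_map W V ?\<psi>" by (simp add: iso_map_def)
  from i have m': "mod_map V W \<phi>" by (simp add: iso_map_def)
  note r = sieveD[OF x R]
  have "\<exists>v \<in> el V x. \<forall>f \<in> R. Res V f v = ?\<psi> (Cod C f) (\<eta> f)"
  proof (rule gluingD[OF g x R])
    fix f assume f: "f \<in> R"
    then show "?\<psi> (Cod C f) (\<eta> f) \<in> el V (Cod C f)" using mod_mapD(1)[OF m cod_obj[OF r(1)[OF f]]] e by simp
    fix g assume h: "g \<in> Arr C" "Dom C g = Cod C f"
    have "\<eta> f \<in> el W (Dom C g)" using e f h by simp
    from mod_mapD(4)[OF m h(1) this]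
    show "?\<psi> (Cod C (g \<cdot> f)) (\<eta> (g \<cdot> f)) = Res V g (?\<psi> (Cod C f) (\<eta> f))"
      using n f h comp_arr[OF r(1)[OF f] h] by simp
  qed
  then obtain v where v: "v \<in> el V x" "\<forall>f \<in> R. Res V f v = ?\<psi> (Cod C f) (\<eta> f)" by (elim bexE)
  have "Res W f (\<phi> x v) = \<eta> f" if f: "f \<in> R" for f
    using mod_mapD(4)[OF m' r(1)[OF f], of v] r(2)[OF f] v f inv(3)[OF cod_obj[OF r(1)[OF f]], of "\<eta> f"] e
    by simp
  then show "\<exists>w \<in> el W x. \<forall>f \<in> R. Res W f w = \<eta> f" using mod_mapD(1)[OF m' x v(1)] by blast
qed

section \<open>The category of modules\<close>

definition arrow :: "('o, 'm, 'r, 'v) module_presheaf \<Rightarrow> ('o, 'm, 'r, 'v) module_presheaf \<Rightarrow> ('o \<Rightarrow> 'v \<Rightarrow> 'v) \<Rightarrow>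
   ('o, 'm, 'r, 'v) module_presheaf \<times> ('o, 'm, 'r, 'v) module_presheaf \<times> ('o \<Rightarrow> 'v \<Rightarrow> 'v)" where
  "arrow V W \<phi> = (V, W, \<lambda>x \<in> Obj C. \<lambda>v \<in> el V x. \<phi> x v)"

text \<open>Because \<open>arrow\<close> cuts a family down to the carriers, any family with the
  right values on elements represents the arrow. Composites and inclusions can thus be written as
  plain functions.\<close>

lemma arrow_eq_iff:
  "arrow V W \<phi> = arrow V' W' \<psi> \<longleftrightarrow> V = V' \<and> W = W' \<and> (\<forall>x \<in> Obj C. \<forall>v \<in> el V x. \<phi> x v = \<psi> x v)"
proof
  assume eq: "arrow V W \<phi> = arrow V' W' \<psi>"
  then have V: "V = V'" "W = W'" and
    f: "(\<lambda>x \<in> Obj C. \<lambda>v \<in> el V x. \<phi> x v) = (\<lambda>x \<in> Obj C. \<lambda>v \<in> el V' x. \<psi> x v)" by (auto simp: arrow_def)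
  have "\<phi> x v = \<psi> x v" if "x \<in> Obj C" "v \<in> el V x" for x v
    using fun_cong[OF fun_cong[OF f, of x], of v] that V by simp
  then show "V = V' \<and> W = W' \<and> (\<forall>x \<in> Obj C. \<forall>v \<in> el V x. \<phi> x v = \<psi> x v)" using V by blast
qed (auto simp: arrow_def intro!: restrict_ext)

lemma linear_maps_iff:
  assumes V: "Omod V" "Omod W"
  shows "\<phi> \<in> O_linear_maps C \<O> V W \<longleftrightarrow>
    mod_map V W \<phi> \<and> \<phi> = (\<lambda>x \<in> Obj C. \<lambda>v \<in> el V x. \<phi> x v)"
proof -
  have ext: "\<phi> \<in> (\<Pi>\<^sub>E x \<in> Obj C. extensional (el V x)) \<longleftrightarrow> \<phi> = (\<lambda>x \<in> Obj C. \<lambda>v \<in> el V x. \<phi> x v)"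
  proof
    assume "\<phi> \<in> (\<Pi>\<^sub>E x \<in> Obj C. extensional (el V x))"
    then show "\<phi> = (\<lambda>x \<in> Obj C. \<lambda>v \<in> el V x. \<phi> x v)"
      by (intro ext) (auto simp: PiE_iff extensional_def)
  next
    assume "\<phi> = (\<lambda>x \<in> Obj C. \<lambda>v \<in> el V x. \<phi> x v)"
    moreover have "(\<lambda>x \<in> Obj C. \<lambda>v \<in> el V x. \<phi> x v) \<in> (\<Pi>\<^sub>E x \<in> Obj C. extensional (el V x))" by auto
    ultimately show "\<phi> \<in> (\<Pi>\<^sub>E x \<in> Obj C. extensional (el V x))" by simp
  qed
  have "(\<forall>x \<in> Obj C. linear_along (Sec \<O> x) (\<lambda>a. a) (Sec V x) (Sec W x) (\<phi> x)) \<and>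
       (\<forall>f \<in> Arr C. \<forall>v \<in> carrier (Sec V (Dom C f)). \<phi> (Cod C f) (Res V f v) = Res W f (\<phi> (Dom C f) v))
     \<longleftrightarrow> mod_map V W \<phi>"
    unfolding mod_map_def linear_along_def hom_def by auto
  then show ?thesis unfolding O_linear_maps_def ext[symmetric] by blast
qed

lemma mod_map_restrict: "mod_map V W (\<lambda>x \<in> Obj C. \<lambda>v \<in> el V x. \<phi> x v) \<longleftrightarrow> mod_map V W \<phi>"
  if "Omod V"
  unfolding mod_map_def by (simp add: mod_closed[OF that] mod_res[OF that] dom_obj cod_obj)

lemma Mod_Hom: "Hom M V W = {arrow V W \<phi> | \<phi>. V \<in> Obj M \<and> W \<in> Obj M \<and> mod_map V W \<phi>}"
proof -
  have H: "Hom M V W = {(V, W, \<phi>) | \<phi>. V \<in> Obj M \<and> W \<in> Obj M \<and> \<phi> \<in> O_linear_maps C \<O> V W}"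
    by (auto simp: Hom_def O_Mod_def Let_def)
  show ?thesis
  proof (intro equalityI subsetI)
    fix f assume "f \<in> Hom M V W"
    then obtain \<phi> where o: "V \<in> Obj M" "W \<in> Obj M" and \<phi>: "\<phi> \<in> O_linear_maps C \<O> V W" and f: "f = (V, W, \<phi>)"
      by (auto simp: H)
    from \<phi> o have m: "mod_map V W \<phi>" and e: "\<phi> = (\<lambda>x \<in> Obj C. \<lambda>v \<in> el V x. \<phi> x v)"
      using linear_maps_iff by (auto simp: Mod_Obj)
    have "f = arrow V W \<phi>" unfolding f arrow_def using e by simp
    then show "f \<in> {arrow V W \<phi> | \<phi>. V \<in> Obj M \<and> W \<in> Obj M \<and> mod_map V W \<phi>}" using o m by blast
  next
    fix f assume "f \<in> {arrow V W \<phi> | \<phi>. V \<in> Obj M \<and> W \<in> Obj M \<and> mod_map V W \<phi>}"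
    then obtain \<phi> where o: "V \<in> Obj M" "W \<in> Obj M" and m: "mod_map V W \<phi>" and f: "f = arrow V W \<phi>" by blast
    have V: "Omod V" "Omod W" using o by (auto simp: Mod_Obj)
    have "(\<lambda>x \<in> Obj C. \<lambda>v \<in> el V x. \<phi> x v) \<in> O_linear_maps C \<O> V W"
      unfolding linear_maps_iff[OF V] mod_map_restrict[OF V(1)] using m by (auto intro!: restrict_ext)
    then show "f \<in> Hom M V W" using o by (simp add: H f arrow_def)
  qed
qed

lemma Mod_simps:
  "Dom M (arrow V W \<phi>) = V" "Cod M (arrow V W \<phi>) = W" "Ident M V = arrow V V (\<lambda>x v. v)"
  by (simp_all add: O_Mod_def Let_def arrow_def)

lemma Mod_Comp:
  assumes "mod_map V W \<phi>"
  shows "arrow W Z \<psi> \<bullet> arrow V W \<phi> = arrow V Z (\<lambda>x v. \<psi> x (\<phi> x v))"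
  using mod_mapD(1)[OF assms]
  by (auto simp: O_Mod_def Let_def arrow_def compose_def intro!: restrict_ext)

lemma Mod_Arr: "f \<in> Arr M \<longleftrightarrow> (\<exists>V W \<phi>. V \<in> Obj M \<and> W \<in> Obj M \<and> mod_map V W \<phi> \<and> f = arrow V W \<phi>)"
proof -
  have "f \<in> Arr M \<longleftrightarrow> (\<exists>V W. f \<in> Hom M V W)" by (auto simp: Hom_def)
  then show ?thesis unfolding Mod_Hom by blast
qed

lemma Mod_category: "category M"
proof
  fix f assume "f \<in> Arr M"
  then show "Dom M f \<in> Obj M" "Cod M f \<in> Obj M" by (auto simp: Mod_Arr Mod_simps)
next
  fix V assume "V \<in> Obj M"
  then show "Ident M V \<in> Hom M V V" using mod_map_ident by (auto simp: Mod_Hom Mod_simps)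
next
  fix f V W g Z assume "f \<in> Hom M V W" "g \<in> Hom M W Z"
  then obtain \<phi> \<psi> where "f = arrow V W \<phi>" "g = arrow W Z \<psi>" and m: "mod_map V W \<phi>" "mod_map W Z \<psi>"
    and "V \<in> Obj M" "Z \<in> Obj M" by (auto simp: Mod_Hom)
  then show "g \<bullet> f \<in> Hom M V Z" using mod_map_comp[OF m] by (auto simp: Mod_Comp[OF m(1)] Mod_Hom)
next
  fix f V W assume "f \<in> Hom M V W"
  then obtain \<phi> where "f = arrow V W \<phi>" "mod_map V W \<phi>" by (auto simp: Mod_Hom)
  then show "Ident M W \<bullet> f = f" "f \<bullet> Ident M V = f"
    by (simp_all add: Mod_simps Mod_Comp mod_map_ident)
next
  fix f V W g X h Z assume "f \<in> Hom M V W" "g \<in> Hom M W X" "h \<in> Hom M X Z"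
  then obtain \<phi> \<psi> \<chi> where "f = arrow V W \<phi>" "g = arrow W X \<psi>" "h = arrow X Z \<chi>"
    and m: "mod_map V W \<phi>" "mod_map W X \<psi>" by (auto simp: Mod_Hom)
  then show "h \<bullet> (g \<bullet> f) = (h \<bullet> g) \<bullet> f"
    by (simp add: Mod_Comp mod_map_comp[OF m])
qed

lemma Mod_HomI: "\<lbrakk>V \<in> Obj M; W \<in> Obj M; mod_map V W \<phi>\<rbrakk> \<Longrightarrow> arrow V W \<phi> \<in> Hom M V W"
  by (auto simp: Mod_Hom)

lemma Mod_ArrI: "\<lbrakk>V \<in> Obj M; W \<in> Obj M; mod_map V W \<phi>\<rbrakk> \<Longrightarrow> arrow V W \<phi> \<in> Arr M"
  by (auto simp: Mod_Arr)

lemma Mod_Omod: "V \<in> Obj M \<Longrightarrow> Omod V"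
  by (simp add: Mod_Obj)

section \<open>Zero objects, kernels and cokernels\<close>

lemma zero_mod_Obj: "zero_mod \<in> Obj M"
proof -
  have "{undefined} \<in> U"
    using U_infinite U_lepoll finite_lepoll_infinite[of _ "{undefined}"] by blast
  then show ?thesis using zero_mod_module by (simp add: Mod_Obj zero_mod_def)
qed

lemma zero_mod_object: "zero_object M zero_mod"
  unfolding zero_object_def
proof (intro conjI ballI zero_mod_Obj)
  fix V assume V: "V \<in> Obj M"
  note m = zero_mod_maps[OF Mod_Omod[OF V]]
  have el0: "el zero_mod x = {undefined}" "zr zero_mod x = undefined" for x
    by (simp_all add: zero_mod_def)
  show "\<exists>!f. f \<in> Hom M zero_mod V"
  proof (rule ex1I, rule Mod_HomI[OF zero_mod_Obj V m(2)])
    fix f assume "f \<in> Hom M zero_mod V"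
    then obtain \<phi> where "f = arrow zero_mod V \<phi>" "mod_map zero_mod V \<phi>" by (auto simp: Mod_Hom)
    then show "f = arrow zero_mod V (\<lambda>x v. zr V x)"
      using mod_map_zero[OF zero_mod_module Mod_Omod[OF V], of \<phi>] by (simp add: arrow_eq_iff el0)
  qed
  show "\<exists>!f. f \<in> Hom M V zero_mod"
  proof (rule ex1I, rule Mod_HomI[OF V zero_mod_Obj m(1)])
    fix f assume "f \<in> Hom M V zero_mod"
    then obtain \<phi> where "f = arrow V zero_mod \<phi>" "mod_map V zero_mod \<phi>" by (auto simp: Mod_Hom)
    then show "f = arrow V zero_mod (\<lambda>x v. undefined)"
      using mod_mapD(1)[of V zero_mod \<phi>] by (simp add: arrow_eq_iff el0)
  qed
qed

text \<open>The zero object in the definition is arbitrary, so nothing is known about its elements.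
  Uniqueness of the arrow from \<open>V\<close> into it forces that arrow to be the zero family, and
  linear maps preserve zero.\<close>

lemma zero_arrow_iff:
  assumes V: "V \<in> Obj M" "W \<in> Obj M" and \<phi>: "mod_map V W \<phi>"
  shows "zero_arrow M (arrow V W \<phi>) \<longleftrightarrow> (\<forall>x \<in> Obj C. \<forall>v \<in> el V x. \<phi> x v = zr W x)"
proof
  assume "zero_arrow M (arrow V W \<phi>)"
  then obtain Z g h where Z: "zero_object M Z" and g: "g \<in> Hom M V Z" and h: "h \<in> Hom M Z W"
    and e: "arrow V W \<phi> = h \<bullet> g" by (auto simp: zero_arrow_def Mod_simps)
  from g h obtain \<gamma> \<eta> where g': "g = arrow V Z \<gamma>" "mod_map V Z \<gamma>" and h': "h = arrow Z W \<eta>" "mod_map Z W \<eta>"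
    and ZO: "Z \<in> Obj M" by (auto simp: Mod_Hom)
  have "arrow V Z (\<lambda>x v. zr Z x) \<in> Hom M V Z"
    using Mod_HomI[OF V(1) ZO zero_map] Mod_Omod V ZO by blast
  moreover have "\<exists>!f. f \<in> Hom M V Z" using Z V by (simp add: zero_object_def)
  ultimately have "arrow V Z (\<lambda>x v. zr Z x) = arrow V Z \<gamma>" using g g' by blast
  then have \<gamma>: "\<gamma> x v = zr Z x" if "x \<in> Obj C" "v \<in> el V x" for x v using that by (simp add: arrow_eq_iff)
  from e have "\<phi> x v = \<eta> x (\<gamma> x v)" if "x \<in> Obj C" "v \<in> el V x" for x v
    using that by (simp add: g' h' Mod_Comp arrow_eq_iff)
  then show "\<forall>x \<in> Obj C. \<forall>v \<in> el V x. \<phi> x v = zr W x"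
    using \<gamma> mod_map_zero[OF Mod_Omod[OF ZO] Mod_Omod[OF V(2)] h'(2)] by simp
next
  assume z: "\<forall>x \<in> Obj C. \<forall>v \<in> el V x. \<phi> x v = zr W x"
  note mV = zero_mod_maps[OF Mod_Omod[OF V(1)]] and mW = zero_mod_maps[OF Mod_Omod[OF V(2)]]
  have "arrow V W \<phi> = arrow zero_mod W (\<lambda>x v. zr W x) \<bullet> arrow V zero_mod (\<lambda>x v. undefined)"
    using z by (simp add: Mod_Comp[OF mV(1)] arrow_eq_iff)
  then show "zero_arrow M (arrow V W \<phi>)"
    unfolding zero_arrow_def Mod_simps
    using zero_mod_object Mod_HomI[OF V(1) zero_mod_Obj mV(1)] Mod_HomI[OF zero_mod_Obj V(2) mW(2)]
    by blast
qed

lemma sub_mod_Obj: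
  assumes "V \<in> Obj M" "submodule_of N V"
  shows "sub_mod N V \<in> Obj M"
  using assms sub_mod_module[OF Mod_Omod[OF assms(1)] assms(2)] U_subset
  by (auto simp: Mod_Obj submodule_of_def)

lemma quot_Obj:
  assumes "V \<in> Obj M" "submodule_of N V"
  shows "quot N V \<in> Obj M"
proof -
  note V = Mod_Omod[OF assms(1)]
  have "el (quot N V) x \<in> U" if "x \<in> Obj C" for x
    using U_subset[OF _ quot_module(5)[OF V assms(2) that]] assms(1) that by (simp add: Mod_Obj)
  then show ?thesis using quot_module(1)[OF V assms(2)] by (simp add: Mod_Obj)
qed

lemma kernel:
  assumes V: "V \<in> Obj M" "W \<in> Obj M" and \<phi>: "mod_map V W \<phi>"
  defines "K \<equiv> sub_mod (kernel_of V W \<phi>) V"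
  shows "is_kernel M (arrow K V (\<lambda>x v. v)) (arrow V W \<phi>)"
proof -
  note O = Mod_Omod[OF V(1)] Mod_Omod[OF V(2)]
  note N = kernel_submodule[OF O \<phi>]
  have K: "K \<in> Obj M" unfolding K_def by (rule sub_mod_Obj[OF V(1) N])
  have elK: "v \<in> el K x \<longleftrightarrow> v \<in> el V x \<and> \<phi> x v = zr W x" for x v by (simp add: K_def kernel_of_def)
  have i: "mod_map K V (\<lambda>x v. v)" unfolding K_def by (rule sub_mod_incl[OF N])
  show ?thesis
    unfolding is_kernel_def Mod_simps Mod_Comp[OF i]
  proof (intro conjI ballI impI; (elim conjE)?)
    show "arrow V W \<phi> \<in> Arr M" "arrow K V (\<lambda>x v. v) \<in> Arr M" using Mod_ArrI V \<phi> K i by blast+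
    show "zero_arrow M (arrow K W \<phi>)"
      using zero_arrow_iff[OF K V(2) mod_map_comp[OF i \<phi>]] by (simp add: elK)
    fix h assume "h \<in> Arr M" and c: "Cod M h = V" and z: "zero_arrow M (arrow V W \<phi> \<bullet> h)"
    then obtain Z \<chi> where Z: "Z \<in> Obj M" and \<chi>: "mod_map Z V \<chi>" and h: "h = arrow Z V \<chi>"
      by (auto simp: Mod_Arr Mod_simps)
    have zk: "\<phi> x (\<chi> x v) = zr W x" if "x \<in> Obj C" "v \<in> el Z x" for x v
      using z zero_arrow_iff[OF Z V(2) mod_map_comp[OF \<chi> \<phi>]] that by (simp add: h Mod_Comp[OF \<chi>])
    have u: "mod_map Z K \<chi>"
      using \<chi> zk by (auto simp: mod_map_def elK) (auto simp: K_def)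
    show "\<exists>!u. u \<in> Hom M (Dom M h) K \<and> arrow K V (\<lambda>x v. v) \<bullet> u = h"
    proof (rule ex1I[of _ "arrow Z K \<chi>"])
      show "arrow Z K \<chi> \<in> Hom M (Dom M h) K \<and> arrow K V (\<lambda>x v. v) \<bullet> arrow Z K \<chi> = h"
        using Mod_HomI[OF Z K u] by (simp add: h Mod_simps Mod_Comp[OF u])
      fix u' assume u': "u' \<in> Hom M (Dom M h) K \<and> arrow K V (\<lambda>x v. v) \<bullet> u' = h"
      then obtain \<upsilon> where "u' = arrow Z K \<upsilon>" "mod_map Z K \<upsilon>" by (auto simp: h Mod_simps Mod_Hom)
      then show "u' = arrow Z K \<chi>" using u' by (simp add: h Mod_Comp arrow_eq_iff)
    qed
  qed simp_all
qed

lemma cokernel: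
  assumes V: "V \<in> Obj M" "W \<in> Obj M" and \<phi>: "mod_map V W \<phi>"
  defines "N \<equiv> image_of V \<phi>"
  shows "is_cokernel M (arrow W (quot N W) (quot_map N W)) (arrow V W \<phi>)"
proof -
  note O = Mod_Omod[OF V(1)] Mod_Omod[OF V(2)]
  have N: "submodule_of N W" unfolding N_def by (rule image_submodule[OF O \<phi>])
  define Q where "Q = quot N W"
  define q where "q = quot_map N W"
  have Q: "Q \<in> Obj M" unfolding Q_def by (rule quot_Obj[OF V(2) N])
  note qm = quot_module[OF O(2) N, folded Q_def q_def]
  have "is_cokernel M (arrow W Q q) (arrow V W \<phi>)"
    unfolding is_cokernel_def Mod_simps Mod_Comp[OF \<phi>]
  proof (intro conjI ballI impI; (elim conjE)?)
    show "arrow V W \<phi> \<in> Arr M" "arrow W Q q \<in> Arr M" using Mod_ArrI V \<phi> Q qm(2) by blast+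
    show "zero_arrow M (arrow V Q (\<lambda>x v. q x (\<phi> x v)))"
      using zero_arrow_iff[OF V(1) Q mod_map_comp[OF \<phi> qm(2)]] qm(4) mod_mapD(1)[OF \<phi>]
      by (simp add: N_def image_of_def)
    fix h assume "h \<in> Arr M" and "Dom M h = W" and z: "zero_arrow M (h \<bullet> arrow V W \<phi>)"
    then obtain Z \<chi> where Z: "Z \<in> Obj M" and \<chi>: "mod_map W Z \<chi>" and h: "h = arrow W Z \<chi>"
      by (auto simp: Mod_Arr Mod_simps)
    note OZ = Mod_Omod[OF Z]
    have zk: "\<chi> x w = zr Z x" if "x \<in> Obj C" "w \<in> N x" for x w
      using z zero_arrow_iff[OF V(1) Z mod_map_comp[OF \<phi> \<chi>]] that
      by (auto simp: h Mod_Comp[OF \<phi>] N_def image_of_def)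
    \<comment> \<open>Elements of the quotient are elements of \<open>W\<close>, so
      \<open>\<chi>\<close> itself is the factorization: a representative differs from
      \<open>w\<close> by an element of the image, where \<open>\<chi>\<close> vanishes.\<close>
    have \<chi>q: "\<chi> x (q x w) = \<chi> x w" if x: "x \<in> Obj C" and w: "w \<in> el W x" for x w
      using mod_map_eq_iff[OF O(2) OZ \<chi> x _ w, of "q x w"] quot_map[OF O(2) N x w] zk[OF x]
      by (simp add: q_def)
    have u: "mod_map Q Z \<chi>" using mod_map_factor[OF O(2) qm(2,3) \<chi> \<chi>q] .
    show "\<exists>!u. u \<in> Hom M Q (Cod M h) \<and> u \<bullet> arrow W Q q = h"
    proof (rule ex1I[of _ "arrow Q Z \<chi>"])
      show "arrow Q Z \<chi> \<in> Hom M Q (Cod M h) \<and> arrow Q Z \<chi> \<bullet> arrow W Q q = h"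
        using Mod_HomI[OF Q Z u] \<chi>q by (simp add: h Mod_simps Mod_Comp[OF qm(2)] arrow_eq_iff)
      fix u' assume u': "u' \<in> Hom M Q (Cod M h) \<and> u' \<bullet> arrow W Q q = h"
      then obtain \<upsilon> where e: "u' = arrow Q Z \<upsilon>" "mod_map Q Z \<upsilon>" by (auto simp: h Mod_simps Mod_Hom)
      then have "\<upsilon> x (q x w) = \<chi> x (q x w)" if "x \<in> Obj C" "w \<in> el W x" for x w
        using u' \<chi>q that by (simp add: h Mod_Comp[OF qm(2)] arrow_eq_iff)
      then show "u' = arrow Q Z \<chi>" by (simp add: e arrow_eq_iff qm(3))
    qed
  qed simp_all
  then show ?thesis by (simp add: Q_def q_def)
qed

section \<open>Inverted arrows as local isomorphisms\<close>

abbreviation "T \<equiv> torsion_modules C J \<O> U"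

lemma torsion_Obj: "V \<in> Obj T \<longleftrightarrow> V \<in> Obj M \<and>
    (\<forall>x \<in> Obj C. \<forall>v \<in> el V x. cov x (\<lambda>f. Res V f v = zr V (Cod C f)))"
  by (auto simp: torsion_modules_def full_subcategory_def torsion_module_def torsion_element_iff)

text \<open>Torsion of the explicit kernel \<open>K\<close> and cokernel \<open>Q\<close> is local
  injectivity and local surjectivity. Since \<open>inverted\<close> offers only some kernel and some
  cokernel in \<open>T\<close>, these are first compared with \<open>K\<close> and \<open>Q\<close>
  by their universal properties.\<close>

lemma inverted_iff:
  assumes V: "V \<in> Obj M" "W \<in> Obj M" and \<phi>: "mod_map V W \<phi>"
  shows "arrow V W \<phi> \<in> inverted M T \<longleftrightarrow> loc_inj V W \<phi> \<and> loc_surj V W \<phi>"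
proof -
  note O = Mod_Omod[OF V(1)] Mod_Omod[OF V(2)]
  define K where "K = sub_mod (kernel_of V W \<phi>) V"
  have Ns: "submodule_of (kernel_of V W \<phi>) V" by (rule kernel_submodule[OF O \<phi>])
  have K: "K \<in> Obj M" unfolding K_def by (rule sub_mod_Obj[OF V(1) Ns])
  have elK: "v \<in> el K x \<longleftrightarrow> v \<in> el V x \<and> \<phi> x v = zr W x" "zr K x = zr V x" "Res K = Res V" for x v
    by (simp_all add: K_def kernel_of_def)
  note ker = kernel[OF V \<phi>, folded K_def]
  define N where "N = image_of V \<phi>"
  have N: "submodule_of N W" unfolding N_def by (rule image_submodule[OF O \<phi>])
  define Q where "Q = quot N W"
  define q where "q = quot_map N W"
  have Q: "Q \<in> Obj M" unfolding Q_def by (rule quot_Obj[OF V(2) N])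
  note qm = quot_module[OF O(2) N, folded Q_def q_def]
  note coker = cokernel[OF V \<phi>, folded N_def, folded Q_def q_def]
  have N_iff: "w \<in> N x \<longleftrightarrow> (\<exists>v \<in> el V x. \<phi> x v = w)" for x w by (auto simp: N_def image_of_def)
  show ?thesis
  proof
    assume "arrow V W \<phi> \<in> inverted M T"
    then obtain k c where k: "is_kernel M k (arrow V W \<phi>)" "Dom M k \<in> Obj T"
      and c: "is_cokernel M c (arrow V W \<phi>)" "Cod M c \<in> Obj T" by (auto simp: inverted_def)
    show "loc_inj V W \<phi> \<and> loc_surj V W \<phi>"
    proof
      from k obtain L \<kappa> where L: "L \<in> Obj M" and \<kappa>: "mod_map L V \<kappa>" and k': "k = arrow L V \<kappa>"
        by (auto simp: is_kernel_def Mod_Arr Mod_simps)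
      from ker have "arrow K V (\<lambda>x v. v) \<in> Arr M \<and> Cod M (arrow K V (\<lambda>x v. v)) = Dom M (arrow V W \<phi>) \<and>
          zero_arrow M (arrow V W \<phi> \<bullet> arrow K V (\<lambda>x v. v))" by (simp add: is_kernel_def)
      with k(1) have "\<exists>!u. u \<in> Hom M (Dom M (arrow K V (\<lambda>x v. v))) (Dom M k) \<and> k \<bullet> u = arrow K V (\<lambda>x v. v)"
        unfolding is_kernel_def by blast
      then obtain u where "u \<in> Hom M K L" "k \<bullet> u = arrow K V (\<lambda>x v. v)" by (auto simp: k' Mod_simps)
      \<comment> \<open>The explicit kernel factors through the given one, so each element killed by
        \<open>\<phi>\<close> is the image of a torsion element.\<close>
      then obtain \<upsilon> where \<upsilon>: "mod_map K L \<upsilon>" and e: "\<And>x v. \<lbrakk>x \<in> Obj C; v \<in> el K x\<rbrakk> \<Longrightarrow> \<kappa> x (\<upsilon> x v) = v"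
        by (auto simp: Mod_Hom k' Mod_Comp arrow_eq_iff)
      show "loc_inj V W \<phi>"
        unfolding loc_inj_def
      proof (intro ballI impI)
        fix x v assume x: "x \<in> Obj C" and v: "v \<in> el V x" "\<phi> x v = zr W x"
        then have vK: "v \<in> el K x" by (simp add: elK)
        have "cov x (\<lambda>f. Res L f (\<upsilon> x v) = zr L (Cod C f))"
          using k(2) x mod_mapD(1)[OF \<upsilon> x vK] by (simp add: k' Mod_simps torsion_Obj)
        then show "cov x (\<lambda>f. Res V f v = zr V (Cod C f))"
        proof (rule cov_mono[OF _ x])
          fix f assume f: "f \<in> Arr C" "Dom C f = x" and "Res L f (\<upsilon> x v) = zr L (Cod C f)"
          then show "Res V f v = zr V (Cod C f)"
            using mod_mapD(4)[OF \<kappa> f(1), of "\<upsilon> x v"] e[OF x vK] mod_mapD(1)[OF \<upsilon> x vK]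
              mod_map_zero[OF Mod_Omod[OF L] O(1) \<kappa> cod_obj[OF f(1)]] by simp
        qed
      qed
      from c obtain L' \<gamma> where L': "L' \<in> Obj M" and \<gamma>: "mod_map W L' \<gamma>" and c': "c = arrow W L' \<gamma>"
        by (auto simp: is_cokernel_def Mod_Arr Mod_simps)
      from coker have "arrow W Q q \<in> Arr M \<and> Dom M (arrow W Q q) = Cod M (arrow V W \<phi>) \<and>
          zero_arrow M (arrow W Q q \<bullet> arrow V W \<phi>)" by (simp add: is_cokernel_def)
      with c(1) have "\<exists>!u. u \<in> Hom M (Cod M c) (Cod M (arrow W Q q)) \<and> u \<bullet> c = arrow W Q q"
        unfolding is_cokernel_def by blast
      then obtain u where "u \<in> Hom M L' Q" "u \<bullet> c = arrow W Q q" by (auto simp: c' Mod_simps)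
      \<comment> \<open>Dually, \<open>q\<close> factors through the given cokernel. Since
        \<open>\<gamma> x w\<close> is torsion, \<open>q\<close> kills the restrictions of
        \<open>w\<close> on a cover, which places them in the image of
        \<open>\<phi>\<close>.\<close>
      then obtain \<upsilon> where \<upsilon>: "mod_map L' Q \<upsilon>" and e: "\<And>x w. \<lbrakk>x \<in> Obj C; w \<in> el W x\<rbrakk> \<Longrightarrow> \<upsilon> x (\<gamma> x w) = q x w"
        by (auto simp: Mod_Hom c' Mod_Comp[OF \<gamma>] arrow_eq_iff)
      show "loc_surj V W \<phi>"
        unfolding loc_surj_def N_iff[symmetric]
      proof (intro ballI)
        fix x w assume x: "x \<in> Obj C" and w: "w \<in> el W x"
        have "cov x (\<lambda>f. Res L' f (\<gamma> x w) = zr L' (Cod C f))"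
          using c(2) x mod_mapD(1)[OF \<gamma> x w] by (simp add: c' Mod_simps torsion_Obj)
        then show "cov x (\<lambda>f. Res W f w \<in> N (Cod C f))"
        proof (rule cov_mono[OF _ x])
          fix f assume f: "f \<in> Arr C" "Dom C f = x" and "Res L' f (\<gamma> x w) = zr L' (Cod C f)"
          then have "\<upsilon> (Cod C f) (\<gamma> (Cod C f) (Res W f w)) = zr Q (Cod C f)"
            using mod_mapD(4)[OF \<gamma> f(1), of w] w
              mod_map_zero[OF Mod_Omod[OF L'] Mod_Omod[OF Q] \<upsilon> cod_obj[OF f(1)]] by simp
          moreover have r: "Res W f w \<in> el W (Cod C f)" using mod_res[OF O(2) f(1)] f(2) w by simp
          ultimately show "Res W f w \<in> N (Cod C f)"
            using e[OF cod_obj[OF f(1)] r] qm(4)[OF cod_obj[OF f(1)] r] by simp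
        qed
      qed
    qed
  next
    assume l: "loc_inj V W \<phi> \<and> loc_surj V W \<phi>"
    have "K \<in> Obj T" using K l by (simp add: torsion_Obj elK loc_inj_def)
    moreover have "Q \<in> Obj T"
      unfolding torsion_Obj qm(3)
    proof (intro conjI Q ballI; elim imageE; hypsubst)
      fix x w assume x: "x \<in> Obj C" and w: "w \<in> el W x"
      have "cov x (\<lambda>f. Res W f w \<in> N (Cod C f))" using l x w by (simp add: loc_surj_def N_iff)
      then show "cov x (\<lambda>f. Res Q f (q x w) = zr Q (Cod C f))"
      proof (rule cov_mono[OF _ x])
        fix f assume f: "f \<in> Arr C" "Dom C f = x" and n: "Res W f w \<in> N (Cod C f)"
        have "Res W f w \<in> el W (Cod C f)" using mod_res[OF O(2) f(1)] f(2) w by simp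
        then have "q (Cod C f) (Res W f w) = zr Q (Cod C f)" using qm(4)[OF cod_obj[OF f(1)]] n by simp
        then show "Res Q f (q x w) = zr Q (Cod C f)"
          using mod_mapD(4)[OF qm(2) f(1), of w] w f(2) by simp
      qed
    qed
    moreover have "arrow V W \<phi> \<in> Arr M" using Mod_ArrI[OF V \<phi>] .
    ultimately show "arrow V W \<phi> \<in> inverted M T"
      unfolding inverted_def using ker coker
      by (intro CollectI conjI exI[of _ "arrow K V (\<lambda>x v. v)"] exI[of _ "arrow W Q q"])
        (simp_all add: Mod_simps)
  qed
qed

lemma inverted_obtain:
  assumes "s \<in> inverted M T"
  obtains V W \<sigma> where "V \<in> Obj M" "W \<in> Obj M" "mod_map V W \<sigma>" "s = arrow V W \<sigma>"
    "loc_inj V W \<sigma>" "loc_surj V W \<sigma>"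
proof -
  from assms have "s \<in> Arr M" by (simp add: inverted_def)
  then obtain V W \<sigma> where "V \<in> Obj M" "W \<in> Obj M" "mod_map V W \<sigma>" "s = arrow V W \<sigma>" by (auto simp: Mod_Arr)
  then show ?thesis using that assms inverted_iff by blast
qed

section \<open>Right fractions of local isomorphisms\<close>

lemma inclusion_loc_inj: "loc_inj (sub_mod N V) V (\<lambda>x v. v)" if "Omod V"
  unfolding loc_inj_def sub_mod_simps
proof (intro ballI impI cov_all)
  fix x v f assume "v = zr V x" "f \<in> Arr C" "Dom C f = x"
  then show "Res V f v = zr V (Cod C f)" using mod_res_zero[OF that, of f] by simp
qed

text \<open>The square is the fibre product of \<open>f\<close> and \<open>t\<close>. Local
  isomorphisms are stable under base change, so its projection to \<open>X\<close> is
  inverted.\<close>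

lemma inverted_ore:
  assumes t: "t \<in> inverted M T" and f: "f \<in> Hom M X (Cod M t)"
  shows "\<exists>W u h. u \<in> inverted M T \<and> u \<in> Hom M W X \<and> h \<in> Hom M W (Dom M t) \<and> f \<bullet> u = t \<bullet> h"
proof -
  from t obtain Y' Y \<tau> where Y: "Y' \<in> Obj M" "Y \<in> Obj M" and \<tau>: "mod_map Y' Y \<tau>" and t': "t = arrow Y' Y \<tau>"
    and l: "loc_inj Y' Y \<tau>" "loc_surj Y' Y \<tau>" by (rule inverted_obtain)
  from f obtain \<phi> where X: "X \<in> Obj M" and \<phi>: "mod_map X Y \<phi>" and f': "f = arrow X Y \<phi>"
    by (auto simp: t' Mod_simps Mod_Hom)
  note O = Mod_Omod[OF X] Mod_Omod[OF Y(1)] Mod_Omod[OF Y(2)]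
  define P where "P = prod_mod X Y'"
  have P: "Omod P" unfolding P_def by (rule prod_mod_module[OF O(1,2)])
  have elP: "el P x = el X x \<times> el Y' x" "zr P x = (zr X x, zr Y' x)"
    "Res P f p = (Res X f (fst p), Res Y' f (snd p))" for x f p by (simp_all add: P_def prod_mod_def)
  note pr = prod_mod_maps[of X Y', folded P_def]
  define N where "N = equalizer_of P (\<lambda>x p. \<phi> x (fst p)) (\<lambda>x p. \<tau> x (snd p))"
  have N: "submodule_of N P"
    unfolding N_def by (rule equalizer_submodule[OF P O(3) mod_map_comp[OF pr(1) \<phi>] mod_map_comp[OF pr(2) \<tau>]])
  have N_iff: "p \<in> N x \<longleftrightarrow> fst p \<in> el X x \<and> snd p \<in> el Y' x \<and> \<phi> x (fst p) = \<tau> x (snd p)" for p x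
    by (cases p) (auto simp: N_def equalizer_of_def elP)
  define E where "E = sub_mod N P"
  have E: "Omod E" unfolding E_def by (rule sub_mod_module[OF P N])
  have elE: "el E x = N x" "zr E x = (zr X x, zr Y' x)" "Res E f p = (Res X f (fst p), Res Y' f (snd p))" for x f p
    by (simp_all add: E_def elP)
  note incl = sub_mod_incl[OF N, folded E_def]
  have e1: "mod_map E X (\<lambda>x. fst)" and e2: "mod_map E Y' (\<lambda>x. snd)"
    using mod_map_comp[OF incl pr(1)] mod_map_comp[OF incl pr(2)] by simp_all
  \<comment> \<open>The fibre product consists of pairs and has left the type \<open>'v\<close>;
    being small, it has an isomorphic copy \<open>W\<close> in the category.\<close>
  have "small (el E x)" if "x \<in> Obj C" for x
  proof (rule small_lepoll[OF small_times[of "el X x" "el Y' x"]])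
    show "el X x \<in> U" "el Y' x \<in> U" using X Y that by (auto simp: Mod_Obj)
    show "el E x \<lesssim> el X x \<times> el Y' x"
      by (rule subset_imp_lepoll) (auto simp: elE N_iff mem_Times_iff)
  qed
  from transport[OF E this] obtain W \<theta> where W: "W \<in> Obj M" and \<theta>: "iso_map E W \<theta>" by blast
  define \<psi> where "\<psi> = (\<lambda>x. inv_into (el E x) (\<theta> x))"
  have \<psi>: "iso_map W E \<psi>" unfolding \<psi>_def by (rule iso_map_inverse(1)[OF E \<theta>])
  then have \<psi>m: "mod_map W E \<psi>" by (simp add: iso_map_def)
  note \<psi>l = iso_map_loc[OF Mod_Omod[OF W] E \<psi>]
  \<comment> \<open>If the first component vanishes, the second is killed by \<open>\<tau>\<close>,
    hence torsion.\<close>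
  have "loc_inj E X (\<lambda>x. fst)"
    unfolding loc_inj_def
  proof (intro ballI impI)
    fix x p assume x: "x \<in> Obj C" and "p \<in> el E x" and z: "fst p = zr X x"
    then have p: "snd p \<in> el Y' x" "\<phi> x (fst p) = \<tau> x (snd p)" by (auto simp: elE N_iff)
    then have "\<tau> x (snd p) = zr Y x" using z mod_map_zero[OF O(1,3) \<phi> x] by simp
    then have "cov x (\<lambda>f. Res Y' f (snd p) = zr Y' (Cod C f))" using l(1) p(1) x by (simp add: loc_inj_def)
    then show "cov x (\<lambda>f. Res E f p = zr E (Cod C f))"
      by (rule cov_mono[OF _ x]) (use z mod_res_zero[OF O(1)] in \<open>auto simp: elE\<close>)
  qed
  then have li: "loc_inj W X (\<lambda>x w. fst (\<psi> x w))"
    by (rule loc_inj_comp[OF Mod_Omod[OF W] E \<psi>m \<psi>l(1)])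
  have "loc_surj E X (\<lambda>x. fst)"
    unfolding loc_surj_def
  proof (intro ballI)
    fix x v assume x: "x \<in> Obj C" and v: "v \<in> el X x"
    \<comment> \<open>A local preimage of \<open>\<phi> x v\<close> under \<open>\<tau>\<close>,
      paired with the restriction of \<open>v\<close>, is a point of the fibre product.\<close>
    have "cov x (\<lambda>f. \<exists>y \<in> el Y' (Cod C f). \<tau> (Cod C f) y = Res Y f (\<phi> x v))"
      using l(2) x mod_mapD(1)[OF \<phi> x v] by (simp add: loc_surj_def)
    then show "cov x (\<lambda>f. \<exists>p \<in> el E (Cod C f). fst p = Res X f v)"
    proof (rule cov_mono[OF _ x], elim bexE)
      fix f y assume f: "f \<in> Arr C" "Dom C f = x" and y: "y \<in> el Y' (Cod C f)" "\<tau> (Cod C f) y = Res Y f (\<phi> x v)"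
      then show "\<exists>p \<in> el E (Cod C f). fst p = Res X f v"
        using mod_mapD(4)[OF \<phi> f(1), of v] mod_res[OF O(1) f(1), of v] v
        by (intro bexI[of _ "(Res X f v, y)"]) (simp_all add: elE N_iff)
    qed
  qed
  then have ls: "loc_surj W X (\<lambda>x w. fst (\<psi> x w))"
    by (rule loc_surj_comp[OF E O(1) \<psi>m e1 \<psi>l(2)])
  note u = mod_map_comp[OF \<psi>m e1] and h = mod_map_comp[OF \<psi>m e2]
  let ?u = "arrow W X (\<lambda>x w. fst (\<psi> x w))" and ?h = "arrow W Y' (\<lambda>x w. snd (\<psi> x w))"
  have "?u \<in> inverted M T" using inverted_iff[OF W X u] li ls by simp
  moreover have "?u \<in> Hom M W X" "?h \<in> Hom M W (Dom M t)"
    using Mod_HomI[OF W X u] Mod_HomI[OF W Y(1) h] by (simp_all add: t' Mod_simps)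
  moreover have "f \<bullet> ?u = t \<bullet> ?h"
    using mod_mapD(1)[OF \<psi>m] by (simp add: f' t' Mod_Comp[OF u] Mod_Comp[OF h] arrow_eq_iff elE N_iff)
  ultimately show ?thesis by blast
qed

text \<open>The arrow \<open>e\<close> is the inclusion of the equalizer of \<open>f\<close> and
  \<open>g\<close>. The difference of their values at an element is killed by \<open>t\<close>,
  hence torsion, so on a cover the restrictions of that element lie in the equalizer.\<close>

lemma inverted_cancel:
  assumes t: "t \<in> inverted M T" and f: "f \<in> Hom M X (Dom M t)" and g: "g \<in> Hom M X (Dom M t)"
    and eq: "t \<bullet> f = t \<bullet> g"
  shows "\<exists>W e. e \<in> inverted M T \<and> e \<in> Hom M W X \<and> f \<bullet> e = g \<bullet> e"
proof -
  from t obtain Y Z \<tau> where Y: "Y \<in> Obj M" "Z \<in> Obj M" and \<tau>: "mod_map Y Z \<tau>" and t': "t = arrow Y Z \<tau>"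
    and l: "loc_inj Y Z \<tau>" "loc_surj Y Z \<tau>" by (rule inverted_obtain)
  from f g obtain \<phi> \<gamma> where X: "X \<in> Obj M" and \<phi>: "mod_map X Y \<phi>" and f': "f = arrow X Y \<phi>"
    and \<gamma>: "mod_map X Y \<gamma>" and g': "g = arrow X Y \<gamma>"
    by (auto simp: t' Mod_simps Mod_Hom)
  note O = Mod_Omod[OF X] Mod_Omod[OF Y(1)] Mod_Omod[OF Y(2)]
  define N where "N = equalizer_of X \<phi> \<gamma>"
  have N: "submodule_of N X" unfolding N_def by (rule equalizer_submodule[OF O(1,2) \<phi> \<gamma>])
  define E where "E = sub_mod N X"
  have E: "E \<in> Obj M" unfolding E_def by (rule sub_mod_Obj[OF X N])
  have i: "mod_map E X (\<lambda>x v. v)" unfolding E_def by (rule sub_mod_incl[OF N])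
  have "loc_surj E X (\<lambda>x v. v)"
    unfolding loc_surj_def
  proof (intro ballI)
    fix x v assume x: "x \<in> Obj C" and v: "v \<in> el X x"
    note pv = mod_mapD(1)[OF \<phi> x v] and gv = mod_mapD(1)[OF \<gamma> x v]
    have "\<tau> x (\<phi> x v) = \<tau> x (\<gamma> x v)"
      using eq x v by (simp add: t' f' g' Mod_Comp[OF \<phi>] Mod_Comp[OF \<gamma>] arrow_eq_iff)
    then have "\<tau> x (mi Y x (\<phi> x v) (\<gamma> x v)) = zr Z x" using mod_map_eq_iff[OF O(2,3) \<tau> x pv gv] by simp
    then have "cov x (\<lambda>f. Res Y f (mi Y x (\<phi> x v) (\<gamma> x v)) = zr Y (Cod C f))"
      using l(1) x mod_closed(3)[OF O(2) x pv gv] by (simp add: loc_inj_def)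
    then show "cov x (\<lambda>f. \<exists>w \<in> el E (Cod C f). w = Res X f v)"
    proof (rule cov_mono[OF _ x])
      fix f assume f: "f \<in> Arr C" "Dom C f = x" and "Res Y f (mi Y x (\<phi> x v) (\<gamma> x v)) = zr Y (Cod C f)"
      then have "Res Y f (\<phi> x v) = Res Y f (\<gamma> x v)"
        using mod_res_minus[OF O(2) f(1), of "\<phi> x v" "\<gamma> x v"] pv gv mod_res[OF O(2) f(1), of "\<phi> x v"]
          mod_res[OF O(2) f(1), of "\<gamma> x v"] mod_diff_zero_iff[OF O(2) cod_obj[OF f(1)], of "Res Y f (\<phi> x v)" "Res Y f (\<gamma> x v)"]
        by simp
      then show "\<exists>w \<in> el E (Cod C f). w = Res X f v"
        using mod_mapD(4)[OF \<phi> f(1), of v] mod_mapD(4)[OF \<gamma> f(1), of v] f v mod_res[OF O(1) f(1), of v]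
        by (simp add: E_def N_def equalizer_of_def)
    qed
  qed
  then have "arrow E X (\<lambda>x v. v) \<in> inverted M T"
    using inverted_iff[OF E X i] inclusion_loc_inj[OF O(1)] by (simp add: E_def)
  moreover have "arrow E X (\<lambda>x v. v) \<in> Hom M E X" by (rule Mod_HomI[OF E X i])
  moreover have "f \<bullet> arrow E X (\<lambda>x v. v) = g \<bullet> arrow E X (\<lambda>x v. v)"
    unfolding f' g' Mod_Comp[OF i] arrow_eq_iff by (simp add: E_def N_def equalizer_of_def)
  ultimately show ?thesis by blast
qed

section \<open>Sheaves as a reflective class\<close>

lemma sheafification:
  assumes X: "X \<in> Obj M"
  shows "\<exists>e \<in> inverted M T. Dom M e = X \<and> Cod M e \<in> {V. is_sheaf C J (underlying V)}"
proof -
  note O = Mod_Omod[OF X]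
  define Q where "Q = quot (torsion_of X) X"
  define q where "q = quot_map (torsion_of X) X"
  have Q: "Q \<in> Obj M" unfolding Q_def by (rule quot_Obj[OF X torsion_submodule[OF O]])
  note OQ = Mod_Omod[OF Q]
  have q: "mod_map X Q q" unfolding Q_def q_def by (rule quot_module(2)[OF O torsion_submodule[OF O]])
  note qt = quot_torsion[OF O, folded Q_def q_def]
  note Pm = plus_module[OF OQ qt(1)]
  \<comment> \<open>Germs are sets of pairs, so the plus construction also changes the element type;
    smallness brings it back as an isomorphic sheaf \<open>F\<close>.\<close>
  have "small (el (Plus Q) x)" if "x \<in> Obj C" for x using small_germs[OF Q that] by simp
  from transport[OF Pm this] obtain F \<theta> where F: "F \<in> Obj M" and \<theta>: "iso_map (Plus Q) F \<theta>" by blast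
  note OF' = Mod_Omod[OF F]
  from \<theta> have \<theta>m: "mod_map (Plus Q) F \<theta>" by (simp add: iso_map_def)
  note g = germ_map[OF OQ qt(1)] germ_loc_inj[OF OQ qt(1)] germ_loc_surj[OF OQ qt(1)]
  note \<theta>l = iso_map_loc[OF Pm OF' \<theta>]
  note m1 = mod_map_comp[OF q g(1)]
  note m2 = mod_map_comp[OF m1 \<theta>m]
  have "loc_inj X F (\<lambda>x v. \<theta> x (germ Q x (q x v)))"
    by (rule loc_inj_comp[OF O Pm m1 loc_inj_comp[OF O OQ q qt(2) g(2)] \<theta>l(1)])
  moreover have "loc_surj X F (\<lambda>x v. \<theta> x (germ Q x (q x v)))"
    by (rule loc_surj_comp[OF Pm OF' m1 \<theta>m loc_surj_comp[OF OQ Pm q g(1) qt(3) g(3)] \<theta>l(2)])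
  ultimately have "arrow X F (\<lambda>x v. \<theta> x (germ Q x (q x v))) \<in> inverted M T"
    using inverted_iff[OF X F m2] by simp
  moreover have "is_sheaf C J (underlying F)"
    unfolding is_sheaf_iff[OF OF']
    using iso_map_separated[OF Pm \<theta> plus_separated[OF OQ qt(1)]] iso_map_gluing[OF Pm \<theta> plus_gluing[OF OQ qt(1)]] ..
  ultimately show ?thesis by (intro bexI) (simp_all add: Mod_simps)
qed

lemma sheaf_local:
  assumes s: "s \<in> inverted M T" "s \<in> Hom M X Y" and Z: "Z \<in> Obj M" "is_sheaf C J (underlying Z)"
    and h: "h \<in> Hom M X Z"
  shows "\<exists>!k. k \<in> Hom M Y Z \<and> k \<bullet> s = h"
proof -
  from s(2) obtain \<sigma> where X: "X \<in> Obj M" "Y \<in> Obj M" and \<sigma>: "mod_map X Y \<sigma>" and s': "s = arrow X Y \<sigma>"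
    by (auto simp: Mod_Hom)
  from s(1) have l: "loc_inj X Y \<sigma>" "loc_surj X Y \<sigma>" using inverted_iff[OF X \<sigma>] s' by simp_all
  from h obtain \<chi> where \<chi>: "mod_map X Z \<chi>" and h': "h = arrow X Z \<chi>" by (auto simp: Mod_Hom)
  note O = Mod_Omod[OF X(1)] Mod_Omod[OF X(2)] Mod_Omod[OF Z(1)]
  have sh: "separated Z" "gluing Z" using Z(2) is_sheaf_iff[OF O(3)] by simp_all
  obtain \<phi> where \<phi>: "mod_map Y Z \<phi>" and e: "\<And>x v. \<lbrakk>x \<in> Obj C; v \<in> el X x\<rbrakk> \<Longrightarrow> \<phi> x (\<sigma> x v) = \<chi> x v"
    using sheaf_local_exists[OF sh O \<sigma> l \<chi>] by auto
  show ?thesis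
  proof (rule ex1I[of _ "arrow Y Z \<phi>"])
    show "arrow Y Z \<phi> \<in> Hom M Y Z \<and> arrow Y Z \<phi> \<bullet> s = h"
      using Mod_HomI[OF X(2) Z(1) \<phi>] e by (simp add: s' h' Mod_Comp[OF \<sigma>] arrow_eq_iff)
    fix k assume k: "k \<in> Hom M Y Z \<and> k \<bullet> s = h"
    then obtain \<psi> where \<psi>: "mod_map Y Z \<psi>" and k': "k = arrow Y Z \<psi>" by (auto simp: Mod_Hom)
    have eq: "\<psi> x (\<sigma> x v) = \<phi> x (\<sigma> x v)" if "x \<in> Obj C" "v \<in> el X x" for x v
      using k e that by (simp add: k' s' h' Mod_Comp[OF \<sigma>] arrow_eq_iff)
    show "k = arrow Y Z \<phi>"
      unfolding k' arrow_eq_iff using sheaf_local_unique[OF sh(1) O(2,3) \<sigma> l(2) \<psi> \<phi> eq] by simp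
  qed
qed

lemma inverted_ident:
  assumes X: "X \<in> Obj M"
  shows "Ident M X \<in> inverted M T"
proof -
  have "iso_map X X (\<lambda>x v. v)" using mod_map_ident by (simp add: iso_map_def bij_betw_def)
  from iso_map_loc[OF Mod_Omod[OF X] Mod_Omod[OF X] this]
  show ?thesis using inverted_iff[OF X X mod_map_ident] by (simp add: Mod_simps)
qed

lemma inverted_comp:
  assumes "s \<in> inverted M T" "t \<in> inverted M T" "Cod M s = Dom M t"
  shows "t \<bullet> s \<in> inverted M T"
proof -
  from assms(1) obtain X Y \<sigma> where X: "X \<in> Obj M" "Y \<in> Obj M" and \<sigma>: "mod_map X Y \<sigma>" and s: "s = arrow X Y \<sigma>"
    and l: "loc_inj X Y \<sigma>" "loc_surj X Y \<sigma>" by (rule inverted_obtain)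
  from assms(2) obtain Y' Z \<tau> where t': "t = arrow Y' Z \<tau>" and Z: "Z \<in> Obj M" and "mod_map Y' Z \<tau>"
    "loc_inj Y' Z \<tau>" "loc_surj Y' Z \<tau>" by (rule inverted_obtain)
  moreover have "Y' = Y" using assms(3) by (simp add: s t' Mod_simps)
  ultimately have \<tau>: "mod_map Y Z \<tau>" and t: "t = arrow Y Z \<tau>"
    and l': "loc_inj Y Z \<tau>" "loc_surj Y Z \<tau>" by simp_all
  note O = Mod_Omod[OF X(1)] Mod_Omod[OF X(2)] Mod_Omod[OF Z]
  show ?thesis
    using inverted_iff[OF X(1) Z mod_map_comp[OF \<sigma> \<tau>]] loc_inj_comp[OF O(1,2) \<sigma> l(1) l'(1)]
      loc_surj_comp[OF O(2,3) \<sigma> \<tau> l(2) l'(2)] by (simp add: s t Mod_Comp[OF \<sigma>])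
qed

lemma reflective_fractions:
  "reflective_fractions M (inverted M T) {V. is_sheaf C J (underlying V)}"
proof (rule reflective_fractions.intro[OF Mod_category reflective_fractions_axioms.intro])
  show "s \<in> inverted M T \<Longrightarrow> s \<in> Arr M" for s by (simp add: inverted_def)
qed ((rule inverted_ident inverted_comp inverted_ore inverted_cancel sheafification sheaf_local;
    (assumption | simp))+)

end

theorem corollary1p2:
  fixes C :: "('o, 'm) cat"
    and J :: "'o \<Rightarrow> 'm set set"
    and \<O> :: "('o, 'm, 'r ring, 'r) presheaf"
    and U :: "'v set set"
  assumes "category C"
    and "grothendieck_topology C J"
    and "structure_sheaf C J \<O>"
    and "universe_over (Arr C) U"
  shows "equivalent_categories
    (Sh C J \<O> U)
    (serre_quotient (O_Mod C \<O> U) (torsion_modules C J \<O> U))"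
proof -
  have "ringed_site_universe C J \<O> U"
    using assms by (auto simp: ringed_site_universe_def ringed_site_def ringed_site_axioms_def
        ringed_site_universe_axioms_def structure_sheaf_def)
  \<comment> \<open>Unfolded, the two sides are the full subcategory on the sheaves and the
    localization at the inverted arrows, which are \<open>Sub\<close> and \<open>Loc\<close> for
    this instance of the locale.\<close>
  then show ?thesis
    unfolding Sh_def serre_quotient_def
    by (rule reflective_fractions.equivalence[OF ringed_site_universe.reflective_fractions])
qed

end
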